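(* Let $X_1,\dots,X_n$ be independent zero-mean (integrable) real random variables, and let $U_1,\dots,U_n$ be independent random variables uniformly distributed on $[0,1]$ which are also independent of $X_1,\dots,X_n$. Let $\mathsf r_i:=\mathsf r_{X_i}$ be the reciprocating function of $X_i$, let $W_i:=|X_i-\mathsf r_i(X_i,U_i)|$, and let $$S_W:=\frac{X_1+\dots+X_n}{\frac12\sqrt{W_1^2+\dots+W_n^2}},\qquad \tfrac00:=0 .$$ Let $Z$ be a standard normal random variable. Then $$\mathsf E f(S_W)\le\mathsf E f(Z)\quad\text{for all } f\in\mathcal H_+^5,$$ and $$\mathsf P(S_W\ge x)\le c_{5,0}\,\mathsf P(Z\ge x)\quad\text{for all }x\in\mathbb R,$$ where $c_{5,0}=5!\,(e/5)^5=5.699\dots$.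
   Context: Function class. For a natural number $\alpha$, $\mathcal H_+^\alpha$ is the class of all functions $f\colon\mathbb R\to\mathbb R$ having finite derivatives $f^{(0)}:=f,f^{(1)},\dots,f^{(\alpha-1)}$ on $\mathbb R$, with $f^{(\alpha-1)}$ convex on $\mathbb R$ and $\lim_{x\to-\infty}f^{(j)}(x)=0$ for $j=0,1,\dots,\alpha-1$. Reciprocating function. For a finite nonnegative Borel measure $\nu$ on $\mathbb R$ (extended to $[-\infty,\infty]$ by $\nu(\{\pm\infty\})=0$) define $G=G_\nu\colon[-\infty,\infty]\to[0,\infty]$ by $G(x)=\int_{(0,x]}z\,\nu(dz)$ for $x\in[0,\infty]$ and $G(x)=\int_{[x,0)}(-z)\,\nu(dz)$ for $x\in[-\infty,0]$. For $h\in[-\infty,\infty]$ let $x_+(h)=\inf\{x\in[0,\infty]\colon G(x)\ge h\}$ and $x_-(h)=\sup\{x\in[-\infty,0]\colon G(x)\ge h\}$ (with $\inf\emptyset=\infty$, $\sup\emptyset=-\infty$). For $u\in[0,1]$ let $\tilde G(x,u)=G(x-)+(G(x)-G(x-))u$ if $x\in[0,\infty]$ and $\tilde G(x,u)=G(x+)+(G(x)-G(x+))u$ if $x\in[-\infty,0]$ (one-sided limits; note $G$ is continuous at $0$, $G(0)=0$). The reciprocating function of $\nu$ is $\mathsf r_\nu(x,u)=x_-(\tilde G(x,u))$ if $x\in[0,\infty]$ and $\mathsf r_\nu(x,u)=x_+(\tilde G(x,u))$ if $x\in[-\infty,0]$, $u\in[0,1]$. For a random variable $X$, $\mathsf r_X:=\mathsf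 r_\nu$ with $\nu$ the distribution of $X$. (For zero-mean $X$ and independent uniform $U$, $\mathsf r_X(X,U)$ is a.s. finite.) *)

theory Defs
  imports "HOL-Probability.Probability"
begin

text \<open>
  The class \<open>H\<^sub>+\<^sup>\<alpha>\<close>, for \<open>\<alpha> \<ge> 1\<close>: \<open>(deriv ^^ j) f\<close> is the \<open>j\<close>-th derivative of \<open>f\<close>. Since
  \<open>deriv\<close> is total, existence of the derivatives of order \<open>\<le> \<alpha> - 1\<close> is stated as
  differentiability of those of order \<open>< \<alpha> - 1\<close>.
\<close>

definition H_plus :: "nat \<Rightarrow> (real \<Rightarrow> real) set" where
  "H_plus \<alpha> = {f.
     (\<forall>j < \<alpha> - 1. \<forall>x. (deriv ^^ j) f differentiable (at x)) \<and>
     convex_on UNIV ((deriv ^^ (\<alpha> - 1)) f) \<and>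
     (\<forall>j \<le> \<alpha> - 1. ((deriv ^^ j) f \<longlongrightarrow> 0) at_bot)}"

text \<open>
  In the following definitions \<open>\<nu>\<close> is a finite Borel measure on the real line. Its extension to
  \<open>[-\<infinity>, \<infinity>]\<close> does not charge \<open>\<plusminus>\<infinity>\<close>, so the integrals range over real \<open>z\<close> only.
\<close>

definition G_fun :: "real measure \<Rightarrow> ereal \<Rightarrow> ereal" where
  "G_fun \<nu> x = enn2ereal
     (if 0 \<le> x then \<integral>\<^sup>+ z \<in> {z. 0 < z \<and> ereal z \<le> x}. ennreal z \<partial>\<nu>
      else \<integral>\<^sup>+ z \<in> {z. x \<le> ereal z \<and> z < 0}. ennreal (- z) \<partial>\<nu>)"

definition x_plus :: "real measure \<Rightarrow> ereal \<Rightarrow> ereal" where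
  "x_plus \<nu> h = Inf {x. 0 \<le> x \<and> h \<le> G_fun \<nu> x}"

definition x_minus :: "real measure \<Rightarrow> ereal \<Rightarrow> ereal" where
  "x_minus \<nu> h = Sup {x. x \<le> 0 \<and> h \<le> G_fun \<nu> x}"

definition G_tilde :: "real measure \<Rightarrow> ereal \<Rightarrow> real \<Rightarrow> ereal" where
  "G_tilde \<nu> x u =
     (let G = G_fun \<nu>;
          G0 = (if 0 \<le> x then Lim (at_left x) G else Lim (at_right x) G)
      in G0 + (G x - G0) * ereal u)"

text \<open>
  \<open>G x\<close> can be infinite only at \<open>x = \<plusminus>\<infinity>\<close>, in which case \<open>G0 = \<infinity>\<close> as well and \<open>\<infinity> - \<infinity> = \<infinity>\<close> in
  \<^typ>\<open>ereal\<close> makes \<open>G_tilde \<nu> x u = \<infinity>\<close> there; this does not occur when \<open>\<nu>\<close> has a finite mean.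

  At \<open>x = 0\<close> the two cases of the definition agree (both give \<open>0\<close>), so assigning \<open>0\<close> to the first
  case here, in \<open>G_fun\<close> and in \<open>G_tilde\<close> is harmless. Only \<open>u \<in> {0..1}\<close> is relevant.
\<close>

definition reciprocating :: "real measure \<Rightarrow> ereal \<Rightarrow> real \<Rightarrow> ereal" where
  "reciprocating \<nu> x u =
     (if 0 \<le> x then x_minus \<nu> (G_tilde \<nu> x u) else x_plus \<nu> (G_tilde \<nu> x u))"

text \<open>
  \<open>W = \<bar>X - r\<^sub>X(X, U)\<bar>\<close>. The value of \<open>r\<^sub>X(X, U)\<close> is almost surely finite for a zero-mean \<open>X\<close> and an
  independent uniform \<open>U\<close>, so the conversion to \<open>real\<close> (which sends \<open>\<infinity>\<close> to \<open>0\<close>) changes \<open>W\<close> only on a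
  null set.
\<close>

definition W_rv :: "'a measure \<Rightarrow> ('a \<Rightarrow> real) \<Rightarrow> ('a \<Rightarrow> real) \<Rightarrow> 'a \<Rightarrow> real" where
  "W_rv M X U \<omega> =
     real_of_ereal \<bar>ereal (X \<omega>) - reciprocating (distr M borel X) (ereal (X \<omega>)) (U \<omega>)\<bar>"

text \<open>The convention \<open>0 / 0 = 0\<close> is that of division in HOL.\<close>

definition S_W :: "'a measure \<Rightarrow> nat \<Rightarrow> (nat \<Rightarrow> 'a \<Rightarrow> real) \<Rightarrow> (nat \<Rightarrow> 'a \<Rightarrow> real) \<Rightarrow> 'a \<Rightarrow> real" where
  "S_W M n X U \<omega> =
     (\<Sum>i = 1..n. X i \<omega>) / (1 / 2 * sqrt (\<Sum>i = 1..n. (W_rv M (X i) (U i) \<omega>)\<^sup>2))"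

definition c_5_0 :: real where
  "c_5_0 = fact 5 * (exp 1 / 5) ^ 5"

lemma c_5_0_approx: "5699 / 1000 < c_5_0" "c_5_0 < 5700 / 1000"
proof -
  have e: "27182818 / 10000000 \<le> exp (1::real)" "exp (1::real) \<le> 27183 / 10000"
    using e_approx_32 by (simp_all only: abs_le_iff) (simp_all add: field_simps)
  have f5: "fact 5 = (120::real)" by (simp add: fact_numeral)
  have "(27182818 / 50000000) ^ 5 \<le> (exp (1::real) / 5) ^ 5"
    using e by (intro power_mono) auto
  moreover have "5699 / 1000 < 120 * (27182818 / 50000000 :: real) ^ 5"
    by (simp add: power_divide)
  ultimately show "5699 / 1000 < c_5_0" unfolding c_5_0_def f5 by linarith
  have "(exp (1::real) / 5) ^ 5 \<le> (27183 / 50000) ^ 5"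
    using e by (intro power_mono) auto
  moreover have "120 * (27183 / 50000 :: real) ^ 5 < 5700 / 1000"
    by (simp add: power_divide)
  ultimately show "c_5_0 < 5700 / 1000" unfolding c_5_0_def f5 by linarith
qed

text \<open>
  Every \<open>f\<close> in \<open>H\<^sub>+\<^sup>\<alpha>\<close> is nonnegative, so its (possibly infinite) expectation is the Lebesgue
  integral \<open>\<integral>\<^sup>+ \<omega>. ennreal (f (Y \<omega>)) \<partial>M\<close>, without truncation by \<open>ennreal\<close>.
\<close>

lemma convex_tendsto_0_at_bot:
  fixes g :: "real \<Rightarrow> real"
  assumes cvx: "convex_on UNIV g" and lim: "(g \<longlongrightarrow> 0) at_bot"
  shows "0 \<le> g x"
proof (rule ccontr)
  assume "\<not> 0 \<le> g x"
  then have neg: "g x < 0" by simp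
  have "eventually (\<lambda>y. g y > g x / 4) at_bot"
    by (rule order_tendstoD(1)[OF lim]) (use neg in simp)
  then obtain N where N: "\<And>y. y \<le> N \<Longrightarrow> g y > g x / 4"
    by (auto simp: eventually_at_bot_linorder)
  define b where "b = min N x - 1"
  have bx: "b < x" and gb: "g b > g x / 4" unfolding b_def using N by auto
  define D where "D = g b - g x"
  have D: "D > 0" using gb neg by (simp add: D_def)
  have "eventually (\<lambda>y. g y < 1) at_bot"
    by (rule order_tendstoD(2)[OF lim]) simp
  then obtain K where K: "\<And>y. y \<le> K \<Longrightarrow> g y < 1"
    by (auto simp: eventually_at_bot_linorder)
  define c where "c = (x - b) * (1 + \<bar>g b\<bar>) / D"
  have c: "c > 0" using bx D by (simp add: c_def add_pos_nonneg)
  define y where "y = min K (b - c)"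
  have yb: "y < b" "y \<le> K" "c \<le> b - y" using c by (auto simp: y_def)
  define t where "t = (b - y) / (x - y)"
  have t: "0 \<le> t" "t \<le> 1" using yb bx by (auto simp: t_def divide_simps)
  have tm: "t * (x - y) = b - y" using yb bx by (simp add: t_def)
  have "b = (1 - t) * y + t * x" using tm by (simp add: algebra_simps)
  with convex_onD[OF cvx t, of y x] have "g b \<le> (1 - t) * g y + t * g x" by simp
  then have "(x - y) * g b \<le> (x - y) * ((1 - t) * g y + t * g x)"
    using yb bx by (intro mult_left_mono) auto
  also have "\<dots> = (x - y) * g y + (t * (x - y)) * (g x - g y)"
    by (simp add: algebra_simps)
  finally have "(x - b) * g b + (b - y) * D \<le> (x - b) * g y"
    unfolding tm by (simp add: D_def algebra_simps)
  moreover have "c * D \<le> (b - y) * D" using yb D by (intro mult_right_mono) auto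
  moreover have "c * D = (x - b) * (1 + \<bar>g b\<bar>)" using D by (simp add: c_def)
  ultimately have "(x - b) * (g b + 1 + \<bar>g b\<bar>) \<le> (x - b) * g y"
    by (simp add: algebra_simps)
  then have "g b + 1 + \<bar>g b\<bar> \<le> g y" using bx by simp
  with K[OF yb(2)] show False by linarith
qed

lemma H_plus_nonneg:
  assumes "f \<in> H_plus \<alpha>"
  shows "0 \<le> f x"
proof -
  have "\<forall>x. 0 \<le> (deriv ^^ (\<alpha> - 1 - k)) f x" if "k \<le> \<alpha> - 1" for k
    using that
  proof (induction k)
    case 0
    then show ?case
      using assms convex_tendsto_0_at_bot by (auto simp: H_plus_def)
  next
    case (Suc k)
    define j where "j = \<alpha> - 1 - Suc k"
    have j: "j < \<alpha> - 1" "\<alpha> - 1 - k = Suc j" using Suc.prems by (auto simp: j_def)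
    let ?g = "(deriv ^^ j) f"
    have der: "(?g has_real_derivative deriv ?g y) (at y)" for y
      using assms j by (auto simp: H_plus_def DERIV_deriv_iff_real_differentiable)
    have nn: "0 \<le> deriv ?g y" for y using Suc j by auto
    have mono: "?g y \<le> ?g z" if "y \<le> z" for y z
      using DERIV_nonneg_imp_nondecreasing[OF that] der nn by blast
    have lim: "(?g \<longlongrightarrow> 0) at_bot" using assms j by (auto simp: H_plus_def)
    have "0 \<le> ?g z" for z
      by (rule tendsto_upperbound[OF lim])
         (use mono in \<open>auto simp: eventually_at_bot_linorder\<close>)
    then show ?case by (simp add: j_def)
  qed
  from this[of "\<alpha> - 1"] show ?thesis by simp
qed

end

theory Submission
  imports Defs "HOL-Real_Asymp.Real_Asymp"
begin

text \<open>
  Write \<open>G(t) = E (Z - t)\<^sub>+\<^sup>5\<close>. If \<open>X\<close> has mean zero then \<open>G_tilde(X, U)\<close>, under the measure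
  \<open>\<bar>z\<bar> \<nu>(dz)\<close> on either half-line, is uniform on the same interval, and \<open>X\<close> and \<open>r(X, U)\<close> are the two
  quantiles at that level. Hence, given \<open>W\<close>, the variable \<open>X\<close> is a mixture of zero-mean laws on two points
  at distance \<open>W\<close>. For such a two-point law with distance \<open>2\<close> an elementary calculus argument
  gives \<open>E (X - t)\<^sub>+\<^sup>5 \<le> G(t)\<close>, so conditionally on all widths each \<open>X\<^sub>i\<close> can be replaced, one at a time, by
  an independent normal variable with standard deviation \<open>W\<^sub>i / 2\<close>; the normalized sum then becomes
  standard normal. This is the moment inequality for \<open>f(x) = (x - t)\<^sub>+\<^sup>5\<close>.

  For general \<open>f\<close> Taylor's formula at \<open>- \<infinity>\<close> gives \<open>6 f(x) = \<integral> h(s) (x - s)\<^sub>+\<^sup>3 ds\<close> with \<open>h\<close> the convex fourth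
  derivative. The cubic kernel is the limit from below of second differences of \<open>(x - s)\<^sub>+\<^sup>5 / 20\<close>, and moving
  the differences onto \<open>h\<close> exhibits \<open>f\<close> as a limit of positive mixtures of truncated fifth powers.

  For the tails, log-concavity bounds the Gaussian tail \<open>Q\<close> by \<open>Q(y) \<le> Q(x) exp(- l (y - x))\<close>, so that
  \<open>G(t) \<le> Q(x) exp(l (x - t)) 5! / l\<^sup>5\<close>, and Markov's inequality with \<open>l (x - t) = 5\<close> gives the constant.
\<close>

section \<open>The Gaussian tail and its truncated fifth moment\<close>

text \<open>Two obstacles shape the argument. The random denominator depends on the same pairs as
  the numerator, so summands cannot be replaced in the numerator alone. The induction therefore
  treats functions \<open>L\<close> of two arguments, the sum and the accumulated variance, and the
  replacement touches only the first one; an inequality between integrals for arbitrary test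
  functions \<open>k\<close> and \<open>K\<close> stands in for conditioning on a width. The other
  obstacle is skewness. A zero-mean law on two points at distance 2 has variance at most 1, but its
  third and fifth moments may be positive, while those of a normal variable vanish. With d half the
  difference of the distances from 0 to the right and to the left point, the variance falls short of
  1 by d^2 and the third moment is 2 d (1 - d^2). In the fifth moment about a remote threshold these
  two effects combine into a perfect square, so the smaller variance pays for the skewness.
  Expectations of functions in \<open>H_plus 5\<close> may be infinite, so the passage from
  truncated powers to general functions uses nonnegative integrals with Tonelli and Fatou
  only.\<close>

abbreviation std_normal :: "real measure" where
  "std_normal \<equiv> density lborel (\<lambda>x. ennreal (std_normal_density x))"

lemma real_distribution_std_normal: "real_distribution std_normal"
  using prob_space_normal_density[of 1 0]
  by (simp add: real_distribution_def real_distribution_axioms_def)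

interpretation std_normal: real_distribution std_normal
  by (rule real_distribution_std_normal)

lemma nn_integral_std_normal:
  "f \<in> borel_measurable borel \<Longrightarrow>
    (\<integral>\<^sup>+ z. f z \<partial>std_normal) = (\<integral>\<^sup>+ z. ennreal (std_normal_density z) * f z \<partial>lborel)"
  by (subst nn_integral_density) simp_all

definition normal_tail :: "real \<Rightarrow> real" where
  "normal_tail t = measure std_normal {t..}"

lemma measure_std_normal_singleton: "measure std_normal {a} = 0"
proof -
  have "emeasure std_normal {a} = 0"
    by (subst emeasure_density) (auto intro!: nn_integral_zero' AE_I[where N = "{a}"] split: split_indicator)
  then show ?thesis by (simp add: measure_def)
qed

lemma normal_tail_eq_cdf: "normal_tail t = 1 - cdf std_normal t"
proof -
  have "{..t} \<union> {t..} = UNIV" "{..t} \<inter> {t..} = {t}" by auto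
  then have "1 = measure std_normal {..t} + measure std_normal {t..} - measure std_normal {t}"
    using std_normal.prob_space measure_Un3[of "{..t}" std_normal "{t..}"]
    by (simp add: std_normal.fmeasurable_eq_sets)
  then show ?thesis by (simp add: normal_tail_def cdf_def measure_std_normal_singleton)
qed

lemma DERIV_std_normal_density:
  "(std_normal_density has_real_derivative - x * std_normal_density x) (at x)"
proof -
  define c where "c = 1 / sqrt (2 * pi)"
  have "((\<lambda>x. c * exp (- x\<^sup>2 / 2)) has_real_derivative - x * (c * exp (- x\<^sup>2 / 2))) (at x)"
    by (auto intro!: derivative_eq_intros)
  then show ?thesis by (simp add: c_def std_normal_density_def[abs_def])
qed

text \<open>The density is continuous, so it has an antiderivative \<open>F\<close>. The fundamental
  theorem on compact intervals then shows that \<open>normal_tail\<close> and \<open>- F\<close>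
  differ by a constant.\<close>

lemma DERIV_normal_tail:
  "(normal_tail has_real_derivative - std_normal_density x) (at x)"
proof -
  obtain F where F: "\<And>x. (F has_real_derivative std_normal_density x) (at x)"
    using einterval_antiderivative[of "-\<infinity>" "\<infinity>" std_normal_density]
      DERIV_isCont[OF DERIV_std_normal_density]
    by (auto simp: has_real_derivative_iff_has_vector_derivative)
  have step: "normal_tail a - normal_tail b = F b - F a" if "a \<le> b" for a b
  proof -
    have "F a \<le> F b"
      using that F by (intro DERIV_nonneg_imp_nondecreasing[of a b F]) (auto intro!: exI)
    have ind: "(indicator {a..} x :: ennreal) = indicator {a..b} x + indicator {b..} x" if "x \<noteq> b" for x
      using \<open>a \<le> b\<close> that by (simp add: indicator_def)
    have "emeasure std_normal {a..} = (\<integral>\<^sup>+ x. ennreal (std_normal_density x) * indicator {a..} x \<partial>lborel)"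
      by (simp add: emeasure_density)
    also have "\<dots> = (\<integral>\<^sup>+ x. ennreal (std_normal_density x) * indicator {a..b} x
        + ennreal (std_normal_density x) * indicator {b..} x \<partial>lborel)"
    proof (rule nn_integral_cong_AE, rule AE_mp[OF AE_lborel_singleton[of b]], rule AE_I2, rule impI)
      fix x assume "x \<noteq> b"
      then show "ennreal (std_normal_density x) * indicator {a..} x
        = ennreal (std_normal_density x) * indicator {a..b} x + ennreal (std_normal_density x) * indicator {b..} x"
        by (simp only: ind[OF \<open>x \<noteq> b\<close>] distrib_left)
    qed
    also have "\<dots> = ennreal (F b - F a) + emeasure std_normal {b..}"
      using F that by (subst nn_integral_add) (auto simp: emeasure_density nn_integral_FTC_Icc)
    finally have "ennreal (normal_tail a) = ennreal (F b - F a + normal_tail b)"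
      using \<open>F a \<le> F b\<close>
      by (simp add: normal_tail_def std_normal.emeasure_eq_measure flip: ennreal_plus)
    moreover have "0 \<le> normal_tail a" "0 \<le> normal_tail b" by (simp_all add: normal_tail_def)
    ultimately show ?thesis
      using \<open>F a \<le> F b\<close> by (subst (asm) ennreal_inj) auto
  qed
  have "normal_tail t = normal_tail 0 + F 0 - F t" for t
    using step[of 0 t] step[of t 0] by (cases "0 \<le> t") auto
  then have "normal_tail = (\<lambda>t. normal_tail 0 + F 0 - F t)" by (rule ext)
  moreover have "((\<lambda>t. normal_tail 0 + F 0 - F t) has_real_derivative - std_normal_density x) (at x)"
    by (auto intro!: derivative_eq_intros F)
  ultimately show ?thesis by (simp only:)
qed

lemma normal_tail_at_top: "(normal_tail \<longlongrightarrow> 0) at_top"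
  using tendsto_diff[OF tendsto_const[of 1] std_normal.cdf_lim_at_top_prob]
  by (simp add: normal_tail_eq_cdf[abs_def])

lemma normal_tail_at_bot: "(normal_tail \<longlongrightarrow> 1) at_bot"
  using tendsto_diff[OF tendsto_const[of 1] std_normal.cdf_lim_at_bot]
  by (simp add: normal_tail_eq_cdf[abs_def])

lemma normal_tail_nonneg: "0 \<le> normal_tail t"
  by (simp add: normal_tail_def)

text \<open>The density is even, so the derivative of the sum of both tails vanishes; the constant
  value is read off at infinity.\<close>

lemma normal_tail_minus: "normal_tail (- t) = 1 - normal_tail t"
proof -
  let ?s = "\<lambda>t. normal_tail t + normal_tail (- t)"
  have "(?s has_real_derivative 0) (at x)" for x
    using DERIV_add[OF DERIV_normal_tail DERIV_chain'[OF DERIV_minus[OF DERIV_ident] DERIV_normal_tail]]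
    by (simp add: std_normal_density_def)
  then have const: "?s x = ?s y" for x y using DERIV_isconst_all by blast
  have "(?s \<longlongrightarrow> 0 + 1) at_top"
    by (intro tendsto_add normal_tail_at_top filterlim_compose[OF normal_tail_at_bot]
        filterlim_uminus_at_bot_at_top)
  moreover have "?s = (\<lambda>_. ?s t)" by (rule ext) (rule const)
  ultimately have "((\<lambda>_. ?s t) \<longlongrightarrow> 0 + 1) (at_top :: real filter)" by metis
  then have "?s t = 1" by (simp add: tendsto_const_iff)
  then show ?thesis by simp
qed

lemma normal_tail_0: "normal_tail 0 = 1 / 2"
  using normal_tail_minus[of 0] by simp

lemma normal_tail_pos: "0 < normal_tail t"
proof -
  have "normal_tail (t + 1) < normal_tail t"
    by (rule DERIV_neg_imp_decreasing[of t])
       (auto intro!: exI DERIV_normal_tail normal_density_pos)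
  then show ?thesis using normal_tail_nonneg[of "t + 1"] by linarith
qed

text \<open>Integration by parts brings E (Z - t)_+^5 into this form. The polynomial in front of the
  tail is E (Z + t)^5, computed from the even moments 1, 1, 3.\<close>

definition normal_moment5 :: "real \<Rightarrow> real" where
  "normal_moment5 t = (t^4 + 9 * t^2 + 8) * std_normal_density t - (t^5 + 10 * t^3 + 15 * t) * normal_tail t"

abbreviation trunc5 :: "real \<Rightarrow> real \<Rightarrow> real" where
  "trunc5 t x \<equiv> max 0 (x - t) ^ 5"

lemma nn_integral_trunc5_std_normal:
  "(\<integral>\<^sup>+ z. ennreal (trunc5 t z) \<partial>std_normal) = ennreal (normal_moment5 t)"
proof -
  \<comment> \<open>Antiderivative found by expanding (z - t)^5: each z^k times the density
    integrates to a polynomial times the density, and k = 0, 2, 4 contribute in addition the tail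
    with factors 1, 1, 3.\<close>
  define A where "A z = (- (z^4 + 4 * z^2 + 8) + 5 * t * (z^3 + 3 * z) - 10 * t^2 * (z^2 + 2)
      + 10 * t^3 * z - 5 * t^4) * std_normal_density z + (15 * t + 10 * t^3 + t^5) * normal_tail z" for z
  have A: "(A has_real_derivative (z - t)^5 * std_normal_density z) (at z)" for z
  proof -
    define P where "P z = - (z^4 + 4 * z^2 + 8) + 5 * t * (z^3 + 3 * z) - 10 * t^2 * (z^2 + 2)
      + 10 * t^3 * z - 5 * t^4" for z
    have P: "(P has_real_derivative
        - (4 * z^3 + 8 * z) + 5 * t * (3 * z^2 + 3) - 20 * t^2 * z + 10 * t^3) (at z)"
      unfolding P_def by (auto intro!: derivative_eq_intros)
    have "(- (4 * z^3 + 8 * z) + 5 * t * (3 * z^2 + 3) - 20 * t^2 * z + 10 * t^3) * p + - z * p * P z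
        + (15 * t + 10 * t^3 + t^5) * - p = (z - t)^5 * p" for p
      unfolding P_def by algebra
    moreover have "A = (\<lambda>z. P z * std_normal_density z + (15 * t + 10 * t^3 + t^5) * normal_tail z)"
      by (simp add: fun_eq_iff A_def P_def)
    moreover have "((\<lambda>z. P z * std_normal_density z + (15 * t + 10 * t^3 + t^5) * normal_tail z)
        has_real_derivative (- (4 * z^3 + 8 * z) + 5 * t * (3 * z^2 + 3) - 20 * t^2 * z + 10 * t^3)
          * std_normal_density z + - z * std_normal_density z * P z
        + (15 * t + 10 * t^3 + t^5) * - std_normal_density z) (at z)"
      by (intro DERIV_add DERIV_mult DERIV_cmult P DERIV_std_normal_density DERIV_normal_tail)
    ultimately show ?thesis by (simp only:)
  qed
  have pd: "((\<lambda>z. p * (z^k * exp (- (z^2 / 2)))) \<longlongrightarrow> 0) at_top" for p :: real and k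
    by real_asymp
  have "(A \<longlongrightarrow> 0) at_top"
  proof -
    define c where "c = 1 / sqrt (2 * pi)"
    have c: "std_normal_density z = c * exp (- (z^2 / 2))" for z
      by (simp add: c_def std_normal_density_def)
    have "A = (\<lambda>z. c * ((- 1) * (z^4 * exp (- (z^2 / 2))) + (5 * t) * (z^3 * exp (- (z^2 / 2)))
        + (- 4 - 10 * t^2) * (z^2 * exp (- (z^2 / 2))) + (15 * t + 10 * t^3) * (z^1 * exp (- (z^2 / 2)))
        + (- 8 - 20 * t^2 - 5 * t^4) * (z^0 * exp (- (z^2 / 2)))) + (15 * t + 10 * t^3 + t^5) * normal_tail z)"
      unfolding A_def c
      by (rule ext) (simp add: algebra_simps)
    moreover have "(\<dots> \<longlongrightarrow> c * (0 + 0 + 0 + 0 + 0) + (15 * t + 10 * t^3 + t^5) * 0) at_top"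
      by (intro tendsto_add tendsto_mult tendsto_const pd normal_tail_at_top)
    ultimately show ?thesis by simp
  qed
  have "(\<integral>\<^sup>+ z. ennreal (trunc5 t z) \<partial>std_normal)
      = (\<integral>\<^sup>+ z. ennreal ((z - t)^5 * std_normal_density z) * indicator {t..} z \<partial>lborel)"
    by (subst nn_integral_std_normal)
       (auto intro!: nn_integral_cong simp: ennreal_mult'[symmetric] mult.commute max_def split: split_indicator)
  also have "\<dots> = ennreal (0 - A t)"
    by (rule nn_integral_FTC_atLeast[OF _ A _ \<open>(A \<longlongrightarrow> 0) at_top\<close>]) auto
  also have "0 - A t = normal_moment5 t"
    unfolding A_def normal_moment5_def by algebra
  finally show ?thesis .
qed

text \<open>\<open>ennreal\<close> sends negative numbers to 0, so the integral formula alone does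
  not determine the sign. A negative value would force \<open>trunc5\<close> to vanish almost
  everywhere, against the positivity of the tail.\<close>

lemma normal_moment5_nonneg: "0 \<le> normal_moment5 t"
proof (rule ccontr)
  assume "\<not> 0 \<le> normal_moment5 t"
  then have "(\<integral>\<^sup>+ z. ennreal (trunc5 t z) \<partial>std_normal) = 0"
    using nn_integral_trunc5_std_normal[of t] by (simp add: ennreal_neg)
  then have "AE z in std_normal. trunc5 t z = 0"
    by (subst (asm) nn_integral_0_iff_AE) (auto elim: AE_mp)
  then have "AE z in std_normal. z \<notin> {t + 1..}"
    by (rule AE_mp) (auto intro!: AE_I2 simp: max_def split: if_splits)
  then have "normal_tail (t + 1) = 0"
    by (simp add: normal_tail_def AE_iff_measurable[OF _ refl] measure_def atLeast_def)
  then show False using normal_tail_pos[of "t + 1"] by simp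
qed

text \<open>Probabilistically this is x^5 = x_+^5 - (-x)_+^5 at x = Z + t, together with the
  symmetry of Z.\<close>

lemma normal_moment5_minus: "normal_moment5 (- t) = t^5 + 10 * t^3 + 15 * t + normal_moment5 t"
  by (simp add: normal_moment5_def normal_tail_minus std_normal_density_def) algebra

text \<open>The remainder of this Maclaurin expansion is nonnegative because the sixth derivative of
  \<^const>\<open>normal_moment5\<close> is \<open>120\<close> times the density.\<close>
lemma normal_moment5_taylor:
  defines "\<kappa> \<equiv> 1 / sqrt (2 * pi)"
  shows "8 * \<kappa> - 15 / 2 * t + 20 * \<kappa> * t^2 - 5 * t^3 + 5 * \<kappa> * t^4 - t^5 / 2 \<le> normal_moment5 t"
proof -
  \<comment> \<open>\<open>d m\<close> is the m-th derivative, kept as polynomial times density plus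
    polynomial times tail. Differentiation gives P (Suc m) = (P m)' - x P m - R m and R (Suc m) = (R
    m)'. The last branch of \<open>P\<close> serves both m = 4 and m = 6.\<close>
  define P where "P m x = (if m = 0 then x^4 + 9 * x^2 + 8 else if m = 1 then 5 * (x^3 + 5 * x)
    else if m = 2 then 20 * (x^2 + 2) else if m = 3 then 60 * x else if m = 5 then 0 else 120)"
    for m :: nat and x :: real
  define R where "R m x = (if m = 0 then - (x^5 + 10 * x^3 + 15 * x) else if m = 1 then - 5 * (x^4 + 6 * x^2 + 3)
    else if m = 2 then - 20 * (x^3 + 3 * x) else if m = 3 then - 60 * (x^2 + 1)
    else if m = 4 then - 120 * x else if m = 5 then - 120 else 0)"
    for m :: nat and x :: real
  define d where "d m x = P m x * std_normal_density x + R m x * normal_tail x" for m x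
  have d0: "d 0 = normal_moment5"
    by (rule ext) (simp add: d_def P_def R_def normal_moment5_def algebra_simps)
  have "(d m has_real_derivative d (Suc m) x) (at x)" if m: "m < 6" for m x
  proof -
    consider "m = 0" | "m = 1" | "m = 2" | "m = 3" | "m = 4" | "m = 5" using m by linarith
    then have "(P m has_real_derivative P (Suc m) x + x * P m x + R m x) (at x) \<and>
        (R m has_real_derivative R (Suc m) x) (at x)"
      by cases (auto simp: P_def[abs_def] R_def[abs_def] algebra_simps power_numeral_reduce
          intro!: derivative_eq_intros)
    then have "((\<lambda>x. P m x * std_normal_density x + R m x * normal_tail x) has_real_derivative
        ((P (Suc m) x + x * P m x + R m x) * std_normal_density x + (- x * std_normal_density x) * P m x)
        + (R (Suc m) x * normal_tail x + (- std_normal_density x) * R m x)) (at x)"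
      by (intro DERIV_add DERIV_mult DERIV_normal_tail DERIV_std_normal_density) auto
    then show ?thesis by (simp add: d_def[abs_def] algebra_simps)
  qed
  then obtain \<xi> where "normal_moment5 t = (\<Sum>m<6. d m 0 / fact m * t ^ m) + d 6 \<xi> / fact 6 * t ^ 6"
    using Maclaurin_bi_le[of d normal_moment5 6 t, OF d0] by blast
  moreover have "0 \<le> d 6 \<xi> / fact 6 * t ^ 6"
    by (simp add: d_def P_def R_def zero_le_even_power)
  moreover have "std_normal_density 0 = \<kappa>" by (simp add: std_normal_density_def \<kappa>_def)
  ultimately show ?thesis
    by (simp add: lessThan_nat_numeral d_def P_def R_def normal_tail_0 fact_numeral)
qed

section \<open>Numerical lower bounds for the truncated fifth moment\<close>

lemma inverse_sqrt_2pi_ge: "3989 / 10000 \<le> 1 / sqrt (2 * pi)"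
proof -
  have "sqrt (2 * pi) \<le> sqrt ((10000 / 3989)\<^sup>2)"
    using pi_approx by (intro real_sqrt_le_mono) (simp add: power2_eq_square)
  then have "sqrt (2 * pi) \<le> 10000 / 3989" by simp
  moreover have "0 < sqrt (2 * pi)" by simp
  ultimately show ?thesis by (simp add: field_simps)
qed

text \<open>The factor \<open>1 / sqrt (2 * pi)\<close> multiplies only even powers, so rounding it
  down to 0.3989 lowers the polynomial for either sign of t.\<close>

lemma normal_moment5_taylor_numeric:
  "31912 / 10000 - 15 / 2 * t + 7978 / 1000 * t^2 - 5 * t^3 + 19945 / 10000 * t^4 - t^5 / 2 \<le> normal_moment5 t"
proof -
  define k where "k = 1 / sqrt (2 * pi)"
  have "0 \<le> (k - 3989 / 10000) * (8 + 20 * t^2 + 5 * t^4)"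
    using inverse_sqrt_2pi_ge by (intro mult_nonneg_nonneg) (auto simp: k_def)
  then have "31912 / 10000 - 15 / 2 * t + 7978 / 1000 * t^2 - 5 * t^3 + 19945 / 10000 * t^4 - t^5 / 2
      \<le> 8 * k - 15 / 2 * t + 20 * k * t^2 - 5 * t^3 + 5 * k * t^4 - t^5 / 2"
    by (simp add: algebra_simps add_divide_distrib)
  with normal_moment5_taylor[of t] show ?thesis unfolding k_def by linarith
qed

text \<open>Serves \<open>two_point_left_tail\<close> at small \<tau>, where the polynomial part is
  only known to be at least -\<tau>.\<close>

lemma normal_moment5_ge_self:
  assumes "0 \<le> t" "t \<le> 1 / 2"
  shows "t \<le> normal_moment5 t"
proof -
  have "t^3 \<le> t^2 / 2" using mult_left_mono[of t "1 / 2" "t^2"] assms by (simp add: power2_eq_square power3_eq_cube)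
  moreover have "t^5 \<le> t^4" using assms by (intro power_decreasing) auto
  moreover have "0 \<le> t^4" by simp
  moreover have "t - 1 / 4 \<le> t^2" using sum_squares_ge_zero[of "t - 1 / 2" 0]
    by (simp add: power2_eq_square algebra_simps)
  ultimately show ?thesis using assms normal_moment5_taylor_numeric[of t] by linarith
qed

lemma ln_one_plus_ge_quadratic:
  fixes x :: real
  assumes "0 \<le> x"
  shows "x - x\<^sup>2 / 2 \<le> ln (1 + x)"
proof -
  have "ln (1 + 0) - (0 - 0\<^sup>2 / 2) \<le> ln (1 + x) - (x - x\<^sup>2 / 2)"
  proof (rule DERIV_nonneg_imp_nondecreasing[OF assms])
    fix y :: real assume y: "0 \<le> y" "y \<le> x"
    have "((\<lambda>y. ln (1 + y) - (y - y\<^sup>2 / 2)) has_real_derivative 1 / (1 + y) - (1 - y)) (at y)"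
      using y by (auto intro!: derivative_eq_intros)
    moreover have "0 \<le> 1 / (1 + y) - (1 - y)"
      using y by (simp add: field_simps)
    ultimately show "\<exists>z. ((\<lambda>y. ln (1 + y) - (y - y\<^sup>2 / 2)) has_real_derivative z) (at y) \<and> 0 \<le> z"
      by blast
  qed
  then show ?thesis by simp
qed

text \<open>The Taylor polynomial is negative at t = 2, so here the moment integral is restricted to
  [2, 3], where its integrand is at least the value at 2.\<close>

lemma normal_moment5_ge_right:
  assumes "1 \<le> t" "t \<le> 2"
  shows "335 / 10000 * (2 - t)^6 \<le> normal_moment5 t"
proof -
  have "ennreal ((2 - t)^5 * std_normal_density 2) = (\<integral>\<^sup>+ z. ennreal ((2 - t)^5 * std_normal_density 2) * indicator {2..3::real} z \<partial>lborel)"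
    by (simp add: nn_integral_cmult_indicator)
  also have "\<dots> \<le> (\<integral>\<^sup>+ z. ennreal (std_normal_density z) * ennreal (trunc5 t z) \<partial>lborel)"
  proof (intro nn_integral_mono)
    fix z :: real
    show "ennreal ((2 - t)^5 * std_normal_density 2) * indicator {2..3} z
        \<le> ennreal (std_normal_density z) * ennreal (trunc5 t z)"
    proof (cases "z \<in> {2..3}")
      case True
      \<comment> \<open>From 2 to z = 2 + x the density drops by the factor exp (2 x + x^2 / 2).
        This is at most (1 + x)^5, and z - t grows at least to (2 - t)(1 + x) because t \<ge>
        1.\<close>
      define x where "x = z - 2"
      have x: "0 \<le> x" "x \<le> 1" using True by (auto simp: x_def)
      have "x * x \<le> x * 1" using x by (intro mult_left_mono) auto
      have "x - x\<^sup>2 / 2 \<le> ln (1 + x)" by (rule ln_one_plus_ge_quadratic) (use x in auto)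
      then have "5 * (x - x\<^sup>2 / 2) \<le> 5 * ln (1 + x)" by simp
      then have "2 * x + x\<^sup>2 / 2 \<le> 5 * ln (1 + x)"
        using \<open>x * x \<le> x * 1\<close> by (simp add: power2_eq_square)
      then have "exp (2 * x + x\<^sup>2 / 2) \<le> exp (5 * ln (1 + x))" by simp
      also have "\<dots> = (1 + x)^5"
        using x exp_of_nat_mult[of 5 "ln (1 + x)"] by simp
      finally have e: "exp (2 * x + x\<^sup>2 / 2) \<le> (1 + x)^5" .
      have "std_normal_density 2 = std_normal_density z * exp (2 * x + x\<^sup>2 / 2)"
        unfolding std_normal_density_def mult.assoc exp_add[symmetric] x_def
        by (simp add: power2_eq_square field_simps)
      also have "\<dots> \<le> std_normal_density z * (1 + x)^5"
        using e by (intro mult_left_mono) auto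
      finally have "(2 - t)^5 * std_normal_density 2 \<le> (2 - t)^5 * (std_normal_density z * (1 + x)^5)"
        using assms by (intro mult_left_mono) auto
      also have "\<dots> = std_normal_density z * ((2 - t) * (1 + x))^5"
        by (simp add: power_mult_distrib)
      also have "\<dots> \<le> std_normal_density z * (z - t)^5"
      proof (intro mult_left_mono power_mono)
        have "0 \<le> x * (t - 1)" using x assms by simp
        then show "(2 - t) * (1 + x) \<le> z - t" by (simp add: x_def algebra_simps)
      qed (use x assms in auto)
      also have "(z - t)^5 = trunc5 t z" using True assms by (simp add: max_def)
      finally show ?thesis using True by (simp add: ennreal_mult'[symmetric] ennreal_leI)
    qed simp
  qed
  also have "\<dots> = ennreal (normal_moment5 t)"
    by (subst nn_integral_std_normal[symmetric]) (auto simp: nn_integral_trunc5_std_normal)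
  finally have "(2 - t)^5 * std_normal_density 2 \<le> normal_moment5 t"
    using normal_moment5_nonneg by simp
  moreover have "(2 - t)^6 * (335 / 10000) \<le> (2 - t)^5 * std_normal_density 2"
  proof -
    have "(2 - t)^6 \<le> (2 - t)^5" using assms by (intro power_decreasing) auto
    moreover have "335 / 10000 \<le> std_normal_density 2"
    proof -
      have "exp (1 :: real) ^ 2 \<le> 3 ^ 2" using exp_le by (intro power_mono) auto
      then have "exp (2::real) \<le> 9" by (simp add: exp_of_nat_mult[of 2 1, simplified])
      then have "1 / 9 \<le> exp (- 2 :: real)" by (simp add: exp_minus field_simps)
      then have "3989 / 10000 * (1 / 9) \<le> 1 / sqrt (2 * pi) * exp (- 2)"
        by (intro mult_mono inverse_sqrt_2pi_ge) auto
      moreover have "std_normal_density 2 = 1 / sqrt (2 * pi) * exp (- 2)"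
        by (simp add: std_normal_density_def)
      ultimately show ?thesis by linarith
    qed
    ultimately show ?thesis using assms by (intro mult_mono) auto
  qed
  ultimately show ?thesis by (simp add: mult.commute)
qed

text \<open>The constant is (5/6)^6 / 10 = 0.03349... rounded up, so that the left-hand side
  majorises a (b - t)^5 / 2 for all a + b = 2 with -a \<le> t \<le> b. Left of 1 it is compared with
  the Taylor polynomial.\<close>

lemma normal_moment5_ge_pow6:
  assumes "- 2 / 5 \<le> t" "t \<le> 2"
  shows "335 / 10000 * (2 - t)^6 \<le> normal_moment5 t"
proof (cases "1 \<le> t")
  case False
  have "(2 - t)^6 = 64 - 192 * t + 240 * t^2 - 160 * t^3 + 60 * t^4 - 12 * t^5 + t^6"
    by algebra
  then have ex: "335 / 10000 * (2 - t)^6 = 2144 / 1000 - 6432 / 1000 * t + 8040 / 1000 * t^2 - 5360 / 1000 * t^3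
      + 2010 / 1000 * t^4 - 402 / 1000 * t^5 + 335 / 10000 * t^6"
    by simp
  show ?thesis
  proof (cases "0 \<le> t")
    case True
    have "t^4 \<le> t^3" using True False by (intro power_decreasing) auto
    moreover have "t^5 \<le> t^3" using True False by (intro power_decreasing) auto
    moreover have "t^6 \<le> t^3" using True False by (intro power_decreasing) auto
    moreover have "t^2 \<le> t" using True False by (simp add: power2_eq_square mult_left_le)
    ultimately have "155 / 10000 * t^4 + 98 / 1000 * t^5 + 335 / 10000 * t^6 + 62 / 1000 * t^2
        \<le> 147 / 1000 * t^3 + 62 / 1000 * t"
      by linarith
    \<comment> \<open>The tangent of t^3 at t = 1; it makes the remaining comparison linear.\<close>
    moreover have "3 * t - 2 \<le> t^3"
    proof -
      have "0 \<le> (t - 1)\<^sup>2 * (t + 2)" using True by simp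
      then show ?thesis by (simp add: power2_eq_square power3_eq_cube algebra_simps)
    qed
    ultimately have "2144 / 1000 - 6432 / 1000 * t + 8040 / 1000 * t^2 - 5360 / 1000 * t^3
      + 2010 / 1000 * t^4 - 402 / 1000 * t^5 + 335 / 10000 * t^6 \<le>
        31912 / 10000 - 15 / 2 * t + 7978 / 1000 * t^2 - 5 * t^3 + 19945 / 10000 * t^4 - t^5 / 2"
      using True False by linarith
    then show ?thesis using order_trans[OF _ normal_moment5_taylor_numeric[of t]] unfolding ex by blast
  next
    case neg: False
    define s where "s = - t"
    have s: "0 \<le> s" "s \<le> 2 / 5" using neg assms by (auto simp: s_def)
    have "s^2 \<le> s" "s^3 \<le> s" "s^4 \<le> s" "s^6 \<le> s" using s power_decreasing[of 1 _ s] by auto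
    moreover have "0 \<le> s^5" using s by simp
    moreover have "t = - s" "t^2 = s^2" "t^3 = - (s^3)" "t^4 = s^4" "t^5 = - (s^5)" "t^6 = s^6"
      by (simp_all add: s_def)
    ultimately have "2144 / 1000 - 6432 / 1000 * t + 8040 / 1000 * t^2 - 5360 / 1000 * t^3
      + 2010 / 1000 * t^4 - 402 / 1000 * t^5 + 335 / 10000 * t^6 \<le>
        31912 / 10000 - 15 / 2 * t + 7978 / 1000 * t^2 - 5 * t^3 + 19945 / 10000 * t^4 - t^5 / 2"
      using s by linarith
    then show ?thesis using order_trans[OF _ normal_moment5_taylor_numeric[of t]] unfolding ex by blast
  qed
qed (use normal_moment5_ge_right assms in auto)

section \<open>The inequality for zero-mean two-point laws\<close>

lemma weighted_amgm_power6:
  fixes y c :: real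
  assumes "0 \<le> y" "0 \<le> c"
  shows "6 * y^5 * c \<le> 5 * y^6 + c^6"
proof -
  have "0 \<le> (y - c)\<^sup>2 * (5 * y^4 + 4 * y^3 * c + 3 * y^2 * c^2 + 2 * y * c^3 + c^4)"
    using assms by (intro mult_nonneg_nonneg add_nonneg_nonneg) auto
  also have "\<dots> = 5 * y^6 + c^6 - 6 * y^5 * c" by algebra
  finally show ?thesis by simp
qed

text \<open>Both points exceed the threshold -\<tau>, so the left-hand side is the polynomial E (X +
  \<tau>)^5. With d = (b - a) / 2 and A = a b = 1 - d^2, the variance deficit gains 10 \<tau>^3 d^2
  and the third moment costs 20 \<tau>^2 d A; both are absorbed by the square in
  \<open>\<Phi>\<close>. The only term of uncertain sign comes from the fifth moment 4 d (1 - d^4),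
  and \<open>normal_moment5 \<tau>\<close> helps to compensate it.\<close>

lemma two_point_left_tail:
  assumes ab: "0 < a" "0 < b" "a + b = 2" and \<tau>: "a < \<tau>"
  shows "(a * (b + \<tau>)^5 + b * (\<tau> - a)^5) / 2 \<le> normal_moment5 (- \<tau>)"
proof -
  define d where "d = (b - a) / 2"
  define A where "A = 1 - d^2"
  have d: "a = 1 - d" "b = 1 + d" "- 1 < d" "d < 1" using ab by (auto simp: d_def field_simps)
  have "0 < (1 - d) * (1 + d)" using d by (intro mult_pos_pos) auto
  then have A: "0 < A" by (simp add: A_def power2_eq_square algebra_simps)
  define \<Phi> where "\<Phi> = 10 * \<tau> * ((\<tau> * d - A)\<^sup>2 + d^2 + d^4 / 2) - 4 * d * (1 - d^4)"
  have eq: "\<tau>^5 + 10 * \<tau>^3 + 15 * \<tau> - (a * (b + \<tau>)^5 + b * (\<tau> - a)^5) / 2 = \<Phi>"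
    unfolding d(1,2) \<Phi>_def A_def by (simp add: field_simps) algebra
  have "0 \<le> \<Phi> + normal_moment5 \<tau>"
  proof (cases "d \<le> 0")
    case True
    have "0 \<le> - d * (1 - d^4)"
      using True d power_le_one[of "\<bar>d\<bar>" 4] by (intro mult_nonneg_nonneg) (auto simp: power_even_abs_numeral)
    moreover have "0 \<le> 10 * \<tau> * ((\<tau> * d - A)\<^sup>2 + d^2 + d^4 / 2)"
      using \<tau> ab by (intro mult_nonneg_nonneg) auto
    ultimately show ?thesis using normal_moment5_nonneg[of \<tau>] by (simp add: \<Phi>_def)
  next
    case False
    show ?thesis
    proof (cases "\<tau> \<le> 1 / 2")
      case True
      \<comment> \<open>Here \<tau> > a = 1 - d bounds the fifth moment by a multiple of \<tau>,
        which leaves \<Phi> \<ge> -\<tau>.\<close>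
      have "4 * d * (1 - d^4) = (1 - d) * (4 * d * (1 + d) * (1 + d^2))" by algebra
      also have "\<dots> \<le> \<tau> * (4 * d * (1 + d) * (1 + d^2))"
        using \<tau> d False by (intro mult_right_mono) auto
      finally have "\<tau> * (10 * d^2 + 5 * d^4 - 4 * d * (1 + d) * (1 + d^2)) + 10 * \<tau> * (\<tau> * d - A)\<^sup>2 \<le> \<Phi>"
        by (simp add: \<Phi>_def algebra_simps)
      moreover have "10 * d^2 + 5 * d^4 - 4 * d * (1 + d) * (1 + d^2) = (1 - d)^4 - 1" by algebra
      moreover have "0 \<le> 10 * \<tau> * (\<tau> * d - A)\<^sup>2" "0 \<le> \<tau> * (1 - d)^4"
        using \<tau> ab by (auto intro!: mult_nonneg_nonneg)
      moreover have "\<tau> * ((1 - d)^4 - 1) = \<tau> * (1 - d)^4 - \<tau>" by algebra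
      ultimately have "- \<tau> \<le> \<Phi>" by (smt (verit))
      then show ?thesis using normal_moment5_ge_self[of \<tau>] True \<tau> ab by linarith
    next
      case \<tau>2: False
      have "4 * d * (1 - d^4) \<le> 10 * \<tau> * ((\<tau> * d - A)\<^sup>2 + d^2 + d^4 / 2)"
      proof (cases "d^2 \<le> 54 / 100")
        case True
        \<comment> \<open>The aim is the nonnegativity of the quadratic form B X^2 - 2 (\<tau>^2 +
          c) X A + \<tau>^2 A^2, that is (\<tau>^2 + c)^2 \<le> \<tau>^2 B. For \<tau> \<ge> 1/2
          this allows c up to about 0.309, and 1 + d^2 \<le> 1.54 requires c = 1.54 / 5 = 0.308;
          hence the split of d^2 at 0.54.\<close>
        define B c X where "B = \<tau>^2 + 1" and "c = 308 / (1000 :: real)" and "X = \<tau> * d"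
        have "0 < B * \<tau>" using \<tau>2 by (intro mult_pos_pos) (auto simp: B_def add_nonneg_pos)
        have "(1 / 2)\<^sup>2 \<le> \<tau>\<^sup>2" using \<tau>2 by (intro power_mono) auto
        then have "(\<tau>^2 + c)\<^sup>2 \<le> \<tau>^2 * B"
          by (simp add: B_def c_def power2_eq_square algebra_simps)
        then have "0 \<le> (B * X - (\<tau>^2 + c) * A)\<^sup>2 + (\<tau>^2 * B - (\<tau>^2 + c)\<^sup>2) * A^2"
          by (intro add_nonneg_nonneg mult_nonneg_nonneg) auto
        also have "\<dots> = B * \<tau> * (\<tau> * ((\<tau> * d - A)\<^sup>2 + d^2) - 2 * c * d * A)"
          unfolding B_def X_def by algebra
        finally have "2 * c * d * A \<le> \<tau> * ((\<tau> * d - A)\<^sup>2 + d^2)"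
          using \<open>0 < B * \<tau>\<close> by (simp add: zero_le_mult_iff)
        moreover have "4 * d * (1 - d^4) = 4 * (d * A) * (1 + d^2)" unfolding A_def by algebra
        moreover have "4 * (d * A) * (1 + d^2) \<le> 4 * (d * A) * (154 / 100)"
          using True A False by (intro mult_left_mono) auto
        moreover have "0 \<le> 10 * \<tau> * (d^4 / 2)" using \<tau>2 by simp
        ultimately show ?thesis by (simp add: c_def algebra_simps)
      next
        case d2: False
        \<comment> \<open>For larger d the square can be discarded: d^2 + d^4 / 2 alone outweighs
          the fifth moment.\<close>
        have "(54 / 100)\<^sup>2 \<le> (d^2)\<^sup>2" using d2 by (intro power_mono) auto
        then have d4: "2916 / 10000 \<le> d^4" by (simp add: power_divide)
        then have "4 * d * (1 - d^4) \<le> 4 * 1 * (1 - 2916 / 10000)"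
          using d False by (intro mult_mono) (auto simp: power_le_one)
        also have "\<dots> \<le> 10 * (1 / 2) * (54 / 100 + 2916 / 10000 / 2)" by simp
        also have "\<dots> \<le> 10 * \<tau> * ((\<tau> * d - A)\<^sup>2 + d^2 + d^4 / 2)"
        proof (intro mult_mono)
          show "54 / 100 + 2916 / 10000 / 2 \<le> (\<tau> * d - A)\<^sup>2 + d^2 + d^4 / 2"
            using d2 d4 zero_le_power2[of "\<tau> * d - A"] by linarith
        qed (use \<tau>2 in auto)
        finally show ?thesis .
      qed
      then show ?thesis using normal_moment5_nonneg[of \<tau>] by (simp add: \<Phi>_def)
    qed
  qed
  then show ?thesis using eq normal_moment5_minus[of \<tau>] by linarith
qed

text \<open>The threshold lies beyond both points, between them or below both. Between them only b
  contributes, and the maximiser a = (2 - t) / 6 of a (b - t)^5 is admissible, meaning a \<ge> -t,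
  exactly for t \<ge> -2/5. This is the origin of the inner case distinction.\<close>

lemma two_point_trunc5:
  assumes ab: "0 < a" "0 < b" "a + b = 2"
  shows "(a * trunc5 t b + b * trunc5 t (- a)) / 2 \<le> normal_moment5 t"
proof (cases "b \<le> t")
  case True
  then have "trunc5 t b = 0" "trunc5 t (- a) = 0" using ab by (auto simp: max_def)
  then show ?thesis using normal_moment5_nonneg by simp
next
  case tb: False
  show ?thesis
  proof (cases "- a \<le> t")
    case ta: True
    have eq: "(a * trunc5 t b + b * trunc5 t (- a)) / 2 = a / 2 * (b - t)^5"
      using tb ta by (simp add: max_def)
    show ?thesis
    proof (cases "- 2 / 5 \<le> t")
      case True
      txt \<open>The left-hand side is largest for \<open>a = (2 - t) / 6\<close>, which is the AM-GM bound below.\<close>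
      define v y where "v = 2 - t" and "y = b - t"
      have v: "0 < v" "0 < y" "v = a + y" using tb ab by (auto simp: v_def y_def)
      have "6 * y^5 * (5 * v / 6) \<le> 5 * y^6 + (5 * v / 6)^6"
        using v by (intro weighted_amgm_power6) auto
      then have "5 * (y^5 * (v - y)) \<le> (5 * v / 6)^6" by (simp add: algebra_simps power_numeral_reduce)
      moreover have "(5 * v / 6)^6 = (5 / 6)^6 * v^6" by (simp add: power_mult_distrib power_divide)
      moreover have "a / 2 * (b - t)^5 = y^5 * (v - y) / 2" using v by (simp add: y_def)
      ultimately have "a / 2 * (b - t)^5 \<le> (5 / 6)^6 / 10 * v^6" by linarith
      also have "\<dots> \<le> 335 / 10000 * v^6" by (intro mult_right_mono) (auto simp: power_divide)
      also have "\<dots> \<le> normal_moment5 t" unfolding v_def using True tb ab by (intro normal_moment5_ge_pow6) auto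
      finally show ?thesis using eq by simp
    next
      case False
      \<comment> \<open>The maximum now sits at the endpoint a = \<tau>, that is y = 1, with value
        16 \<tau>. Since a / \<tau> = 1 + 2 (1 - y) / \<tau> and 2 / \<tau> < 5, it suffices that
        y^5 (6 - 5 y) \<le> 1, which is AM-GM.\<close>
      define \<tau> y where "\<tau> = - t" and "y = (b - t) / 2"
      have \<tau>: "2 / 5 < \<tau>" "\<tau> \<le> a" "0 < y" using False ta tb by (auto simp: \<tau>_def y_def)
      have "a / \<tau> \<le> 1 + 5 * (1 - y)"
      proof -
        have "a - \<tau> = 2 * (1 - y)" using ab by (simp add: y_def \<tau>_def field_simps)
        moreover have "0 \<le> (1 - y) * (5 * \<tau> - 2)"
          using \<tau> ab \<open>a - \<tau> = 2 * (1 - y)\<close> by (intro mult_nonneg_nonneg) auto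
        ultimately show ?thesis using \<tau> by (simp add: field_simps)
      qed
      then have "y^5 * (a / \<tau>) \<le> y^5 * (1 + 5 * (1 - y))" using \<tau> by (intro mult_left_mono) auto
      also have "\<dots> \<le> 1" using weighted_amgm_power6[of y 1] \<tau> by (simp add: algebra_simps power_numeral_reduce)
      finally have "a * y^5 \<le> \<tau>" using \<tau> by (simp add: field_simps)
      then have "a / 2 * (b - t)^5 \<le> 16 * \<tau>" by (simp add: y_def power_divide)
      also have "\<dots> \<le> \<tau>^5 + 10 * \<tau>^3 + 15 * \<tau>"
      proof -
        have "(2 / 5)\<^sup>2 \<le> \<tau>^2" using \<tau> by (intro power_mono) auto
        then have "\<tau> * 1 \<le> \<tau> * (10 * \<tau>^2)" using \<tau> by (intro mult_left_mono) (auto simp: power2_eq_square)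
        moreover have "\<tau> * (10 * \<tau>^2) = 10 * \<tau>^3" by algebra
        moreover have "0 \<le> \<tau>^5" using \<tau> by simp
        ultimately show ?thesis by linarith
      qed
      also have "\<dots> \<le> normal_moment5 t"
        using normal_moment5_minus[of \<tau>] normal_moment5_nonneg[of \<tau>] by (simp add: \<tau>_def)
      finally show ?thesis using eq by simp
    qed
  next
    case False
    have eq: "- a - t = - t - a" by simp
    show ?thesis using False two_point_left_tail[OF ab, of "- t"] ab by (simp add: max_def eq)
  qed
qed

section \<open>From truncated moments to tails\<close>

text \<open>The Mills ratio bound: with x fixed, x times the tail minus the density is nondecreasing
  on [x, \<infinity>) and tends to 0.\<close>

lemma normal_tail_le_density: "x * normal_tail x \<le> std_normal_density x"
proof -
  define A where "A z = x * normal_tail z - std_normal_density z" for z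
  have der: "(A has_real_derivative (z - x) * std_normal_density z) (at z)" for z
    using DERIV_diff[OF DERIV_cmult[OF DERIV_normal_tail] DERIV_std_normal_density]
    by (simp add: algebra_simps A_def[abs_def])
  have mono: "A x \<le> A z" if "x \<le> z" for z
    by (rule DERIV_nonneg_imp_nondecreasing[OF that]) (use der in force)
  have "((\<lambda>z. 1 / sqrt (2 * pi) * exp (- (z^2 / 2))) \<longlongrightarrow> 1 / sqrt (2 * pi) * 0) at_top"
    by (intro tendsto_mult tendsto_const) real_asymp
  then have "(A \<longlongrightarrow> x * 0 - 0) at_top"
    unfolding A_def[abs_def]
    by (intro tendsto_intros normal_tail_at_top) (simp add: std_normal_density_def[abs_def])
  then have "A x \<le> x * 0 - 0"
    by (rule tendsto_lowerbound) (use mono in \<open>auto simp: eventually_at_top_linorder\<close>)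
  then show ?thesis by (simp add: A_def)
qed

text \<open>\<open>hz\<close> is the hazard rate, minus the logarithmic derivative of the tail. The
  Mills ratio bound makes it nondecreasing, so the ratio \<open>g\<close> of the tail to its
  exponential tangent at x is largest at x.\<close>

lemma normal_tail_le_log_tangent:
  defines "hz \<equiv> \<lambda>x. std_normal_density x / normal_tail x"
  shows "normal_tail y \<le> normal_tail x * exp (- hz x * (y - x))"
proof -
  have "(hz has_real_derivative std_normal_density z * (std_normal_density z - z * normal_tail z) / (normal_tail z)\<^sup>2) (at z)" for z
    using DERIV_divide[OF DERIV_std_normal_density DERIV_normal_tail, of z] normal_tail_pos[of z]
    by (simp add: hz_def algebra_simps power2_eq_square)
  moreover have "0 \<le> std_normal_density z * (std_normal_density z - z * normal_tail z) / (normal_tail z)\<^sup>2" for z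
    using normal_tail_le_density[of z] by (intro divide_nonneg_nonneg mult_nonneg_nonneg) auto
  ultimately have hazard_mono: "hz u \<le> hz v" if "u \<le> v" for u v
    using DERIV_nonneg_imp_nondecreasing[OF that, of hz] by blast
  define g where "g y = normal_tail y * exp (hz x * (y - x))" for y
  have "((\<lambda>y. exp (hz x * (y - x))) has_real_derivative hz x * exp (hz x * (y - x))) (at y)" for y
    by (auto intro!: derivative_eq_intros)
  from DERIV_mult[OF DERIV_normal_tail this]
  have g: "(g has_real_derivative exp (hz x * (z - x)) * normal_tail z * (hz x - hz z)) (at z)" for z
    using normal_tail_pos[of z] by (simp add: g_def[abs_def] hz_def algebra_simps)
  have "g y \<le> g x"
  proof (cases "x \<le> y")
    case True
    have "exp (hz x * (z - x)) * normal_tail z * (hz x - hz z) \<le> 0" if "x \<le> z" for z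
      using hazard_mono[OF that] normal_tail_nonneg[of z] by (intro mult_nonneg_nonpos) auto
    with g show ?thesis using DERIV_nonpos_imp_nonincreasing[OF True, of g] by blast
  next
    case False
    then have yx: "y \<le> x" by simp
    have "0 \<le> exp (hz x * (z - x)) * normal_tail z * (hz x - hz z)" if "z \<le> x" for z
      using hazard_mono[OF that] normal_tail_nonneg[of z] by (intro mult_nonneg_nonneg) auto
    with g show ?thesis using DERIV_nonneg_imp_nondecreasing[OF yx, of g] by blast
  qed
  then have "g y * exp (- hz x * (y - x)) \<le> g x * exp (- hz x * (y - x))"
    by (intro mult_right_mono) auto
  then show ?thesis by (simp add: g_def mult.assoc exp_add[symmetric])
qed

lemma nn_integral_power_exp:
  fixes t x l :: real
  assumes l: "0 < l"
  shows "(\<integral>\<^sup>+ s. ennreal (5 * (s - t)^4 * exp (- l * (s - x))) * indicator {t..} s \<partial>lborel)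
    = ennreal (exp (l * (x - t)) * (120 / l^5))"
proof -
  have "(\<integral>\<^sup>+ s. ennreal (5 * (s - t)^4 * exp (- l * (s - x))) * indicator {t..} s \<partial>lborel)
      = ennreal (1 / l) * (\<integral>\<^sup>+ y. ennreal (5 * ((t + 1 / l * y) - t)^4 * exp (- l * ((t + 1 / l * y) - x)))
          * indicator {t..} (t + 1 / l * y) \<partial>lborel)"
    using l by (subst nn_integral_real_affine[where c = "1 / l" and t = t]) auto
  also have "(\<integral>\<^sup>+ y. ennreal (5 * ((t + 1 / l * y) - t)^4 * exp (- l * ((t + 1 / l * y) - x)))
          * indicator {t..} (t + 1 / l * y) \<partial>lborel)
      = (\<integral>\<^sup>+ y. ennreal (5 / l^4 * exp (l * (x - t))) * (ennreal (y^4 * exp (- y)) * indicator {0..} y) \<partial>lborel)"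
  proof (intro nn_integral_cong)
    fix y
    have e: "exp (- l * ((t + 1 / l * y) - x)) = exp (l * (x - t)) * exp (- y)"
      using l unfolding exp_add[symmetric] by (simp add: field_simps)
    have i: "indicator {t..} (t + 1 / l * y) = (indicator {0..} y :: ennreal)"
      using l by (auto simp: indicator_def zero_le_divide_iff)
    show "ennreal (5 * ((t + 1 / l * y) - t)^4 * exp (- l * ((t + 1 / l * y) - x)))
          * indicator {t..} (t + 1 / l * y)
      = ennreal (5 / l^4 * exp (l * (x - t))) * (ennreal (y^4 * exp (- y)) * indicator {0..} y)"
      unfolding e i using l by (auto simp: indicator_def ennreal_mult'[symmetric] power_divide)
  qed
  also have "\<dots> = ennreal (5 / l^4 * exp (l * (x - t))) * ennreal 24"
    by (subst nn_integral_cmult) (simp_all add: nn_intergal_power_times_exp_Ici fact_numeral)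
  also have "ennreal (1 / l) * (ennreal (5 / l^4 * exp (l * (x - t))) * ennreal 24)
      = ennreal (1 / l * (5 / l^4 * exp (l * (x - t)) * 24))"
    using l by (subst (1 2) ennreal_mult) auto
  also have "1 / l * (5 / l^4 * exp (l * (x - t)) * 24) = exp (l * (x - t)) * (120 / l^5)"
    using l by (simp add: power_numeral_reduce)
  finally show ?thesis .
qed

text \<open>Layer-cake formula: (z - t)_+^5 is the integral of 5 (s - t)^4 over [t, z], so Tonelli
  turns the moment into an integral of 5 (s - t)^4 against the tail. The exponential bound leaves
  the Gamma integral 5 * 4! / l^5.\<close>

lemma normal_moment5_le_exp:
  assumes l: "0 < l" and K: "\<And>s. normal_tail s \<le> K * exp (- l * (s - x))"
  shows "normal_moment5 t \<le> K * exp (l * (x - t)) * (120 / l^5)"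
proof -
  have K0: "0 \<le> K" using K[of x] normal_tail_nonneg[of x] by simp
  have "ennreal (trunc5 t z) = (\<integral>\<^sup>+ s. ennreal (5 * (s - t)^4) * indicator {t..} s * indicator {..z} s \<partial>lborel)" for z
  proof (cases "t \<le> z")
    case True
    have "(\<integral>\<^sup>+ s. ennreal (5 * (s - t)^4) * indicator {t..} s * indicator {..z} s \<partial>lborel)
        = (\<integral>\<^sup>+ s. ennreal (5 * (s - t)^4) * indicator {t..z} s \<partial>lborel)"
      by (intro nn_integral_cong) (auto simp: indicator_def)
    also have "\<dots> = (z - t)^5 - (t - t)^5"
      by (rule nn_integral_FTC_Icc[where F = "\<lambda>s. (s - t)^5"])
         (use True in \<open>auto intro!: derivative_eq_intros\<close>)
    finally show ?thesis using True by (simp add: max_def)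
  next
    case False
    then have "(\<lambda>s. ennreal (5 * (s - t)^4) * indicator {t..} s * indicator {..z} s) = (\<lambda>s. 0)"
      by (auto simp: indicator_def fun_eq_iff)
    then show ?thesis using False by (simp add: max_def)
  qed
  then have "ennreal (normal_moment5 t)
      = (\<integral>\<^sup>+ z. \<integral>\<^sup>+ s. ennreal (5 * (s - t)^4) * indicator {t..} s * indicator {..z} s \<partial>lborel \<partial>std_normal)"
    by (simp add: nn_integral_trunc5_std_normal[symmetric])
  also have "\<dots> = (\<integral>\<^sup>+ s. \<integral>\<^sup>+ z. ennreal (5 * (s - t)^4) * indicator {t..} s * indicator {z. s \<le> z} z \<partial>std_normal \<partial>lborel)"
  proof -
    interpret pair_sigma_finite std_normal lborel ..
    have "(\<lambda>(z, s). ennreal (5 * (s - t)^4) * indicator {t..} s * indicator {..z} s) \<in> borel_measurable (std_normal \<Otimes>\<^sub>M lborel)"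
      by (simp add: indicator_def[abs_def]) measurable
    from Fubini'[OF this] show ?thesis by (simp add: indicator_def)
  qed
  also have "\<dots> = (\<integral>\<^sup>+ s. ennreal (5 * (s - t)^4) * indicator {t..} s * ennreal (normal_tail s) \<partial>lborel)"
    by (intro nn_integral_cong)
       (simp add: nn_integral_cmult_indicator normal_tail_def std_normal.emeasure_eq_measure atLeast_def)
  also have "\<dots> \<le> (\<integral>\<^sup>+ s. ennreal K * (ennreal (5 * (s - t)^4 * exp (- l * (s - x))) * indicator {t..} s) \<partial>lborel)"
  proof (intro nn_integral_mono)
    fix s
    have "5 * (s - t)^4 * normal_tail s \<le> 5 * (s - t)^4 * (K * exp (- l * (s - x)))"
      by (intro mult_left_mono K) auto
    then show "ennreal (5 * (s - t)^4) * indicator {t..} s * ennreal (normal_tail s)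
        \<le> ennreal K * (ennreal (5 * (s - t)^4 * exp (- l * (s - x))) * indicator {t..} s)"
      using K0 normal_tail_nonneg[of s]
      by (auto simp: indicator_def ennreal_mult'[symmetric] mult_ac intro!: ennreal_leI)
  qed
  also have "\<dots> = ennreal (K * (exp (l * (x - t)) * (120 / l^5)))"
  proof -
    have "(\<integral>\<^sup>+ s. ennreal K * (ennreal (5 * (s - t)^4 * exp (- l * (s - x))) * indicator {t..} s) \<partial>lborel)
        = ennreal K * (\<integral>\<^sup>+ s. ennreal (5 * (s - t)^4 * exp (- l * (s - x))) * indicator {t..} s \<partial>lborel)"
      by (rule nn_integral_cmult) measurable
    then show ?thesis by (simp only: nn_integral_power_exp[OF l] ennreal_mult'[OF K0])
  qed
  finally show ?thesis
    using K0 l by (simp add: mult.assoc)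
qed

lemma tail_le_of_trunc5_moments_le:
  assumes "prob_space M" and S: "S \<in> borel_measurable M"
    and le: "\<And>t. (\<integral>\<^sup>+ \<omega>. ennreal (trunc5 t (S \<omega>)) \<partial>M) \<le> ennreal (normal_moment5 t)"
  shows "measure M {\<omega> \<in> space M. x \<le> S \<omega>} \<le> c_5_0 * normal_tail x"
proof -
  interpret prob_space M by fact
  define l where "l = std_normal_density x / normal_tail x"
  have l: "0 < l" using normal_tail_pos[of x] normal_density_pos[of 1] by (simp add: l_def)
  txt \<open>The bound below is proportional to \<open>exp y / y ^ 5\<close> with \<open>y = l * (x - t)\<close>, which is least at \<open>y = 5\<close>.\<close>
  define t where "t = x - 5 / l"
  have G: "normal_moment5 t \<le> normal_tail x * exp (l * (x - t)) * (120 / l^5)"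
    using normal_tail_le_log_tangent[of _ x] by (intro normal_moment5_le_exp[OF l]) (simp add: l_def)
  have xt: "l * (x - t) = 5" "x - t = 5 / l" using l by (simp_all add: t_def)
  have "ennreal ((5 / l)^5) * emeasure M {\<omega> \<in> space M. x \<le> S \<omega>}
      = (\<integral>\<^sup>+ \<omega>. ennreal ((5 / l)^5) * indicator {\<omega> \<in> space M. x \<le> S \<omega>} \<omega> \<partial>M)"
    using S by (subst nn_integral_cmult_indicator) auto
  also have "\<dots> \<le> (\<integral>\<^sup>+ \<omega>. ennreal (trunc5 t (S \<omega>)) \<partial>M)"
    using l by (intro nn_integral_mono) (auto simp: indicator_def t_def intro!: ennreal_leI power_mono)
  also have "\<dots> \<le> ennreal (normal_tail x * exp 5 * (120 / l^5))"
    using order_trans[OF le[of t] ennreal_leI[OF G]] unfolding xt(1) .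
  finally have "(5 / l)^5 * measure M {\<omega> \<in> space M. x \<le> S \<omega>} \<le> normal_tail x * exp 5 * (120 / l^5)"
    using l normal_tail_nonneg[of x] by (simp add: emeasure_eq_measure ennreal_mult'[symmetric])
  then have "measure M {\<omega> \<in> space M. x \<le> S \<omega>} \<le> (120 * exp 5 / 5^5) * normal_tail x"
    using l by (simp add: power_divide field_simps)
  also have "120 * exp 5 / 5^5 = c_5_0"
    by (simp add: c_5_0_def fact_numeral power_divide exp_of_nat_mult[of 5 1, simplified])
  finally show ?thesis .
qed

section \<open>From truncated fifth powers to \<open>H_plus 5\<close>\<close>

text \<open>The conditional matters at k = 0: the kernel must be the indicator of
  \<open>{t..}\<close> there, whereas \<open>max 0 (x - t) ^ 0\<close> is 1 everywhere.\<close>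

abbreviation trunc :: "nat \<Rightarrow> real \<Rightarrow> real \<Rightarrow> real" where
  "trunc k t x \<equiv> (if t \<le> x then (x - t) ^ k / fact k else 0)"

lemma nn_integral_trunc:
  "(\<integral>\<^sup>+ y. ennreal (trunc k s y) * indicator {..x} y \<partial>lborel) = ennreal (trunc (Suc k) s x)"
proof (cases "s \<le> x")
  case True
  have "(\<integral>\<^sup>+ y. ennreal (trunc k s y) * indicator {..x} y \<partial>lborel)
      = (\<integral>\<^sup>+ y. ennreal ((y - s) ^ k / fact k) * indicator {s..x} y \<partial>lborel)"
    by (intro nn_integral_cong) (auto simp: indicator_def)
  also have "\<dots> = (x - s) ^ Suc k / fact (Suc k) - (s - s) ^ Suc k / fact (Suc k)"
  proof (rule nn_integral_FTC_Icc[where F = "\<lambda>y. (y - s) ^ Suc k / fact (Suc k)"])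
    fix y
    have "((\<lambda>y. (y - s) ^ Suc k) has_real_derivative real (Suc k) * (y - s) ^ k) (at y)"
      by (auto intro!: derivative_eq_intros simp del: power_Suc)
    from DERIV_cdivide[OF this, of "fact (Suc k)"]
    have "((\<lambda>y. (y - s) ^ Suc k / fact (Suc k)) has_real_derivative
        real (Suc k) * (y - s) ^ k / fact (Suc k)) (at y)" .
    moreover have "real (Suc k) * (y - s) ^ k / fact (Suc k) = (y - s) ^ k / fact k"
      by (simp del: of_nat_Suc)
    ultimately show "((\<lambda>y. (y - s) ^ Suc k / fact (Suc k)) has_real_derivative (y - s) ^ k / fact k) (at y)"
      by metis
  qed (use True in auto)
  finally show ?thesis using True by simp
next
  case False
  then have "(\<lambda>y. ennreal (trunc k s y) * indicator {..x} y) = (\<lambda>_. 0)"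
    by (auto simp: fun_eq_iff indicator_def)
  then show ?thesis using False by simp
qed

lemma nn_integral_FTC_atMost:
  fixes f :: "real \<Rightarrow> real"
  assumes f: "f \<in> borel_measurable borel" and nonneg: "\<And>x. 0 \<le> f x"
    and F: "\<And>x. (F has_real_derivative f x) (at x)" and lim: "(F \<longlongrightarrow> 0) at_bot"
  shows "(\<integral>\<^sup>+ y. ennreal (f y) * indicator {..x} y \<partial>lborel) = ennreal (F x)"
proof -
  have "(\<integral>\<^sup>+ y. ennreal (f y) * indicator {..x} y \<partial>lborel)
      = (\<integral>\<^sup>+ y. ennreal (f (- y)) * indicator {- x..} y \<partial>lborel)"
    using f by (subst nn_integral_real_affine[where c = "- 1" and t = 0])
      (auto intro!: nn_integral_cong simp: indicator_def)
  also have "\<dots> = ennreal (0 - (- F (- (- x))))"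
  proof (rule nn_integral_FTC_atLeast[where F = "\<lambda>y. - F (- y)"])
    show "((\<lambda>y. - F (- y)) \<longlongrightarrow> 0) at_top"
      using tendsto_minus[OF filterlim_compose[OF lim filterlim_uminus_at_bot_at_top]] by simp
    show "((\<lambda>y. - F (- y)) has_real_derivative f (- y)) (at y)" for y
      using DERIV_minus[OF DERIV_chain'[OF DERIV_minus[OF DERIV_ident] F]] by simp
  qed (use f nonneg in auto)
  finally show ?thesis by simp
qed

text \<open>Integrating the representation of \<open>f\<close> over \<open>{..x}\<close> raises the
  order of the kernel by one. All integrands are nonnegative, so Tonelli applies without any
  integrability.\<close>

lemma taylor_at_bot_step:
  fixes q :: "real \<Rightarrow> ennreal"
  assumes q: "q \<in> borel_measurable borel"
    and f: "\<And>x. ennreal (f x) = (\<integral>\<^sup>+ s. q s * ennreal (trunc k s x) \<partial>lborel)"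
    and fb: "f \<in> borel_measurable borel" and nonneg: "\<And>x. 0 \<le> f x"
    and F: "\<And>x. (F has_real_derivative f x) (at x)" and lim: "(F \<longlongrightarrow> 0) at_bot"
  shows "ennreal (F x) = (\<integral>\<^sup>+ s. q s * ennreal (trunc (Suc k) s x) \<partial>lborel)"
proof -
  note [measurable] = q
  have "ennreal (F x) = (\<integral>\<^sup>+ y. ennreal (f y) * indicator {..x} y \<partial>lborel)"
    by (rule nn_integral_FTC_atMost[OF fb nonneg F lim, symmetric])
  also have "\<dots> = (\<integral>\<^sup>+ y. \<integral>\<^sup>+ s. q s * (ennreal (trunc k s y) * indicator {z. z \<le> x} y) \<partial>lborel \<partial>lborel)"
    by (auto intro!: nn_integral_cong simp: f indicator_def)
  also have "\<dots> = (\<integral>\<^sup>+ s. \<integral>\<^sup>+ y. q s * (ennreal (trunc k s y) * indicator {z. z \<le> x} y) \<partial>lborel \<partial>lborel)"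
    by (rule lborel_pair.Fubini') measurable
  also have "\<dots> = (\<integral>\<^sup>+ s. q s * ennreal (trunc (Suc k) s x) \<partial>lborel)"
    by (intro nn_integral_cong)
       (subst nn_integral_cmult, auto simp: nn_integral_trunc[symmetric] atMost_def)
  finally show ?thesis .
qed

lemma has_real_derivative_deriv_iter:
  assumes "f \<in> H_plus \<alpha>" "j < \<alpha> - 1"
  shows "((deriv ^^ j) f has_real_derivative (deriv ^^ Suc j) f x) (at x)"
  using assms by (auto simp: H_plus_def DERIV_deriv_iff_real_differentiable)

text \<open>Makes \<open>H_plus_nonneg\<close> available for all derivatives up to order 4, which is
  the sign condition for the Taylor steps.\<close>

lemma H_plus_deriv:
  assumes "f \<in> H_plus \<alpha>" "j \<le> \<alpha> - 1"
  shows "(deriv ^^ j) f \<in> H_plus (\<alpha> - j)"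
  unfolding H_plus_def
proof (intro CollectI conjI allI impI)
  have eq: "(deriv ^^ i) ((deriv ^^ j) f) = (deriv ^^ (i + j)) f" for i
    by (simp add: funpow_add)
  fix i x assume "i < \<alpha> - j - 1"
  then show "(deriv ^^ i) ((deriv ^^ j) f) differentiable (at x)"
    using assms unfolding eq by (auto simp: H_plus_def)
next
  have "\<alpha> - j - 1 + j = \<alpha> - 1" using assms by simp
  then show "convex_on UNIV ((deriv ^^ (\<alpha> - j - 1)) ((deriv ^^ j) f))"
    using assms by (simp add: funpow_add[symmetric, THEN fun_cong, unfolded o_def] H_plus_def)
next
  fix i assume "i \<le> \<alpha> - j - 1"
  then show "((deriv ^^ i) ((deriv ^^ j) f) \<longlongrightarrow> 0) at_bot"
    using assms by (auto simp: H_plus_def funpow_add[symmetric, THEN fun_cong, unfolded o_def])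
qed

lemma H_plus_taylor:
  assumes f: "f \<in> H_plus 5"
  defines "h \<equiv> (deriv ^^ 4) f"
  shows "convex_on UNIV h" and "\<And>x. 0 \<le> h x" and "h \<in> borel_measurable borel"
    and "\<And>x. ennreal (f x) = (\<integral>\<^sup>+ s. ennreal (h s) * ennreal (trunc 3 s x) \<partial>lborel)"
proof -
  show cvx: "convex_on UNIV h" using f by (simp add: H_plus_def h_def)
  have nonneg: "0 \<le> (deriv ^^ j) f x" if "j \<le> 4" for j x
    using H_plus_nonneg[OF H_plus_deriv[OF f]] that by simp
  then show "\<And>x. 0 \<le> h x" by (simp add: h_def)
  show hb: "h \<in> borel_measurable borel"
    using convex_on_continuous[OF open_UNIV cvx] by (rule borel_measurable_continuous_onI)
  have der: "((deriv ^^ j) f has_real_derivative (deriv ^^ Suc j) f x) (at x)" if "j < 4" for j x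
    using has_real_derivative_deriv_iter[OF f] that by simp
  have lim: "((deriv ^^ j) f \<longlongrightarrow> 0) at_bot" if "j \<le> 4" for j
    using f that by (auto simp: H_plus_def)
  have meas: "(deriv ^^ j) f \<in> borel_measurable borel" if "j < 4" for j
    using der[OF that] by (intro borel_measurable_continuous_onI continuous_at_imp_continuous_on ballI)
      (blast intro: DERIV_isCont)
  \<comment> \<open>Induction downwards in the order of the derivative: a kernel of order k
    represents the derivative of order 3 - k, starting from the third derivative as the integral of
    \<open>h\<close>.\<close>
  have "ennreal ((deriv ^^ (3 - k)) f x) = (\<integral>\<^sup>+ s. ennreal (h s) * ennreal (trunc k s x) \<partial>lborel)"
    if "k \<le> 3" for k x
    using that
  proof (induction k arbitrary: x)
    case 0
    have "ennreal ((deriv ^^ 3) f x) = (\<integral>\<^sup>+ y. ennreal (h y) * indicator {..x} y \<partial>lborel)"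
      using der[of 3] lim[of 3] nonneg[of 4] hb
      by (intro nn_integral_FTC_atMost[symmetric]) (auto simp: h_def eval_nat_numeral)
    then show ?case by (auto intro!: nn_integral_cong simp: indicator_def)
  next
    case (Suc k)
    have j: "3 - k = Suc (3 - Suc k)" using Suc.prems by simp
    show ?case
    proof (rule taylor_at_bot_step[where f = "(deriv ^^ (3 - k)) f"])
      show "((deriv ^^ (3 - Suc k)) f has_real_derivative (deriv ^^ (3 - k)) f x) (at x)" for x
        unfolding j using Suc.prems by (intro der) auto
    qed (use Suc hb nonneg lim meas in auto)
  qed
  from this[of 3] show "\<And>x. ennreal (f x) = (\<integral>\<^sup>+ s. ennreal (h s) * ennreal (trunc 3 s x) \<partial>lborel)"
    by simp
qed

section \<open>Second differences of the truncated fifth power\<close>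

lemma DERIV_max_0_power:
  fixes y :: real
  shows "((\<lambda>y. max 0 y ^ Suc (Suc k)) has_real_derivative real (Suc (Suc k)) * max 0 y ^ Suc k) (at y)"
proof (cases y "0 :: real" rule: linorder_cases)
  case less
  have "((\<lambda>_. 0) has_real_derivative 0) (at y)" by simp
  then have "((\<lambda>y. max 0 y ^ Suc (Suc k)) has_real_derivative 0) (at y)"
    by (rule DERIV_cong_ev[THEN iffD1, rotated -1, OF _ refl])
       (use less in \<open>auto intro: eventually_mono[OF eventually_nhds_in_open[of "{..<0}"]]\<close>)
  then show ?thesis using less by simp
next
  case greater
  have "((\<lambda>y. y ^ Suc (Suc k)) has_real_derivative real (Suc (Suc k)) * y ^ Suc k) (at y)"
    by (auto intro!: derivative_eq_intros simp del: power_Suc)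
  then have "((\<lambda>y. max 0 y ^ Suc (Suc k)) has_real_derivative real (Suc (Suc k)) * y ^ Suc k) (at y)"
    by (rule DERIV_cong_ev[THEN iffD1, rotated -1, OF _ refl])
       (use greater in \<open>auto intro!: eventually_mono[OF eventually_nhds_in_open[of "{0<..}"]]\<close>)
  then show ?thesis using greater by simp
next
  case equal
  have "((\<lambda>h::real. max 0 h ^ Suc k) \<longlongrightarrow> max 0 0 ^ Suc k) (at 0)"
    by (intro tendsto_intros)
  then have "((\<lambda>h::real. max 0 h ^ Suc k) \<longlongrightarrow> 0) (at 0)" by simp
  then have "((\<lambda>h::real. (max 0 (0 + h) ^ Suc (Suc k) - max 0 0 ^ Suc (Suc k)) / h) \<longlongrightarrow> 0) (at 0)"
    by (rule Lim_transform_eventually) (auto simp: eventually_at_filter max_def)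
  then show ?thesis using equal by (simp add: DERIV_def)
qed

text \<open>Backward second difference of y_+^5 / 5!. Divided by d^2 it tends to the second
  derivative y_+^3 / 3!, the kernel of Taylor's formula.\<close>

definition second_diff :: "real \<Rightarrow> real \<Rightarrow> real" where
  "second_diff y d = (max 0 y ^ 5 - 2 * max 0 (y - d) ^ 5 + max 0 (y - 2 * d) ^ 5) / 120"

text \<open>As a function of the step e the second difference vanishes at 0. By the mean value
  theorem its derivative is e / 3 times (z_+)^3 at some z between y - 2 e and y - e; comparing with
  multiples of e^2 gives both bounds.\<close>

lemma second_diff_bounds:
  assumes d: "0 \<le> d"
  shows "d^2 * max 0 (y - 2 * d) ^ 3 / 6 \<le> second_diff y d"
    and "second_diff y d \<le> d^2 * max 0 y ^ 3 / 6"
proof -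
  define p where "p = (\<lambda>(k::nat) (y::real). max 0 y ^ k)"
  have der: "(p 5 has_real_derivative 5 * p 4 y) (at y)" "(p 4 has_real_derivative 4 * p 3 y) (at y)" for y
    using DERIV_max_0_power[of 3 y] DERIV_max_0_power[of 2 y] by (simp_all add: p_def eval_nat_numeral)
  have mono: "p 3 u \<le> p 3 v" if "u \<le> v" for u v
    unfolding p_def using that by (intro power_mono) auto
  define u where "u e = (p 5 y - 2 * p 5 (y - e) + p 5 (y - 2 * e)) / 120" for e
  define u' where "u' e = (p 4 (y - e) - p 4 (y - 2 * e)) / 12" for e
  have shift: "((\<lambda>e. p 5 (y - c * e)) has_real_derivative 5 * p 4 (y - c * e) * - c) (at e)" for c e
    by (rule DERIV_chain2[OF der(1)]) (auto intro!: derivative_eq_intros)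
  have u: "(u has_real_derivative u' e) (at e)" for e
  proof -
    have "((\<lambda>e. (p 5 y - 2 * p 5 (y - 1 * e) + p 5 (y - 2 * e)) / 120) has_real_derivative
        (0 - 2 * (5 * p 4 (y - 1 * e) * - 1) + 5 * p 4 (y - 2 * e) * - 2) / 120) (at e)"
      by (intro DERIV_cdivide DERIV_add DERIV_diff DERIV_const DERIV_cmult shift)
    moreover have "(0 - 2 * (5 * p 4 (y - 1 * e) * - 1) + 5 * p 4 (y - 2 * e) * - 2) / 120 = u' e"
      by (simp add: u'_def field_simps)
    moreover have "(\<lambda>e. (p 5 y - 2 * p 5 (y - 1 * e) + p 5 (y - 2 * e)) / 120) = u"
      by (simp add: u_def fun_eq_iff)
    ultimately show ?thesis by (simp only:)
  qed
  have u'_bd: "e * p 3 (y - 2 * d) / 3 \<le> u' e" "u' e \<le> e * p 3 y / 3" if e: "0 \<le> e" "e \<le> d" for e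
  proof -
    have "\<exists>z. y - 2 * e \<le> z \<and> z \<le> y - e \<and> p 4 (y - e) - p 4 (y - 2 * e) = e * (4 * p 3 z)"
    proof (cases "e = 0")
      case False
      then have "y - 2 * e < y - e" using e by simp
      from MVT2[OF this, of "p 4" "\<lambda>z. 4 * p 3 z"] der(2)
      obtain z where "y - 2 * e < z" "z < y - e"
        "p 4 (y - e) - p 4 (y - 2 * e) = (y - e - (y - 2 * e)) * (4 * p 3 z)" by blast
      moreover have "y - e - (y - 2 * e) = e" by simp
      ultimately show ?thesis by (intro exI[of _ z]) simp
    qed auto
    then obtain z where z: "y - 2 * e \<le> z" "z \<le> y - e" "p 4 (y - e) - p 4 (y - 2 * e) = e * (4 * p 3 z)" by blast
    have "e * p 3 (y - 2 * d) \<le> e * p 3 z" "e * p 3 z \<le> e * p 3 y"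
      using e z by (auto intro!: mult_left_mono mono)
    then show "e * p 3 (y - 2 * d) / 3 \<le> u' e" "u' e \<le> e * p 3 y / 3"
      using z(3) by (simp_all add: u'_def)
  qed
  have q: "((\<lambda>e. e^2 * c / 6) has_real_derivative e * c / 3) (at e)" for c e :: real
    by (auto intro!: derivative_eq_intros)
  have "(\<lambda>e. u e - e^2 * p 3 (y - 2 * d) / 6) 0 \<le> (\<lambda>e. u e - e^2 * p 3 (y - 2 * d) / 6) d"
  proof (rule DERIV_nonneg_imp_nondecreasing[OF d])
    fix e assume "0 \<le> e" "e \<le> d"
    then show "\<exists>z. ((\<lambda>e. u e - e^2 * p 3 (y - 2 * d) / 6) has_real_derivative z) (at e) \<and> 0 \<le> z"
      using u'_bd(1)[of e] by (intro exI[of _ "u' e - e * p 3 (y - 2 * d) / 3"] conjI DERIV_diff u q) simp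
  qed
  then show "d^2 * max 0 (y - 2 * d) ^ 3 / 6 \<le> second_diff y d"
    by (simp add: u_def second_diff_def p_def)
  have "(\<lambda>e. e^2 * p 3 y / 6 - u e) 0 \<le> (\<lambda>e. e^2 * p 3 y / 6 - u e) d"
  proof (rule DERIV_nonneg_imp_nondecreasing[OF d])
    fix e assume "0 \<le> e" "e \<le> d"
    then show "\<exists>z. ((\<lambda>e. e^2 * p 3 y / 6 - u e) has_real_derivative z) (at e) \<and> 0 \<le> z"
      using u'_bd(2)[of e] by (intro exI[of _ "e * p 3 y / 3 - u' e"] conjI DERIV_diff u q) simp
  qed
  then show "second_diff y d \<le> d^2 * max 0 y ^ 3 / 6"
    by (simp add: u_def second_diff_def p_def)
qed

lemma second_diff_nonneg: "0 \<le> d \<Longrightarrow> 0 \<le> second_diff y d"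
  by (rule order_trans[OF _ second_diff_bounds(1)]) auto

lemma second_diff_tendsto:
  assumes d: "\<And>n. 0 < d n" "d \<longlonglongrightarrow> 0"
  shows "(\<lambda>n. second_diff y (d n) / (d n)\<^sup>2) \<longlonglongrightarrow> max 0 y ^ 3 / 6"
proof (rule tendsto_sandwich)
  have d2: "0 < (d n)\<^sup>2" for n using d(1)[of n] by simp
  show "(\<lambda>n. max 0 (y - 2 * d n) ^ 3 / 6) \<longlonglongrightarrow> max 0 y ^ 3 / 6"
  proof -
    have "(\<lambda>n. max 0 (y - 2 * d n) ^ 3 / 6) \<longlonglongrightarrow> max 0 (y - 2 * 0) ^ 3 / 6"
      by (intro tendsto_intros d(2)) auto
    then show ?thesis by simp
  qed
  show "\<forall>\<^sub>F n in sequentially. max 0 (y - 2 * d n) ^ 3 / 6 \<le> second_diff y (d n) / (d n)\<^sup>2"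
    using second_diff_bounds(1)[where y = y, OF less_imp_le[OF d(1)]] d2
    by (intro always_eventually allI) (simp add: pos_le_divide_eq mult.commute)
  show "\<forall>\<^sub>F n in sequentially. second_diff y (d n) / (d n)\<^sup>2 \<le> max 0 y ^ 3 / 6"
    using second_diff_bounds(2)[where y = y, OF less_imp_le[OF d(1)]] d2
    by (intro always_eventually allI) (simp add: pos_divide_le_eq mult.commute)
qed (rule tendsto_const)

text \<open>Second differences of \<open>g\<close> are traded for second differences of the kernel. The support condition
  is essential: without it \<open>\<integral> g(s) (x - s)\<^sub>+\<^sup>5 ds\<close> may diverge at \<open>- \<infinity>\<close>.\<close>
lemma nn_integral_second_diff:
  fixes g :: "real \<Rightarrow> real"
  assumes cvx: "convex_on UNIV g" and nonneg: "\<And>s. 0 \<le> g s" and zero: "\<And>s. s \<le> a \<Longrightarrow> g s = 0" and d: "0 < d"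
  shows "(\<integral>\<^sup>+ s. ennreal (g s) * ennreal (second_diff (x - s) d) \<partial>lborel)
    = (\<integral>\<^sup>+ s. ennreal ((g s - 2 * g (s - d) + g (s - 2 * d)) / 120) * ennreal (max 0 (x - s) ^ 5) \<partial>lborel)"
proof -
  have cont: "continuous_on UNIV g" using convex_on_continuous[OF open_UNIV cvx] .
  then have [measurable]: "g \<in> borel_measurable borel" by (rule borel_measurable_continuous_onI)
  define q where "q c s = ennreal (g s * (max 0 (x - s - c) ^ 5 / 120))" for c s
  define T where "T c = integral\<^sup>N lborel (q c)" for c
  have [measurable]: "q c \<in> borel_measurable borel" for c unfolding q_def by measurable
  have shift: "(\<integral>\<^sup>+ s. ennreal (g (s - c) * (max 0 (x - s) ^ 5 / 120)) \<partial>lborel) = T c" for c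
    unfolding T_def q_def
    by (subst nn_integral_real_affine[where c = 1 and t = c]) (auto simp: algebra_simps)
  \<comment> \<open>\<open>T d\<close> is cancelled at the end, which in \<open>ennreal\<close>
    requires finiteness. The integrand lives on [a, x] and is bounded there because \<open>g\<close>
    is continuous.\<close>
  have fin: "T d \<noteq> \<infinity>"
  proof -
    have "compact (g ` {a..x})"
      by (intro compact_continuous_image continuous_on_subset[OF cont]) auto
    then obtain B where B: "\<And>s. s \<in> {a..x} \<Longrightarrow> g s \<le> B"
      using bounded_imp_bdd_above[OF compact_imp_bounded] by (force simp: bdd_above_def)
    have "T d \<le> (\<integral>\<^sup>+ s. ennreal (\<bar>B\<bar> * (max 0 (x - a) ^ 5 / 120)) * indicator {a..x} s \<partial>lborel)"
      unfolding T_def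
    proof (intro nn_integral_mono)
      fix s
      show "q d s \<le> ennreal (\<bar>B\<bar> * (max 0 (x - a) ^ 5 / 120)) * indicator {a..x} s"
      proof (cases "s \<in> {a..x}")
        case True
        then have "g s * (max 0 (x - s - d) ^ 5 / 120) \<le> \<bar>B\<bar> * (max 0 (x - a) ^ 5 / 120)"
          using B[OF True] d by (intro mult_mono divide_right_mono power_mono) auto
        then show ?thesis using True by (simp add: q_def ennreal_leI)
      next
        case False
        then have "g s * (max 0 (x - s - d) ^ 5 / 120) = 0" using zero[of s] d by (auto simp: max_def)
        then show ?thesis unfolding q_def by (simp only: ennreal_0 zero_le)
      qed
    qed
    also have "\<dots> < \<infinity>" by (simp add: nn_integral_cmult_indicator ennreal_mult_less_top emeasure_lborel_Icc_eq)
    finally show ?thesis by simp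
  qed
  have D: "0 \<le> g s - 2 * g (s - d) + g (s - 2 * d)" for s
  proof -
    have "(1 - 1 / 2) * s + (1 / 2) * (s - 2 * d) = s - d" by (simp add: algebra_simps)
    then show ?thesis using convex_onD[OF cvx, of "1 / 2" s "s - 2 * d"] by simp
  qed
  let ?L = "\<lambda>s. ennreal (g s) * ennreal (second_diff (x - s) d)"
  let ?R = "\<lambda>s. ennreal ((g s - 2 * g (s - d) + g (s - 2 * d)) / 120) * ennreal (max 0 (x - s) ^ 5)"
  have [measurable]: "(\<lambda>s. second_diff (x - s) d) \<in> borel_measurable borel"
    unfolding second_diff_def by measurable
  \<comment> \<open>The negative middle term of each second difference is moved to the other side,
    avoiding subtraction in \<open>ennreal\<close>; both sides then become
    \<open>T 0 + T (2 * d)\<close>.\<close>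
  have "integral\<^sup>N lborel ?L + (T d + T d) = (\<integral>\<^sup>+ s. ?L s + (q d s + q d s) \<partial>lborel)"
    unfolding T_def by (simp add: nn_integral_add)
  also have "\<dots> = (\<integral>\<^sup>+ s. q 0 s + q (2 * d) s \<partial>lborel)"
  proof (intro nn_integral_cong)
    fix s
    have "?L s + (q d s + q d s) = ennreal (g s * second_diff (x - s) d + (g s * (max 0 (x - s - d) ^ 5 / 120) + g s * (max 0 (x - s - d) ^ 5 / 120)))"
      using nonneg[of s] second_diff_nonneg[of d "x - s"] d
      by (simp add: q_def ennreal_mult'[symmetric] del: ennreal_plus flip: ennreal_plus)
    also have "g s * second_diff (x - s) d + (g s * (max 0 (x - s - d) ^ 5 / 120) + g s * (max 0 (x - s - d) ^ 5 / 120))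
        = g s * (max 0 (x - s - 0) ^ 5 / 120) + g s * (max 0 (x - s - 2 * d) ^ 5 / 120)"
      unfolding second_diff_def by (simp add: field_simps)
    also have "ennreal \<dots> = q 0 s + q (2 * d) s"
      unfolding q_def using nonneg[of s] by (intro ennreal_plus) auto
    finally show "?L s + (q d s + q d s) = q 0 s + q (2 * d) s" .
  qed
  also have "\<dots> = T 0 + T (2 * d)"
    unfolding T_def by (simp add: nn_integral_add)
  finally have L: "integral\<^sup>N lborel ?L + (T d + T d) = T 0 + T (2 * d)" .
  let ?q = "\<lambda>c s. ennreal (g (s - c) * (max 0 (x - s) ^ 5 / 120))"
  have "integral\<^sup>N lborel ?R + (T d + T d) = (\<integral>\<^sup>+ s. ?R s + (?q d s + ?q d s) \<partial>lborel)"
    unfolding shift[symmetric] by (simp add: nn_integral_add)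
  also have "\<dots> = (\<integral>\<^sup>+ s. ?q 0 s + ?q (2 * d) s \<partial>lborel)"
  proof (intro nn_integral_cong)
    fix s
    define m where "m = max 0 (x - s) ^ 5"
    have m: "0 \<le> m" by (simp add: m_def)
    have "?R s + (?q d s + ?q d s) = ennreal ((g s - 2 * g (s - d) + g (s - 2 * d)) / 120 * m + (g (s - d) * (m / 120) + g (s - d) * (m / 120)))"
      using nonneg[of "s - d"] D[of s] m unfolding m_def[symmetric]
      by (simp add: ennreal_mult'[symmetric] del: ennreal_plus flip: ennreal_plus)
    also have "(g s - 2 * g (s - d) + g (s - 2 * d)) / 120 * m + (g (s - d) * (m / 120) + g (s - d) * (m / 120))
        = g (s - 0) * (m / 120) + g (s - 2 * d) * (m / 120)"
      by (simp add: field_simps)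
    also have "ennreal \<dots> = ?q 0 s + ?q (2 * d) s"
      unfolding m_def using nonneg[of s] nonneg[of "s - 2 * d"] by (simp add: ennreal_plus)
    finally show "?R s + (?q d s + ?q d s) = ?q 0 s + ?q (2 * d) s" .
  qed
  also have "\<dots> = T 0 + T (2 * d)"
    unfolding shift[symmetric] by (simp add: nn_integral_add)
  finally have R: "integral\<^sup>N lborel ?R + (T d + T d) = T 0 + T (2 * d)" .
  have "(T d + T d) + integral\<^sup>N lborel ?L = (T d + T d) + integral\<^sup>N lborel ?R"
    using L R by (simp add: add.commute)
  then show ?thesis using fin unfolding ennreal_add_left_cancel by simp
qed

text \<open>Each approximant \<open>f' n\<close> is a mixture of truncated fifth powers with density
  \<open>c n\<close>, so Tonelli transfers the hypothesis to it. It lies below \<open>f\<close>,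
  which controls the \<nu>-side, while \<open>f\<close> is at most its lower limit, so Fatou
  recovers the \<mu>-side even if the integrals are infinite.\<close>

lemma H_plus_5_integral_le:
  fixes \<mu> \<nu> :: "real measure"
  assumes \<mu>: "finite_measure \<mu>" "sets \<mu> = sets borel" and \<nu>: "finite_measure \<nu>" "sets \<nu> = sets borel"
    and le: "\<And>t. (\<integral>\<^sup>+ x. ennreal (max 0 (x - t) ^ 5) \<partial>\<mu>) \<le> (\<integral>\<^sup>+ x. ennreal (max 0 (x - t) ^ 5) \<partial>\<nu>)"
    and f: "f \<in> H_plus 5"
  shows "(\<integral>\<^sup>+ x. ennreal (f x) \<partial>\<mu>) \<le> (\<integral>\<^sup>+ x. ennreal (f x) \<partial>\<nu>)"
proof -
  note [measurable_cong] = \<mu>(2) \<nu>(2)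
  define h where "h = (deriv ^^ 4) f"
  note H = H_plus_taylor[OF f, folded h_def]
  have [measurable]: "h \<in> borel_measurable borel" by (rule H(3))
  define d where "d n = 1 / real (Suc n)" for n
  have d: "0 < d n" for n by (simp add: d_def)
  have d0: "d \<longlonglongrightarrow> 0" unfolding d_def by (rule LIMSEQ_Suc[OF lim_1_over_n])
  txt \<open>Cutting off \<open>h\<close> at the height \<open>d n\<close> keeps it convex and makes it vanish near \<open>- \<infinity>\<close>.\<close>
  define g where "g n s = max 0 (h s - d n)" for n s
  have [measurable]: "g n \<in> borel_measurable borel" for n unfolding g_def by measurable
  have g: "convex_on UNIV (g n)" for n
  proof (rule convex_onI)
    fix t x y :: real assume t: "0 < t" "t < 1"
    have "h ((1 - t) *\<^sub>R x + t *\<^sub>R y) \<le> (1 - t) * h x + t * h y"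
      using convex_onD[OF H(1), of t x y] t by simp
    then have "h ((1 - t) *\<^sub>R x + t *\<^sub>R y) - d n \<le> (1 - t) * (h x - d n) + t * (h y - d n)"
      by (simp add: algebra_simps)
    also have "\<dots> \<le> (1 - t) * g n x + t * g n y"
      using t by (intro add_mono mult_left_mono) (auto simp: g_def)
    finally show "g n ((1 - t) *\<^sub>R x + t *\<^sub>R y) \<le> (1 - t) * g n x + t * g n y"
      using t by (auto simp: g_def)
  qed auto
  have lim: "(h \<longlongrightarrow> 0) at_bot" using f by (simp add: H_plus_def h_def)
  have "\<exists>a. \<forall>s\<le>a. g n s = 0" for n
    using order_tendstoD(2)[OF lim d[of n]] by (force simp: eventually_at_bot_linorder g_def)
  then obtain a where a: "\<And>n s. s \<le> a n \<Longrightarrow> g n s = 0" by metis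
  define f' where "f' n x = (\<integral>\<^sup>+ s. ennreal (g n s) * ennreal (second_diff (x - s) (d n) / (d n)\<^sup>2) \<partial>lborel)" for n x
  have [measurable]: "(\<lambda>(x, s). second_diff (x - s) (d n)) \<in> borel_measurable (borel \<Otimes>\<^sub>M borel)"
    "(\<lambda>s. second_diff (x - s) (d n)) \<in> borel_measurable borel" for n x
    unfolding second_diff_def by measurable
  have [measurable]: "f' n \<in> borel_measurable borel" for n
    unfolding f'_def[abs_def] by measurable
  have tr: "trunc 3 s x = max 0 (x - s) ^ 3 / 6" for s x
    by (simp add: max_def fact_numeral)
  have [measurable]: "(\<lambda>x. ennreal (f x)) \<in> borel_measurable borel"
    unfolding H(4) by measurable
  have f'_le: "f' n x \<le> ennreal (f x)" for n x
    unfolding f'_def H(4) tr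
  proof (intro nn_integral_mono mult_mono ennreal_leI)
    show "g n s \<le> h s" for s using H(2)[of s] d[of n] by (simp add: g_def)
    show "second_diff (x - s) (d n) / (d n)\<^sup>2 \<le> max 0 (x - s) ^ 3 / 6" for s
      using second_diff_bounds(2)[of "d n" "x - s"] d[of n] by (simp add: field_simps)
  qed auto
  have f_le: "ennreal (f x) \<le> liminf (\<lambda>n. f' n x)" for x
  proof -
    have "(\<lambda>n. ennreal (g n s) * ennreal (second_diff (x - s) (d n) / (d n)\<^sup>2)) \<longlonglongrightarrow> ennreal (h s) * ennreal (trunc 3 s x)" for s
    proof -
      have "(\<lambda>n. g n s) \<longlonglongrightarrow> max 0 (h s - 0)"
        unfolding g_def by (intro tendsto_intros d0)
      then have "(\<lambda>n. g n s * (second_diff (x - s) (d n) / (d n)\<^sup>2)) \<longlonglongrightarrow> max 0 (h s - 0) * (max 0 (x - s) ^ 3 / 6)"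
        by (intro tendsto_mult second_diff_tendsto d d0)
      then have "(\<lambda>n. ennreal (g n s * (second_diff (x - s) (d n) / (d n)\<^sup>2))) \<longlonglongrightarrow> ennreal (h s * trunc 3 s x)"
        using H(2)[of s] unfolding tr by (intro tendsto_ennrealI) simp
      moreover have g0: "0 \<le> g n s" for n by (simp add: g_def)
      ultimately show ?thesis by (simp only: ennreal_mult'[OF g0] ennreal_mult'[OF H(2)])
    qed
    note lims = lim_imp_Liminf[OF sequentially_bot this, symmetric]
    have "ennreal (f x) = (\<integral>\<^sup>+ s. liminf (\<lambda>n. ennreal (g n s) * ennreal (second_diff (x - s) (d n) / (d n)\<^sup>2)) \<partial>lborel)"
      unfolding H(4) by (intro nn_integral_cong lims)
    also have "\<dots> \<le> liminf (\<lambda>n. f' n x)"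
      unfolding f'_def by (rule nn_integral_liminf) measurable
    finally show ?thesis .
  qed
  define c where "c n s = ennreal (1 / (d n)\<^sup>2) * ennreal ((g n s - 2 * g n (s - d n) + g n (s - 2 * d n)) / 120)" for n s
  have [measurable]: "c n \<in> borel_measurable borel" for n unfolding c_def by measurable
  have f'_eq: "f' n x = (\<integral>\<^sup>+ s. c n s * ennreal (max 0 (x - s) ^ 5) \<partial>lborel)" for n x
  proof -
    have "f' n x = (\<integral>\<^sup>+ s. ennreal (1 / (d n)\<^sup>2) * (ennreal (g n s) * ennreal (second_diff (x - s) (d n))) \<partial>lborel)"
      unfolding f'_def
      using second_diff_nonneg[of "d n"] d[of n]
      by (intro nn_integral_cong) (simp add: g_def ennreal_mult'[symmetric] less_imp_le mult.left_commute)
    also have "\<dots> = ennreal (1 / (d n)\<^sup>2) * (\<integral>\<^sup>+ s. ennreal (g n s) * ennreal (second_diff (x - s) (d n)) \<partial>lborel)"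
      by (rule nn_integral_cmult) measurable
    also have "(\<integral>\<^sup>+ s. ennreal (g n s) * ennreal (second_diff (x - s) (d n)) \<partial>lborel)
        = (\<integral>\<^sup>+ s. ennreal ((g n s - 2 * g n (s - d n) + g n (s - 2 * d n)) / 120) * ennreal (max 0 (x - s) ^ 5) \<partial>lborel)"
      by (rule nn_integral_second_diff[OF g _ a d]) (auto simp: g_def)
    also have "ennreal (1 / (d n)\<^sup>2) * \<dots> = (\<integral>\<^sup>+ s. c n s * ennreal (max 0 (x - s) ^ 5) \<partial>lborel)"
      unfolding c_def mult.assoc by (rule nn_integral_cmult[symmetric]) measurable
    finally show ?thesis .
  qed
  have swap: "(\<integral>\<^sup>+ x. f' n x \<partial>\<rho>) = (\<integral>\<^sup>+ s. c n s * (\<integral>\<^sup>+ x. ennreal (max 0 (x - s) ^ 5) \<partial>\<rho>) \<partial>lborel)"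
    if "finite_measure \<rho>" and [measurable_cong]: "sets \<rho> = sets borel" for \<rho> n
  proof -
    interpret finite_measure \<rho> by fact
    interpret pair_sigma_finite lborel \<rho> ..
    have "(\<integral>\<^sup>+ x. f' n x \<partial>\<rho>) = (\<integral>\<^sup>+ s. \<integral>\<^sup>+ x. c n s * ennreal (max 0 (x - s) ^ 5) \<partial>\<rho> \<partial>lborel)"
      unfolding f'_eq by (rule Fubini') measurable
    also have "\<dots> = (\<integral>\<^sup>+ s. c n s * (\<integral>\<^sup>+ x. ennreal (max 0 (x - s) ^ 5) \<partial>\<rho>) \<partial>lborel)"
      by (intro nn_integral_cong nn_integral_cmult) measurable
    finally show ?thesis .
  qed
  have f'_int: "(\<integral>\<^sup>+ x. f' n x \<partial>\<mu>) \<le> (\<integral>\<^sup>+ x. ennreal (f x) \<partial>\<nu>)" for n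
  proof -
    have "(\<integral>\<^sup>+ x. f' n x \<partial>\<mu>) \<le> (\<integral>\<^sup>+ x. f' n x \<partial>\<nu>)"
      unfolding swap[OF \<mu>] swap[OF \<nu>] by (intro nn_integral_mono mult_left_mono le) auto
    also have "\<dots> \<le> (\<integral>\<^sup>+ x. ennreal (f x) \<partial>\<nu>)"
      by (intro nn_integral_mono f'_le)
    finally show ?thesis .
  qed
  have "(\<integral>\<^sup>+ x. ennreal (f x) \<partial>\<mu>) \<le> (\<integral>\<^sup>+ x. liminf (\<lambda>n. f' n x) \<partial>\<mu>)"
    by (intro nn_integral_mono f_le)
  also have "\<dots> \<le> liminf (\<lambda>n. \<integral>\<^sup>+ x. f' n x \<partial>\<mu>)"
    by (rule nn_integral_liminf) measurable
  also have "\<dots> \<le> (\<integral>\<^sup>+ x. ennreal (f x) \<partial>\<nu>)"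
    by (rule Liminf_le) (auto intro!: always_eventually f'_int)
  finally show ?thesis .
qed

section \<open>Randomized distribution functions and quantiles\<close>

abbreviation unif :: "real measure" where
  "unif \<equiv> uniform_measure lborel {0..1}"

lemma prob_space_unif: "prob_space unif"
  by (rule prob_space_uniform_measure) auto

lemma emeasure_unif_atMost:
  assumes "0 \<le> c" "c \<le> 1"
  shows "emeasure unif {u. u \<le> c} = ennreal c"
proof -
  have "{0..1} \<inter> {u. u \<le> c} = {0..c}" using assms by auto
  then show ?thesis using assms divide_ennreal[of c 1] by simp
qed

lemma AE_unif: "AE u in unif. 0 < u \<and> u < 1"
proof (rule AE_uniform_measureI)
  show "AE u in lborel. u \<in> {0..1} \<longrightarrow> 0 < u \<and> u < (1::real)"
    using AE_lborel_singleton[of 0] AE_lborel_singleton[of 1] by eventually_elim auto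
qed auto

text \<open>Abstracts the measures |z| \<nu>(dz) on the two half-lines, the negative one after
  reflection. The absence of mass on \<open>{..0}\<close> makes all quantiles positive.\<close>

locale positive_measure = finite_borel_measure M for M +
  assumes no_nonpos: "measure M {..0} = 0"
begin

lemma M_sets [simp, measurable_cong]: "sets M = sets borel"
  by (rule M_is_borel)

lemma M_space [simp]: "space M = UNIV"
  by (rule borel_UNIV)

definition mass :: real where "mass = measure M UNIV"

text \<open>The generalised inverse of the distribution function. The value 0 outside the open range
  of levels is a default; random levels almost surely avoid it.\<close>

definition quantile :: "real \<Rightarrow> real" where
  "quantile h = (if 0 < h \<and> h < mass then Inf {x. h \<le> cdf M x} else 0)"

definition left_cdf :: "real \<Rightarrow> real" where
  "left_cdf x = measure M {..<x}"

text \<open>For the measure \<open>z \<nu>(dz)\<close> on the positive half-line this is the function of \<^const>\<open>G_tilde\<close>.\<close>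
definition cdf_interp :: "real \<Rightarrow> real \<Rightarrow> real" where
  "cdf_interp x u = left_cdf x + (cdf M x - left_cdf x) * u"

sublocale right_continuous_mono "cdf M" 0 mass
  using cdf_lim_at_top cdf_lim_at_bot
  by unfold_locales (auto intro: monoI cdf_nondecreasing cdf_is_right_cont simp: mass_def)

lemma quantile_le_iff: "0 < h \<Longrightarrow> h < mass \<Longrightarrow> quantile h \<le> x \<longleftrightarrow> h \<le> cdf M x"
  using pseudoinverse[of h x] by (simp add: quantile_def)

lemma cdf_0: "cdf M 0 = 0"
  using no_nonpos by (simp add: cdf_def)

lemma quantile_pos: "0 < h \<Longrightarrow> h < mass \<Longrightarrow> 0 < quantile h"
  using quantile_le_iff[of h 0] cdf_0 by (simp add: not_le[symmetric])

lemma cdf_le_mass: "cdf M x \<le> mass"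
  using cdf_bounded by (simp add: mass_def)

lemma left_cdf_mono: "x \<le> y \<Longrightarrow> left_cdf x \<le> left_cdf y"
  unfolding left_cdf_def by (intro finite_measure_mono) auto

lemma cdf_le_left_cdf: "x < y \<Longrightarrow> cdf M x \<le> left_cdf y"
  unfolding left_cdf_def cdf_def by (intro finite_measure_mono) auto

lemma left_cdf_le_cdf: "left_cdf x \<le> cdf M x"
  unfolding left_cdf_def cdf_def by (intro finite_measure_mono) auto

lemma cdf_eq_left_cdf_add: "cdf M x = left_cdf x + measure M {x}"
proof -
  have "{..x} = {..<x} \<union> {x}" by auto
  moreover have "measure M ({..<x} \<union> {x}) = measure M {..<x} + measure M {x}"
    by (intro finite_measure_Union) auto
  ultimately show ?thesis by (simp add: left_cdf_def cdf_def)
qed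

lemma cdf_interp_bounds:
  assumes "0 \<le> u" "u \<le> 1"
  shows "left_cdf x \<le> cdf_interp x u" "cdf_interp x u \<le> cdf M x" "0 \<le> cdf_interp x u" "cdf_interp x u \<le> mass"
proof -
  have "0 \<le> (cdf M x - left_cdf x) * u" "(cdf M x - left_cdf x) * u \<le> cdf M x - left_cdf x"
    using assms left_cdf_le_cdf[of x] by (auto intro: mult_left_le)
  moreover have "0 \<le> left_cdf x" by (simp add: left_cdf_def)
  ultimately show "left_cdf x \<le> cdf_interp x u" "cdf_interp x u \<le> cdf M x" "0 \<le> cdf_interp x u"
    by (auto simp: cdf_interp_def)
  then show "cdf_interp x u \<le> mass" using cdf_le_mass[of x] by simp
qed

lemma measurable_cdf [measurable]: "cdf M \<in> borel_measurable borel"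
  by (intro borel_measurable_mono monoI cdf_nondecreasing)

lemma measurable_left_cdf [measurable]: "left_cdf \<in> borel_measurable borel"
  by (intro borel_measurable_mono monoI left_cdf_mono)

lemma measurable_cdf_interp [measurable]:
  "(\<lambda>(x, u). cdf_interp x u) \<in> borel_measurable (borel \<Otimes>\<^sub>M borel)"
  unfolding cdf_interp_def by measurable

lemma measurable_quantile [measurable]: "quantile \<in> borel_measurable borel"
proof (rule borel_measurableI_le)
  fix y
  have "{h \<in> space borel. quantile h \<le> y} = {h. 0 < h \<and> h < mass \<and> h \<le> cdf M y} \<union> {h. \<not> (0 < h \<and> h < mass) \<and> 0 \<le> y}"
    using quantile_le_iff by (auto simp: quantile_def)
  also have "\<dots> \<in> sets borel" by measurable
  finally show "{h \<in> space borel. quantile h \<le> y} \<in> sets borel" .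
qed

text \<open>The points beyond \<open>y\<close> over which the distribution function is still flat form an interval
  that is a countable union of null intervals.\<close>
lemma AE_not_right_of_flat: "AE x in M. \<not> (y < x \<and> cdf M x = cdf M y)"
proof -
  define A where "A = {x. y < x \<and> cdf M x = cdf M y}"
  have null: "{y<..q} \<in> null_sets M" if "q \<in> A" for q
    using that emeasure_Ioc[of y q] by (auto simp: A_def null_sets_def)
  have down: "x \<in> A" if "q \<in> A" "y < x" "x \<le> q" for x q
    using that cdf_nondecreasing[of y x] cdf_nondecreasing[of x q] by (auto simp: A_def)
  \<comment> \<open>A point of \<open>A\<close> with a larger point of \<open>A\<close> beyond it is
    caught by an interval with rational endpoint; only a maximum of \<open>A\<close> can
    escape.\<close>
  have cover: "A \<subseteq> (\<Union>q\<in>A \<inter> \<rat>. {y<..q}) \<union> {x. x \<in> A \<and> (\<forall>z\<in>A. z \<le> x)}"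
  proof
    fix x assume x: "x \<in> A"
    show "x \<in> (\<Union>q\<in>A \<inter> \<rat>. {y<..q}) \<union> {x. x \<in> A \<and> (\<forall>z\<in>A. z \<le> x)}"
    proof (cases "\<forall>z\<in>A. z \<le> x")
      case False
      then obtain z where z: "z \<in> A" "x < z" by auto
      then obtain q where "q \<in> \<rat>" "x < q" "q < z" using Rats_dense_in_real by blast
      then have "q \<in> A \<inter> \<rat>" "x \<in> {y<..q}" using down[OF z(1), of q] x by (auto simp: A_def)
      then show ?thesis by blast
    qed (use x in auto)
  qed
  have rat: "(\<Union>q\<in>A \<inter> \<rat>. {y<..q}) \<in> null_sets M"
    using null by (intro null_sets_UN') (auto intro: countable_rat countable_subset[OF Int_lower2])
  have "\<exists>N\<in>null_sets M. {x. x \<in> A \<and> (\<forall>z\<in>A. z \<le> x)} \<subseteq> N"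
  proof (cases "\<exists>x. x \<in> A \<and> (\<forall>z\<in>A. z \<le> x)")
    case True
    then obtain x where "x \<in> A" "\<forall>z\<in>A. z \<le> x" by blast
    then show ?thesis using null[of x] by (intro bexI[of _ "{y<..x}"]) (auto simp: A_def)
  next
    case False
    then have "{x. x \<in> A \<and> (\<forall>z\<in>A. z \<le> x)} = {}" by blast
    then show ?thesis by (intro bexI[of _ "{}"]) auto
  qed
  then obtain N where N: "N \<in> null_sets M" "{x. x \<in> A \<and> (\<forall>z\<in>A. z \<le> x)} \<subseteq> N" by auto
  have "A \<subseteq> (\<Union>q\<in>A \<inter> \<rat>. {y<..q}) \<union> N"
    by (rule order_trans[OF cover Un_mono[OF order_refl N(2)]])
  then have "{x \<in> space M. \<not> \<not> (y < x \<and> cdf M x = cdf M y)} \<subseteq> (\<Union>q\<in>A \<inter> \<rat>. {y<..q}) \<union> N"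
    by (simp add: A_def)
  then show ?thesis by (rule AE_I'[OF null_sets.Un[OF rat N(1)]])
qed

text \<open>The level of (x, u) could belong to a smaller quantile only if the distribution function
  were flat just to the left of x and through x. Such x are null by
  \<open>AE_not_right_of_flat\<close>, applied at rational y to keep the exceptional set countable.
  Since u > 0, a level equal to \<open>left_cdf x\<close> forces x not to be an atom.\<close>

lemma quantile_cdf_interp:
  "AE x in M. \<forall>u. 0 < u \<and> u < 1 \<and> cdf_interp x u < mass \<longrightarrow> 0 < cdf_interp x u \<and> quantile (cdf_interp x u) = x"
proof -
  have "AE x in M. \<forall>y\<in>\<rat>. \<not> (y < x \<and> cdf M x = cdf M y)"
    by (subst AE_ball_countable[OF countable_rat]) (intro ballI AE_not_right_of_flat)
  moreover have "AE x in M. 0 < x"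
  proof -
    have "{..0} \<in> null_sets M" using no_nonpos by (auto simp: null_sets_def emeasure_eq_measure)
    from AE_not_in[OF this] show ?thesis by eventually_elim auto
  qed
  ultimately show ?thesis
  proof eventually_elim
    fix x assume flat: "\<forall>y\<in>\<rat>. \<not> (y < x \<and> cdf M x = cdf M y)" and x: "0 < x"
    show "\<forall>u. 0 < u \<and> u < 1 \<and> cdf_interp x u < mass \<longrightarrow> 0 < cdf_interp x u \<and> quantile (cdf_interp x u) = x"
    proof (intro allI impI; elim conjE)
      fix u :: real assume u: "0 < u" "u < 1" and lt: "cdf_interp x u < mass"
      note b = cdf_interp_bounds[of u x]
      have *: False if "y < x" "cdf_interp x u \<le> cdf M y" for y
      proof -
        obtain q where q: "q \<in> \<rat>" "y < q" "q < x" using Rats_dense_in_real[OF \<open>y < x\<close>] by blast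
        have "cdf_interp x u \<le> cdf M q" "cdf M q \<le> left_cdf x"
          using that q cdf_nondecreasing[of y q] cdf_le_left_cdf[of q x] by auto
        then have "cdf_interp x u = left_cdf x" "cdf M q = left_cdf x" using b u by auto
        then have "cdf M x = left_cdf x" using u by (simp add: cdf_interp_def)
        with \<open>cdf M q = left_cdf x\<close> flat q show False by auto
      qed
      have pos: "0 < cdf_interp x u" using *[OF x] b u cdf_0 by (cases "cdf_interp x u = 0") auto
      moreover have "quantile (cdf_interp x u) = x"
      proof (rule antisym)
        show "quantile (cdf_interp x u) \<le> x" using b u quantile_le_iff[OF pos lt] by simp
        show "x \<le> quantile (cdf_interp x u)"
        proof (rule ccontr)
          assume "\<not> x \<le> quantile (cdf_interp x u)"
          then show False
            using *[of "quantile (cdf_interp x u)"] quantile_le_iff[OF pos lt, of "quantile (cdf_interp x u)"] by simp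
        qed
      qed
      ultimately show "0 < cdf_interp x u \<and> quantile (cdf_interp x u) = x" ..
    qed
  qed
qed

lemma left_cdf_quantile_le:
  assumes "0 < h" "h < mass"
  shows "left_cdf (quantile h) \<le> h"
proof -
  have "cdf M y \<le> h" if "y < quantile h" for y
    using quantile_le_iff[OF assms, of y] that by simp
  then show ?thesis
    using cdf_at_left[of "quantile h"] unfolding left_cdf_def
    by (intro tendsto_upperbound[of "cdf M" _ "at_left (quantile h)"])
       (auto simp: eventually_at_filter)
qed

text \<open>Randomised probability integral transform. Points left of the quantile \<xi> count
  fully, points to its right not at all, and an atom of mass j at \<xi> counts with the share (h -
  l) / j, so the total is h.\<close>

lemma distribution_cdf_interp:
  assumes h: "0 < h" "h < mass"
  shows "(\<integral>\<^sup>+ x. emeasure unif {u. cdf_interp x u \<le> h} \<partial>M) = ennreal h"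
proof -
  define \<xi> where "\<xi> = quantile h"
  define j where "j = measure M {\<xi>}"
  define l where "l = left_cdf \<xi>"
  have l: "l \<le> h" "h \<le> l + j" "0 \<le> l" "0 \<le> j"
    using left_cdf_quantile_le[OF h] quantile_le_iff[OF h, of \<xi>] cdf_eq_left_cdf_add[of \<xi>]
    by (simp_all add: l_def j_def \<xi>_def left_cdf_def)
  interpret unif: prob_space unif by (rule prob_space_unif)
  have sets: "{u. cdf_interp x u \<le> h} \<in> sets unif" for x
    by (simp add: cdf_interp_def)
  have left: "emeasure unif {u. cdf_interp x u \<le> h} = 1" if "x < \<xi>" for x
  proof -
    have le: "cdf M x \<le> h" using that quantile_le_iff[OF h, of x] by (simp add: \<xi>_def)
    have "AE u in unif. u \<in> {u. cdf_interp x u \<le> h}"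
      using AE_unif
    proof eventually_elim
      case (elim u)
      then show ?case using le cdf_interp_bounds(2)[of u x] by simp
    qed
    then have "emeasure unif {u. cdf_interp x u \<le> h} = emeasure unif (space unif)"
      using sets by (intro emeasure_eq_AE) auto
    then show ?thesis by (simp only: unif.emeasure_space_1)
  qed
  have at: "emeasure unif {u. cdf_interp \<xi> u \<le> h} = ennreal ((h - l) / j)" if "0 < j"
  proof -
    have "{u. cdf_interp \<xi> u \<le> h} = {u. u \<le> (h - l) / j}"
      using that cdf_eq_left_cdf_add[of \<xi>] by (auto simp: cdf_interp_def l_def j_def field_simps)
    then show ?thesis using that l emeasure_unif_atMost[of "(h - l) / j"]
      by (simp del: emeasure_uniform_measure)
  qed
  have atom: "AE x in M. x = \<xi> \<longrightarrow> 0 < j"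
  proof (cases "j = 0")
    case True
    then have "{\<xi>} \<in> null_sets M" by (auto simp: j_def null_sets_def emeasure_eq_measure)
    from AE_not_in[OF this] show ?thesis by eventually_elim auto
  qed (use l in auto)
  have "AE x in M. emeasure unif {u. cdf_interp x u \<le> h}
      = indicator {..<\<xi>} x + ennreal ((h - l) / j) * indicator {\<xi>} x"
    using quantile_cdf_interp atom
  proof eventually_elim
    case (elim x)
    consider "x < \<xi>" | "x = \<xi>" | "\<xi> < x" by linarith
    then show ?case
    proof cases
      case 3
      have "AE u in unif. u \<notin> {u. cdf_interp x u \<le> h}"
        using AE_unif
      proof eventually_elim
        case (elim u)
        show ?case
        proof
          assume "u \<in> {u. cdf_interp x u \<le> h}"
          then have le: "cdf_interp x u \<le> h" by simp
          then have q: "0 < cdf_interp x u" "quantile (cdf_interp x u) = x"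
            using \<open>\<forall>u. 0 < u \<and> u < 1 \<and> cdf_interp x u < mass \<longrightarrow> _\<close> elim h by auto
          have "cdf_interp x u \<le> cdf M \<xi>"
            using le quantile_le_iff[OF h, of \<xi>] by (simp add: \<xi>_def)
          then have "x \<le> \<xi>" using quantile_le_iff[OF q(1), of \<xi>] le h q by simp
          with 3 show False by simp
        qed
      qed
      then have "emeasure unif {u. cdf_interp x u \<le> h} = 0"
        using sets by (subst AE_iff_measurable[symmetric, OF sets, where P = "\<lambda>u. u \<notin> {u. cdf_interp x u \<le> h}"]) auto
      then show ?thesis using 3 by (simp del: emeasure_uniform_measure)
    qed (use elim at left in \<open>auto simp del: emeasure_uniform_measure\<close>)
  qed
  then have "(\<integral>\<^sup>+ x. emeasure unif {u. cdf_interp x u \<le> h} \<partial>M)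
      = (\<integral>\<^sup>+ x. indicator {..<\<xi>} x + ennreal ((h - l) / j) * indicator {\<xi>} x \<partial>M)"
    by (rule nn_integral_cong_AE)
  also have "\<dots> = ennreal l + ennreal ((h - l) / j) * ennreal j"
    by (subst nn_integral_add)
       (auto simp: nn_integral_cmult_indicator emeasure_eq_measure l_def j_def left_cdf_def)
  also have "\<dots> = ennreal h"
    using l by (cases "j = 0") (auto simp flip: ennreal_mult' ennreal_plus)
  finally show ?thesis .
qed

lemma distr_cdf_interp:
  "distr (M \<Otimes>\<^sub>M unif) borel (\<lambda>(x, u). cdf_interp x u) = density lborel (indicator {0<..<mass})"
proof -
  interpret unif: prob_space unif by (rule prob_space_unif)
  interpret P: pair_sigma_finite M unif ..
  let ?D = "distr (M \<Otimes>\<^sub>M unif) borel (\<lambda>(x, u). cdf_interp x u)"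
  let ?L = "density lborel (indicator {0<..<mass}) :: real measure"
  have mass0: "0 \<le> mass" by (simp add: mass_def)
  have D: "emeasure ?D A = (\<integral>\<^sup>+ x. emeasure unif {u. cdf_interp x u \<in> A} \<partial>M)" if "A \<in> sets borel" for A
  proof -
    have "emeasure ?D A = emeasure (M \<Otimes>\<^sub>M unif) ((\<lambda>(x, u). cdf_interp x u) -` A \<inter> space (M \<Otimes>\<^sub>M unif))"
      using that by (subst emeasure_distr) auto
    also have "\<dots> = (\<integral>\<^sup>+ x. emeasure unif (Pair x -` ((\<lambda>(x, u). cdf_interp x u) -` A \<inter> space (M \<Otimes>\<^sub>M unif))) \<partial>M)"
      using that by (intro unif.emeasure_pair_measure_alt measurable_sets[of _ _ borel]) auto
    also have "(\<lambda>x. Pair x -` ((\<lambda>(x, u). cdf_interp x u) -` A \<inter> space (M \<Otimes>\<^sub>M unif))) = (\<lambda>x. {u. cdf_interp x u \<in> A})"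
      by (auto simp: space_pair_measure)
    finally show ?thesis .
  qed
  have Dtop: "emeasure ?D A \<le> ennreal mass" if "A \<in> sets borel" for A
  proof -
    have "emeasure ?D A \<le> (\<integral>\<^sup>+ x. 1 \<partial>M)"
      unfolding D[OF that] by (intro nn_integral_mono unif.measure_le_1)
    then show ?thesis by (simp add: mass_def emeasure_eq_measure)
  qed
  have Dh: "emeasure ?D {..h} = ennreal (max 0 (min h mass))" for h
  proof -
    consider "h \<le> 0" | "0 < h" "h < mass" | "0 < h" "mass \<le> h" by linarith
    then show ?thesis
    proof cases
      case 1
      \<comment> \<open>\<open>distribution_cdf_interp\<close> covers interior levels only; levels
        at or below 0 are reached by monotonicity from small positive \<open>e\<close>.\<close>
      have "emeasure ?D {..h} \<le> ennreal e" if "0 < e" for e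
      proof (cases "e < mass")
        case True
        have "emeasure ?D {..h} \<le> emeasure ?D {..e}" using 1 that by (intro emeasure_mono) auto
        also have "\<dots> = ennreal e" using distribution_cdf_interp[OF that True] by (simp add: D del: emeasure_uniform_measure)
        finally show ?thesis .
      next
        case False
        then show ?thesis using order_trans[OF Dtop[of "{..h}"], of "ennreal e"] by (simp add: ennreal_leI)
      qed
      then have "emeasure ?D {..h} \<le> 0 + ennreal e" if "0 < e" for e using that by simp
      then have "emeasure ?D {..h} \<le> 0" by (rule ennreal_le_epsilon)
      then show ?thesis using 1 mass0 by (simp add: max_def min_def)
    next
      case 2
      then show ?thesis using distribution_cdf_interp[of h] by (simp add: D del: emeasure_uniform_measure)
    next
      case 3
      have "emeasure ?D {..h} = (\<integral>\<^sup>+ x. 1 \<partial>M)"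
        unfolding D[OF borel_closed[OF closed_atMost]]
      proof (intro nn_integral_cong)
        fix x
        have "AE u in unif. u \<in> {u. cdf_interp x u \<in> {..h}}"
          using AE_unif
        proof eventually_elim
          case (elim u)
          then show ?case using 3 cdf_interp_bounds(4)[of u x] by simp
        qed
        then have "emeasure unif {u. cdf_interp x u \<in> {..h}} = emeasure unif (space unif)"
          by (intro emeasure_eq_AE) (auto simp: cdf_interp_def)
        then show "emeasure unif {u. cdf_interp x u \<in> {..h}} = 1" by (simp only: unif.emeasure_space_1)
      qed
      then show ?thesis using 3 mass0 by (simp add: mass_def emeasure_eq_measure max_def min_def)
    qed
  qed
  have Lh: "emeasure ?L {..h} = ennreal (max 0 (min h mass))" for h
  proof -
    have "emeasure ?L {..h} = emeasure lborel ({0<..<mass} \<inter> {..h})"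
      by (simp add: emeasure_density indicator_inter_arith[symmetric])
    also have "\<dots> = emeasure lborel {0..max 0 (min h mass)}"
      using AE_lborel_singleton[of 0] AE_lborel_singleton[of mass]
      by (intro emeasure_eq_AE) (auto elim!: eventually_elim2)
    finally show ?thesis by simp
  qed
  show ?thesis
  proof (rule cdf_unique')
    show "finite_borel_measure ?D"
    proof (intro finite_borel_measure.intro finite_measureI finite_borel_measure_axioms.intro)
      have "emeasure ?D (space ?D) < top"
        by (rule le_less_trans[OF Dtop ennreal_less_top]) simp
      then show "emeasure ?D (space ?D) \<noteq> \<infinity>" by (simp only: infinity_ennreal_def less_top)
    qed simp
    show "finite_borel_measure ?L"
    proof (intro finite_borel_measure.intro finite_measureI finite_borel_measure_axioms.intro)
      have "emeasure ?L (space ?L) = emeasure lborel {0<..<mass}" by (simp add: emeasure_density)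
      also have "\<dots> < top" by (simp add: mass0)
      finally show "emeasure ?L (space ?L) \<noteq> \<infinity>" by (simp only: infinity_ennreal_def less_top)
    qed simp
    show "cdf ?D = cdf ?L"
      unfolding cdf_def measure_def Dh Lh ..
  qed
qed

lemma AE_cdf_interp:
  "AE x in M. AE u in unif. 0 < cdf_interp x u \<and> cdf_interp x u < mass"
proof -
  interpret unif: prob_space unif by (rule prob_space_unif)
  interpret P: pair_sigma_finite M unif ..
  have "AE h in density lborel (indicator {0<..<mass}). 0 < h \<and> h < mass"
    by (subst AE_density) (auto simp: indicator_def)
  then have "AE z in M \<Otimes>\<^sub>M unif. 0 < (case z of (x, u) \<Rightarrow> cdf_interp x u) \<and> (case z of (x, u) \<Rightarrow> cdf_interp x u) < mass"
    unfolding distr_cdf_interp[symmetric] by (subst (asm) AE_distr_iff) auto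
  from P.AE_pair[OF this] show ?thesis by simp
qed

text \<open>The level is uniform on (0, mass) and almost everywhere determines x as its quantile, so
  a point together with its level can be replaced by the level alone.\<close>

lemma nn_integral_cdf_interp:
  fixes q :: "real \<Rightarrow> real \<Rightarrow> ennreal"
  assumes q [measurable]: "(\<lambda>(x, h). q x h) \<in> borel_measurable (borel \<Otimes>\<^sub>M borel)"
  shows "(\<integral>\<^sup>+ x. \<integral>\<^sup>+ u. q x (cdf_interp x u) \<partial>unif \<partial>M)
    = (\<integral>\<^sup>+ h. q (quantile h) h * indicator {0<..<mass} h \<partial>lborel)"
proof -
  interpret unif: prob_space unif by (rule prob_space_unif)
  interpret P: pair_sigma_finite M unif ..
  have "(\<integral>\<^sup>+ x. \<integral>\<^sup>+ u. q x (cdf_interp x u) \<partial>unif \<partial>M)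
      = (\<integral>\<^sup>+ x. \<integral>\<^sup>+ u. q (quantile (cdf_interp x u)) (cdf_interp x u) \<partial>unif \<partial>M)"
  proof (rule nn_integral_cong_AE)
    show "AE x in M. (\<integral>\<^sup>+ u. q x (cdf_interp x u) \<partial>unif)
      = (\<integral>\<^sup>+ u. q (quantile (cdf_interp x u)) (cdf_interp x u) \<partial>unif)"
      using quantile_cdf_interp AE_cdf_interp
    proof eventually_elim
      fix x assume *: "\<forall>u. 0 < u \<and> u < 1 \<and> cdf_interp x u < mass \<longrightarrow> 0 < cdf_interp x u \<and> quantile (cdf_interp x u) = x"
        "AE u in unif. 0 < cdf_interp x u \<and> cdf_interp x u < mass"
      show "(\<integral>\<^sup>+ u. q x (cdf_interp x u) \<partial>unif)
        = (\<integral>\<^sup>+ u. q (quantile (cdf_interp x u)) (cdf_interp x u) \<partial>unif)"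
      proof (rule nn_integral_cong_AE)
        show "AE u in unif. q x (cdf_interp x u) = q (quantile (cdf_interp x u)) (cdf_interp x u)"
          using *(2) AE_unif by eventually_elim (simp add: *(1))
      qed
    qed
  qed
  also have "\<dots> = (\<integral>\<^sup>+ z. q (quantile (case z of (x, u) \<Rightarrow> cdf_interp x u)) (case z of (x, u) \<Rightarrow> cdf_interp x u) \<partial>(M \<Otimes>\<^sub>M unif))"
    by (subst unif.nn_integral_fst[symmetric]) auto
  also have "\<dots> = (\<integral>\<^sup>+ h. q (quantile h) h \<partial>density lborel (indicator {0<..<mass}))"
    unfolding distr_cdf_interp[symmetric] by (subst nn_integral_distr) auto
  also have "\<dots> = (\<integral>\<^sup>+ h. q (quantile h) h * indicator {0<..<mass} h \<partial>lborel)"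
    by (subst nn_integral_density) (auto simp: mult.commute)
  finally show ?thesis .
qed

end

section \<open>Disintegration of a zero-mean law into two-point laws\<close>

definition pos_part_measure :: "real measure \<Rightarrow> real measure" where
  "pos_part_measure \<nu> = density \<nu> (\<lambda>z. ennreal (max 0 z))"

lemma emeasure_pos_part:
  assumes "sets \<mu> = sets borel" "A \<in> sets borel"
  shows "emeasure (pos_part_measure \<mu>) A = (\<integral>\<^sup>+ z. ennreal z * indicator (A \<inter> {0<..}) z \<partial>\<mu>)"
proof -
  note [measurable_cong] = assms(1)
  have "emeasure (pos_part_measure \<mu>) A = (\<integral>\<^sup>+ z. ennreal (max 0 z) * indicator A z \<partial>\<mu>)"
    unfolding pos_part_measure_def using assms by (subst emeasure_density) auto
  also have "\<dots> = (\<integral>\<^sup>+ z. ennreal z * indicator (A \<inter> {0<..}) z \<partial>\<mu>)"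
    by (intro nn_integral_cong) (auto simp: indicator_def max_def)
  finally show ?thesis .
qed

lemma nn_integral_pos_part:
  fixes F :: "real \<Rightarrow> ennreal"
  assumes "sets \<mu> = sets borel" and F: "F \<in> borel_measurable borel"
  shows "(\<integral>\<^sup>+ x. F x * indicator {0<..} x \<partial>\<mu>) = (\<integral>\<^sup>+ x. ennreal (1 / x) * F x \<partial>pos_part_measure \<mu>)"
proof -
  note [measurable_cong] = assms(1) and [measurable] = F
  have "(\<integral>\<^sup>+ x. ennreal (1 / x) * F x \<partial>pos_part_measure \<mu>) = (\<integral>\<^sup>+ x. ennreal (max 0 x) * (ennreal (1 / x) * F x) \<partial>\<mu>)"
    unfolding pos_part_measure_def by (subst nn_integral_density) auto
  also have "\<dots> = (\<integral>\<^sup>+ x. F x * indicator {0<..} x \<partial>\<mu>)"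
    by (intro nn_integral_cong)
       (auto simp: indicator_def max_def mult.assoc[symmetric] ennreal_mult'[symmetric])
  finally show ?thesis by simp
qed

lemma trivial_limit_ereal: "at_left (ereal x) \<noteq> bot" "at_right (ereal x) \<noteq> bot"
  by (simp_all add: at_left_ereal at_right_ereal filtermap_bot_iff)

locale zero_mean_law = prob_space \<nu> for \<nu> :: "real measure" +
  assumes law_sets [simp, measurable_cong]: "sets \<nu> = sets borel"
    and law_integrable: "integrable \<nu> (\<lambda>z. z)"
    and law_mean: "(\<integral>z. z \<partial>\<nu>) = 0"
begin

lemma law_space [simp]: "space \<nu> = UNIV"
  using law_sets[THEN sets_eq_imp_space_eq] by simp

text \<open>Carries the negative half-line to the positive one, so that
  \<open>positive_measure\<close> serves both halves.\<close>

definition reflected :: "real measure" where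
  "reflected = distr \<nu> borel uminus"

lemma emeasure_neg_part:
  assumes "A \<in> sets borel"
  shows "emeasure (pos_part_measure reflected) A = (\<integral>\<^sup>+ z. ennreal (- z) * indicator {z. - z \<in> A \<and> z < 0} z \<partial>\<nu>)"
proof -
  have "emeasure (pos_part_measure reflected) A = (\<integral>\<^sup>+ z. ennreal (- z) * indicator (A \<inter> {0<..}) (- z) \<partial>\<nu>)"
    using assms by (subst emeasure_pos_part) (auto simp: reflected_def nn_integral_distr)
  also have "\<dots> = (\<integral>\<^sup>+ z. ennreal (- z) * indicator {z. - z \<in> A \<and> z < 0} z \<partial>\<nu>)"
    by (intro nn_integral_cong) (auto simp: indicator_def)
  finally show ?thesis .
qed

text \<open>The zero mean enters here: both halves have the same first absolute moment, so their
  levels range over the same interval and can be matched.\<close>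

lemma emeasure_parts_UNIV:
  shows "emeasure (pos_part_measure \<nu>) UNIV = emeasure (pos_part_measure reflected) UNIV"
    and "emeasure (pos_part_measure \<nu>) UNIV < \<infinity>"
proof -
  have i: "integrable \<nu> (\<lambda>z. max 0 z)" "integrable \<nu> (\<lambda>z. max 0 (- z))"
    using law_integrable by auto
  have "(\<integral>z. max 0 z \<partial>\<nu>) - (\<integral>z. max 0 (- z) \<partial>\<nu>) = (\<integral>z. max 0 z - max 0 (- z) \<partial>\<nu>)"
    using i by simp
  also have "(\<lambda>z::real. max 0 z - max 0 (- z)) = (\<lambda>z. z)" by (auto simp: max_def)
  finally have eq: "(\<integral>z. max 0 z \<partial>\<nu>) = (\<integral>z. max 0 (- z) \<partial>\<nu>)" using law_mean by simp
  have "emeasure (pos_part_measure \<nu>) UNIV = (\<integral>\<^sup>+ z. ennreal (max 0 z) \<partial>\<nu>)"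
    by (subst emeasure_pos_part) (auto intro!: nn_integral_cong simp: indicator_def max_def)
  then have p: "emeasure (pos_part_measure \<nu>) UNIV = ennreal (\<integral>z. max 0 z \<partial>\<nu>)"
    using nn_integral_eq_integral[OF i(1)] by simp
  have "emeasure (pos_part_measure reflected) UNIV = (\<integral>\<^sup>+ z. ennreal (max 0 (- z)) \<partial>\<nu>)"
    by (subst emeasure_neg_part) (auto intro!: nn_integral_cong simp: indicator_def max_def)
  then have m: "emeasure (pos_part_measure reflected) UNIV = ennreal (\<integral>z. max 0 (- z) \<partial>\<nu>)"
    using nn_integral_eq_integral[OF i(2)] by simp
  show "emeasure (pos_part_measure \<nu>) UNIV = emeasure (pos_part_measure reflected) UNIV"
    and "emeasure (pos_part_measure \<nu>) UNIV < \<infinity>"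
    using p m eq by auto
qed

lemma positive_measure_parts:
  "positive_measure (pos_part_measure \<nu>)" "positive_measure (pos_part_measure reflected)"
proof -
  have s: "sets (pos_part_measure \<nu>) = sets borel" "sets (pos_part_measure reflected) = sets borel"
    by (simp_all add: pos_part_measure_def reflected_def)
  then have sp: "space (pos_part_measure \<nu>) = UNIV" "space (pos_part_measure reflected) = UNIV"
    using s[THEN sets_eq_imp_space_eq] by simp_all
  have z: "emeasure (pos_part_measure \<nu>) {..0} = 0" "emeasure (pos_part_measure reflected) {..0} = 0"
    by (simp_all add: emeasure_pos_part emeasure_neg_part)
  show "positive_measure (pos_part_measure \<nu>)"
    using s sp z emeasure_parts_UNIV
    by (intro positive_measure.intro finite_borel_measure.intro finite_measureI
        finite_borel_measure_axioms.intro positive_measure_axioms.intro) (simp_all add: measure_def)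
  show "positive_measure (pos_part_measure reflected)"
    using s sp z emeasure_parts_UNIV
    by (intro positive_measure.intro finite_borel_measure.intro finite_measureI
        finite_borel_measure_axioms.intro positive_measure_axioms.intro) (simp_all add: measure_def)
qed

sublocale pos: positive_measure "pos_part_measure \<nu>"
  by (rule positive_measure_parts)

sublocale neg: positive_measure "pos_part_measure reflected"
  by (rule positive_measure_parts)

lemma mass_eq: "neg.mass = pos.mass"
  using emeasure_parts_UNIV(1) by (simp add: pos.mass_def neg.mass_def measure_def)

section \<open>The reciprocating function in terms of quantiles\<close>

lemma G_fun_pos: "0 \<le> x \<Longrightarrow> G_fun \<nu> (ereal x) = ereal (cdf (pos_part_measure \<nu>) x)"
proof -
  assume x: "0 \<le> x"
  have "(\<integral>\<^sup>+ z \<in> {z. 0 < z \<and> ereal z \<le> ereal x}. ennreal z \<partial>\<nu>) = emeasure (pos_part_measure \<nu>) {..x}"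
    by (subst emeasure_pos_part) (auto intro!: nn_integral_cong simp: indicator_def)
  then show ?thesis using x by (simp add: G_fun_def cdf_def pos.emeasure_eq_measure)
qed

lemma G_fun_neg: "x \<le> 0 \<Longrightarrow> G_fun \<nu> (ereal x) = ereal (cdf (pos_part_measure reflected) (- x))"
proof (cases "x = 0")
  case True
  then show ?thesis using G_fun_pos[of 0] pos.cdf_0 neg.cdf_0 by simp
next
  case False
  assume "x \<le> 0"
  then have x: "x < 0" using False by simp
  have "(\<integral>\<^sup>+ z \<in> {z. ereal x \<le> ereal z \<and> z < 0}. ennreal (- z) \<partial>\<nu>) = emeasure (pos_part_measure reflected) {..- x}"
    by (subst emeasure_neg_part) (auto intro!: nn_integral_cong simp: indicator_def)
  then show ?thesis using x by (simp add: G_fun_def cdf_def neg.emeasure_eq_measure)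
qed

lemma G_tilde_pos:
  assumes x: "0 < x"
  shows "G_tilde \<nu> (ereal x) u = ereal (pos.cdf_interp x u)"
proof -
  have ev: "\<forall>\<^sub>F y in at_left x. ereal (cdf (pos_part_measure \<nu>) y) = G_fun \<nu> (ereal y)"
    using eventually_at_left_field[of "\<lambda>y. 0 < y" x] x
    by (auto elim!: eventually_mono intro!: G_fun_pos[symmetric] exI[of _ 0])
  have "((\<lambda>y. ereal (cdf (pos_part_measure \<nu>) y)) \<longlongrightarrow> ereal (pos.left_cdf x)) (at_left x)"
    unfolding pos.left_cdf_def by (intro tendsto_ereal pos.cdf_at_left)
  from Lim_transform_eventually[OF this ev]
  have "(G_fun \<nu> \<longlongrightarrow> ereal (pos.left_cdf x)) (at_left (ereal x))"
    by (simp add: at_left_ereal filterlim_filtermap)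
  from tendsto_Lim[OF trivial_limit_ereal(1) this]
  show ?thesis using x by (simp add: G_tilde_def Let_def G_fun_pos pos.cdf_interp_def)
qed

lemma G_tilde_neg:
  assumes x: "x < 0"
  shows "G_tilde \<nu> (ereal x) u = ereal (neg.cdf_interp (- x) u)"
proof -
  have ev: "\<forall>\<^sub>F y in at_right x. ereal (cdf (pos_part_measure reflected) (- y)) = G_fun \<nu> (ereal y)"
    using eventually_at_right_field[of "\<lambda>y. y < 0" x] x
    by (auto elim!: eventually_mono intro!: G_fun_neg[symmetric] exI[of _ 0])
  have "((\<lambda>y. ereal (cdf (pos_part_measure reflected) (- y))) \<longlongrightarrow> ereal (neg.left_cdf (- x))) (at_right x)"
    unfolding neg.left_cdf_def
    by (intro tendsto_ereal filterlim_compose[OF neg.cdf_at_left])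
       (simp add: at_right_minus[of x] filterlim_filtermap filterlim_ident)
  from Lim_transform_eventually[OF this ev]
  have "(G_fun \<nu> \<longlongrightarrow> ereal (neg.left_cdf (- x))) (at_right (ereal x))"
    by (simp add: at_right_ereal filterlim_filtermap)
  from tendsto_Lim[OF trivial_limit_ereal(2) this]
  show ?thesis using x by (simp add: G_tilde_def Let_def G_fun_neg neg.cdf_interp_def)
qed

text \<open>At 0 the left limit is taken from negative arguments, where \<open>G_fun\<close> is
  governed by the reflected measure; right continuity of its distribution function at 0 gives the
  value.\<close>

lemma G_tilde_0: "G_tilde \<nu> 0 u = 0"
proof -
  have ev: "\<forall>\<^sub>F y in at_left 0. ereal (cdf (pos_part_measure reflected) (- y)) = G_fun \<nu> (ereal y)"
    unfolding eventually_at_filter by (intro always_eventually) (auto simp: G_fun_neg)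
  have "(cdf (pos_part_measure reflected) \<longlongrightarrow> 0) (at_right 0)"
    using neg.cdf_is_right_cont[of 0] neg.cdf_0 by (simp add: continuous_within)
  then have "((\<lambda>y. ereal (cdf (pos_part_measure reflected) (- y))) \<longlongrightarrow> ereal 0) (at_left 0)"
    by (intro tendsto_ereal) (simp add: at_left_minus[of "0::real"] filterlim_filtermap)
  from Lim_transform_eventually[OF this ev]
  have "(G_fun \<nu> \<longlongrightarrow> ereal 0) (at_left (ereal 0))"
    by (simp add: at_left_ereal filterlim_filtermap)
  from tendsto_Lim[OF trivial_limit_ereal(1) this]
  show ?thesis using G_fun_pos[of 0] pos.cdf_0
    by (simp add: G_tilde_def Let_def zero_ereal_def)
qed

lemma x_plus_eq:
  assumes h: "0 < h" "h < pos.mass"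
  shows "x_plus \<nu> (ereal h) = ereal (pos.quantile h)"
  unfolding x_plus_def
proof (rule antisym)
  have "0 < pos.quantile h" by (rule pos.quantile_pos[OF h])
  then show "Inf {x. 0 \<le> x \<and> ereal h \<le> G_fun \<nu> x} \<le> ereal (pos.quantile h)"
    using pos.quantile_le_iff[OF h, of "pos.quantile h"] by (intro Inf_lower) (simp add: G_fun_pos)
  show "ereal (pos.quantile h) \<le> Inf {x. 0 \<le> x \<and> ereal h \<le> G_fun \<nu> x}"
  proof (rule Inf_greatest)
    fix x assume x: "x \<in> {x. 0 \<le> x \<and> ereal h \<le> G_fun \<nu> x}"
    show "ereal (pos.quantile h) \<le> x"
    proof (cases x)
      case (real r)
      then show ?thesis using x pos.quantile_le_iff[OF h, of r] by (auto simp: G_fun_pos)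
    qed (use x in auto)
  qed
qed

lemma x_minus_eq:
  assumes h: "0 < h" "h < neg.mass"
  shows "x_minus \<nu> (ereal h) = ereal (- neg.quantile h)"
  unfolding x_minus_def
proof (rule antisym)
  have "0 < neg.quantile h" by (rule neg.quantile_pos[OF h])
  then show "ereal (- neg.quantile h) \<le> Sup {x. x \<le> 0 \<and> ereal h \<le> G_fun \<nu> x}"
    using neg.quantile_le_iff[OF h, of "neg.quantile h"] by (intro Sup_upper) (simp add: G_fun_neg)
  show "Sup {x. x \<le> 0 \<and> ereal h \<le> G_fun \<nu> x} \<le> ereal (- neg.quantile h)"
  proof (rule Sup_least)
    fix x assume x: "x \<in> {x. x \<le> 0 \<and> ereal h \<le> G_fun \<nu> x}"
    show "x \<le> ereal (- neg.quantile h)"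
    proof (cases x)
      case (real r)
      then show ?thesis using x neg.quantile_le_iff[OF h, of "- r"] by (auto simp: G_fun_neg)
    qed (use x in auto)
  qed
qed

lemma x_minus_0: "x_minus \<nu> 0 = 0"
  unfolding x_minus_def
proof (rule antisym)
  show "0 \<le> Sup {x. x \<le> 0 \<and> 0 \<le> G_fun \<nu> x}" by (intro Sup_upper) (simp add: G_fun_def)
qed (auto intro!: Sup_least)

text \<open>A real-valued, jointly measurable version of |x - r(x, u)|. It agrees with the extended
  real expression at all \<open>regular\<close> points, which have full measure.\<close>

definition width :: "real \<Rightarrow> real \<Rightarrow> real" where
  "width x u = (if 0 < x then x + neg.quantile (pos.cdf_interp x u)
     else if x < 0 then - x + pos.quantile (neg.cdf_interp (- x) u) else 0)"

lemma measurable_width [measurable]: "(\<lambda>(x, u). width x u) \<in> borel_measurable (borel \<Otimes>\<^sub>M borel)"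
  unfolding width_def by measurable

lemma width_nonneg: "0 \<le> width x u"
proof -
  have "0 \<le> pos.quantile h" "0 \<le> neg.quantile h" for h
    using pos.quantile_pos[of h] neg.quantile_pos[of h]
    by (auto simp: pos.quantile_def neg.quantile_def)
  from this(1)[of "neg.cdf_interp (- x) u"] this(2)[of "pos.cdf_interp x u"]
  show ?thesis by (simp add: width_def)
qed

definition regular :: "real \<Rightarrow> real \<Rightarrow> bool" where
  "regular x u \<longleftrightarrow> (0 < x \<longrightarrow> 0 < pos.cdf_interp x u \<and> pos.cdf_interp x u < pos.mass) \<and>
     (x < 0 \<longrightarrow> 0 < neg.cdf_interp (- x) u \<and> neg.cdf_interp (- x) u < neg.mass)"

lemma reciprocating_width:
  assumes "regular x u"
  shows "real_of_ereal \<bar>ereal x - reciprocating \<nu> (ereal x) u\<bar> = width x u"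
proof -
  consider "0 < x" | "x < 0" | "x = 0" by linarith
  then show ?thesis
  proof cases
    case 1
    then have r: "0 < pos.cdf_interp x u" "pos.cdf_interp x u < pos.mass" using assms by (auto simp: regular_def)
    then have "0 < neg.quantile (pos.cdf_interp x u)" by (intro neg.quantile_pos) (auto simp: mass_eq)
    then show ?thesis using 1 r
      by (simp add: reciprocating_def G_tilde_pos x_minus_eq mass_eq width_def)
  next
    case 2
    then have r: "0 < neg.cdf_interp (- x) u" "neg.cdf_interp (- x) u < neg.mass" using assms by (auto simp: regular_def)
    then have "0 < pos.quantile (neg.cdf_interp (- x) u)" by (intro pos.quantile_pos) (auto simp: mass_eq)
    then show ?thesis using 2 r
      by (simp add: reciprocating_def G_tilde_neg x_plus_eq mass_eq width_def)
  next
    case 3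
    then show ?thesis by (simp add: reciprocating_def G_tilde_0 x_minus_0 width_def zero_ereal_def[symmetric])
  qed
qed

lemma AE_regular: "AE z in \<nu> \<Otimes>\<^sub>M unif. regular (fst z) (snd z)"
proof -
  interpret unif: prob_space unif by (rule prob_space_unif)
  interpret P: pair_sigma_finite \<nu> unif ..
  have "AE x in \<nu>. 0 < x \<longrightarrow> (AE u in unif. 0 < pos.cdf_interp x u \<and> pos.cdf_interp x u < pos.mass)"
    using pos.AE_cdf_interp unfolding pos_part_measure_def by (subst (asm) AE_density) auto
  moreover have "AE x in \<nu>. x < 0 \<longrightarrow> (AE u in unif. 0 < neg.cdf_interp (- x) u \<and> neg.cdf_interp (- x) u < neg.mass)"
  proof -
    have "AE y in reflected. 0 < y \<longrightarrow> (AE u in unif. 0 < neg.cdf_interp y u \<and> neg.cdf_interp y u < neg.mass)"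
      using neg.AE_cdf_interp unfolding pos_part_measure_def
      by (subst (asm) AE_density) (auto simp: reflected_def)
    moreover have "AE x in \<nu>. P (- x)" if "AE x in reflected. P x" for P
      by (rule AE_distrD[OF _ that[unfolded reflected_def]]) simp
    ultimately show ?thesis by fastforce
  qed
  ultimately have "AE x in \<nu>. AE u in unif. regular x u"
  proof eventually_elim
    case (elim x)
    consider "0 < x" | "x < 0" | "x = 0" by linarith
    then show ?case using elim by cases (auto simp: regular_def)
  qed
  moreover have "{z \<in> space (\<nu> \<Otimes>\<^sub>M unif). regular (fst z) (snd z)} \<in> sets (\<nu> \<Otimes>\<^sub>M unif)"
    unfolding regular_def by measurable
  ultimately show ?thesis by (intro P.AE_pair_measure) simp_all
qed

text \<open>The law \<open>\<nu>\<close> is a mixture, over the level \<open>h\<close>, of the zero-mean two-point laws on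
  \<open>{- a, b}\<close>, where \<open>a\<close> and \<open>b\<close> are the two quantiles of \<open>h\<close>; here \<open>W = a + b\<close>.\<close>
lemma disintegration:
  fixes k :: "real \<Rightarrow> real \<Rightarrow> ennreal"
  assumes k [measurable]: "(\<lambda>(x, w). k x w) \<in> borel_measurable (borel \<Otimes>\<^sub>M borel)"
  shows "(\<integral>\<^sup>+ x. \<integral>\<^sup>+ u. k x (width x u) \<partial>unif \<partial>\<nu>) = k 0 0 * emeasure \<nu> {0} +
    (\<integral>\<^sup>+ h. (let a = neg.quantile h; b = pos.quantile h in
        ennreal (1 / b) * k b (a + b) + ennreal (1 / a) * k (- a) (a + b)) * indicator {0<..<pos.mass} h \<partial>lborel)"
proof -
  interpret unif: prob_space unif by (rule prob_space_unif)
  have sp: "space unif = UNIV" by simp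
  have u1: "emeasure unif UNIV = 1" using unif.emeasure_space_1 unfolding sp .
  define F where "F x = (\<integral>\<^sup>+ u. k x (width x u) \<partial>unif)" for x
  have [measurable]: "F \<in> borel_measurable borel" unfolding F_def by measurable
  have "(\<integral>\<^sup>+ x. F x \<partial>\<nu>) = (\<integral>\<^sup>+ x. F x * indicator {0} x + (F x * indicator {0<..} x + F x * indicator {..<0} x) \<partial>\<nu>)"
    by (intro nn_integral_cong) (auto simp: indicator_def)
  also have "\<dots> = (\<integral>\<^sup>+ x. F x * indicator {0} x \<partial>\<nu>) + ((\<integral>\<^sup>+ x. F x * indicator {0<..} x \<partial>\<nu>) + (\<integral>\<^sup>+ x. F x * indicator {..<0} x \<partial>\<nu>))"
    by (simp add: nn_integral_add)
  also have "(\<integral>\<^sup>+ x. F x * indicator {0} x \<partial>\<nu>) = k 0 0 * emeasure \<nu> {0}"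
    by (subst nn_integral_indicator_singleton)
       (auto simp: F_def width_def u1 simp del: emeasure_uniform_measure)
  also have "(\<integral>\<^sup>+ x. F x * indicator {0<..} x \<partial>\<nu>)
      = (\<integral>\<^sup>+ h. (ennreal (1 / pos.quantile h) * k (pos.quantile h) (neg.quantile h + pos.quantile h)) * indicator {0<..<pos.mass} h \<partial>lborel)"
  proof -
    \<comment> \<open>Dividing by x passes from \<nu> to z \<nu>(dz), under which the level is
      uniform; this produces the weight 1 / b at b.\<close>
    have "(\<integral>\<^sup>+ x. F x * indicator {0<..} x \<partial>\<nu>) = (\<integral>\<^sup>+ x. ennreal (1 / x) * F x \<partial>pos_part_measure \<nu>)"
      by (rule nn_integral_pos_part) auto
    also have "\<dots> = (\<integral>\<^sup>+ x. \<integral>\<^sup>+ u. (ennreal (1 / x) * k x (neg.quantile (pos.cdf_interp x u) + x)) \<partial>unif \<partial>pos_part_measure \<nu>)"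
    proof (rule nn_integral_cong)
      fix x
      show "ennreal (1 / x) * F x = (\<integral>\<^sup>+ u. ennreal (1 / x) * k x (neg.quantile (pos.cdf_interp x u) + x) \<partial>unif)"
      proof (cases "0 < x")
        case True
        then show ?thesis unfolding F_def by (subst nn_integral_cmult[symmetric]) (auto simp: width_def add.commute)
      next
        case False
        then have "ennreal (1 / x) = 0" by (intro ennreal_neg) (simp add: divide_nonpos_nonpos not_less)
        then show ?thesis by simp
      qed
    qed
    also have "\<dots> = (\<integral>\<^sup>+ h. (ennreal (1 / pos.quantile h) * k (pos.quantile h) (neg.quantile h + pos.quantile h)) * indicator {0<..<pos.mass} h \<partial>lborel)"
      by (rule pos.nn_integral_cdf_interp[where q = "\<lambda>x h. ennreal (1 / x) * k x (neg.quantile h + x)"]) measurable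
    finally show ?thesis .
  qed
  also have "(\<integral>\<^sup>+ x. F x * indicator {..<0} x \<partial>\<nu>)
      = (\<integral>\<^sup>+ h. (ennreal (1 / neg.quantile h) * k (- neg.quantile h) (neg.quantile h + pos.quantile h)) * indicator {0<..<pos.mass} h \<partial>lborel)"
  proof -
    have "(\<integral>\<^sup>+ x. F x * indicator {..<0} x \<partial>\<nu>) = (\<integral>\<^sup>+ x. F (- x) * indicator {0<..} x \<partial>reflected)"
      unfolding reflected_def by (subst nn_integral_distr) (auto intro!: nn_integral_cong simp: indicator_def)
    also have "\<dots> = (\<integral>\<^sup>+ x. ennreal (1 / x) * F (- x) \<partial>pos_part_measure reflected)"
      by (rule nn_integral_pos_part) (auto simp: reflected_def)
    also have "\<dots> = (\<integral>\<^sup>+ x. \<integral>\<^sup>+ u. (ennreal (1 / x) * k (- x) (x + pos.quantile (neg.cdf_interp x u))) \<partial>unif \<partial>pos_part_measure reflected)"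
    proof (rule nn_integral_cong)
      fix x
      show "ennreal (1 / x) * F (- x) = (\<integral>\<^sup>+ u. ennreal (1 / x) * k (- x) (x + pos.quantile (neg.cdf_interp x u)) \<partial>unif)"
      proof (cases "0 < x")
        case True
        then show ?thesis unfolding F_def by (subst nn_integral_cmult[symmetric]) (auto simp: width_def)
      next
        case False
        then have "ennreal (1 / x) = 0" by (intro ennreal_neg) (simp add: divide_nonpos_nonpos not_less)
        then show ?thesis by simp
      qed
    qed
    also have "\<dots> = (\<integral>\<^sup>+ h. (ennreal (1 / neg.quantile h) * k (- neg.quantile h) (neg.quantile h + pos.quantile h)) * indicator {0<..<neg.mass} h \<partial>lborel)"
      by (rule neg.nn_integral_cdf_interp[where q = "\<lambda>x h. ennreal (1 / x) * k (- x) (x + pos.quantile h)"]) measurable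
    finally show ?thesis by (simp add: mass_eq)
  qed
  finally show ?thesis
    unfolding F_def by (simp add: nn_integral_add[symmetric] Let_def distrib_right)
qed

text \<open>At each level the weights 1 / b at b and 1 / a at -a are the zero-mean weights a and b
  divided by a b. Hence the pointwise two-point inequality integrates over levels; the right-hand
  side is the disintegration of a function of the width alone.\<close>

lemma two_point_domination:
  fixes k :: "real \<Rightarrow> real \<Rightarrow> ennreal" and K :: "real \<Rightarrow> ennreal"
  assumes [measurable]: "(\<lambda>(x, w). k x w) \<in> borel_measurable (borel \<Otimes>\<^sub>M borel)" "K \<in> borel_measurable borel"
    and le: "\<And>a b. 0 < a \<Longrightarrow> 0 < b \<Longrightarrow> ennreal a * k b (a + b) + ennreal b * k (- a) (a + b) \<le> ennreal (a + b) * K (a + b)"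
    and le0: "k 0 0 \<le> K 0"
  shows "(\<integral>\<^sup>+ x. \<integral>\<^sup>+ u. k x (width x u) \<partial>unif \<partial>\<nu>) \<le> (\<integral>\<^sup>+ x. \<integral>\<^sup>+ u. K (width x u) \<partial>unif \<partial>\<nu>)"
proof -
  have main: "ennreal (1 / b) * k b (a + b) + ennreal (1 / a) * k (- a) (a + b)
      \<le> ennreal (1 / b) * K (a + b) + ennreal (1 / a) * K (a + b)" if "0 < a" "0 < b" for a b
  proof -
    have "ennreal (1 / (a * b)) * (ennreal a * k b (a + b) + ennreal b * k (- a) (a + b))
        \<le> ennreal (1 / (a * b)) * (ennreal (a + b) * K (a + b))"
      using le[OF that] by (rule mult_left_mono) simp
    moreover have "ennreal (1 / (a * b)) * ennreal a = ennreal (1 / b)" "ennreal (1 / (a * b)) * ennreal b = ennreal (1 / a)"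
      using that by (simp_all add: ennreal_mult'[symmetric])
    ultimately show ?thesis
      using that by (simp add: distrib_left distrib_right mult.assoc[symmetric] ennreal_plus)
  qed
  have level: "(let a = neg.quantile h; b = pos.quantile h in
        ennreal (1 / b) * k b (a + b) + ennreal (1 / a) * k (- a) (a + b)) * indicator {0<..<pos.mass} h
      \<le> (let a = neg.quantile h; b = pos.quantile h in
        ennreal (1 / b) * K (a + b) + ennreal (1 / a) * K (a + b)) * indicator {0<..<pos.mass} h" for h
  proof (cases "h \<in> {0<..<pos.mass}")
    case True
    then show ?thesis
      using main[of "neg.quantile h" "pos.quantile h"] pos.quantile_pos[of h] neg.quantile_pos[of h]
      by (simp add: Let_def mass_eq)
  qed simp
  show ?thesis
    unfolding disintegration[OF assms(1)] disintegration[of "\<lambda>x w. K w", simplified]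
    using le0 by (intro add_mono mult_right_mono nn_integral_mono level) auto
qed

end

section \<open>Sums of independent mixtures of two-point laws\<close>

lemma nn_integral_std_normal_affine:
  fixes g :: "real \<Rightarrow> ennreal"
  assumes [measurable]: "g \<in> borel_measurable borel" and s: "0 < s"
  shows "(\<integral>\<^sup>+ z. g (c + s * z) \<partial>std_normal) = (\<integral>\<^sup>+ x. ennreal (normal_density 0 s x) * g (c + x) \<partial>lborel)"
proof -
  have eq: "std_normal_density (x / s) / s = normal_density 0 s x" for x
    using s by (simp add: normal_density_def real_sqrt_mult power_divide)
  have "(\<integral>\<^sup>+ z. g (c + s * z) \<partial>std_normal) = (\<integral>\<^sup>+ z. ennreal (std_normal_density z) * g (c + s * z) \<partial>lborel)"
    by (rule nn_integral_std_normal) measurable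
  also have "\<dots> = ennreal (1 / s) * (\<integral>\<^sup>+ x. ennreal (std_normal_density (0 + 1 / s * x)) * g (c + s * (0 + 1 / s * x)) \<partial>lborel)"
    using s by (subst nn_integral_real_affine[where c = "1 / s" and t = 0]) auto
  also have "\<dots> = (\<integral>\<^sup>+ x. ennreal (1 / s) * (ennreal (std_normal_density (0 + 1 / s * x)) * g (c + s * (0 + 1 / s * x))) \<partial>lborel)"
    by (rule nn_integral_cmult[symmetric]) measurable
  also have "\<dots> = (\<integral>\<^sup>+ x. ennreal (normal_density 0 s x) * g (c + x) \<partial>lborel)"
    using s by (intro nn_integral_cong)
      (simp add: mult.assoc[symmetric] ennreal_mult'[symmetric] eq[symmetric])
  finally show ?thesis .
qed

text \<open>Convolution of normal densities; a zero scale has no density and is treated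
  apart.\<close>

lemma nn_integral_std_normal_sum:
  fixes g :: "real \<Rightarrow> ennreal"
  assumes g [measurable]: "g \<in> borel_measurable borel" and s: "0 \<le> s" and r: "0 \<le> r"
  shows "(\<integral>\<^sup>+ y. \<integral>\<^sup>+ z. g (s * y + r * z) \<partial>std_normal \<partial>std_normal)
    = (\<integral>\<^sup>+ z. g (sqrt (s\<^sup>2 + r\<^sup>2) * z) \<partial>std_normal)"
proof -
  have one: "emeasure std_normal UNIV = 1"
    using std_normal.emeasure_space_1 by simp
  consider "s = 0" | "r = 0" | "0 < s" "0 < r" using s r by linarith
  then show ?thesis
  proof cases
    case 3
    have sr: "0 < sqrt (s\<^sup>2 + r\<^sup>2)" using 3 by (simp add: add_pos_pos)
    have "(\<integral>\<^sup>+ y. \<integral>\<^sup>+ z. g (s * y + r * z) \<partial>std_normal \<partial>std_normal)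
        = (\<integral>\<^sup>+ y. \<integral>\<^sup>+ x. ennreal (normal_density 0 r x) * g (s * y + x) \<partial>lborel \<partial>std_normal)"
      by (intro nn_integral_cong nn_integral_std_normal_affine 3) measurable
    also have "\<dots> = (\<integral>\<^sup>+ y. (\<lambda>y. \<integral>\<^sup>+ x. ennreal (normal_density 0 r x) * g (y + x) \<partial>lborel) (0 + s * y) \<partial>std_normal)"
      by simp
    also have "\<dots> = (\<integral>\<^sup>+ y. ennreal (normal_density 0 s y) * (\<integral>\<^sup>+ x. ennreal (normal_density 0 r x) * g (0 + y + x) \<partial>lborel) \<partial>lborel)"
      by (rule nn_integral_std_normal_affine[OF _ 3(1)]) measurable
    also have "\<dots> = (\<integral>\<^sup>+ y. \<integral>\<^sup>+ x. ennreal (normal_density 0 s y) * (ennreal (normal_density 0 r (- y + x)) * g x) \<partial>lborel \<partial>lborel)"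
    proof (intro nn_integral_cong)
      fix y :: real
      have "(\<integral>\<^sup>+ x. ennreal (normal_density 0 r x) * g (0 + y + x) \<partial>lborel)
          = (\<integral>\<^sup>+ x. ennreal (normal_density 0 r (- y + x)) * g x \<partial>lborel)"
        by (subst nn_integral_real_affine[where c = 1 and t = "- y"]) auto
      then show "ennreal (normal_density 0 s y) * (\<integral>\<^sup>+ x. ennreal (normal_density 0 r x) * g (0 + y + x) \<partial>lborel)
        = (\<integral>\<^sup>+ x. ennreal (normal_density 0 s y) * (ennreal (normal_density 0 r (- y + x)) * g x) \<partial>lborel)"
        by (simp add: nn_integral_cmult)
    qed
    also have "\<dots> = (\<integral>\<^sup>+ x. \<integral>\<^sup>+ y. ennreal (normal_density 0 s y) * (ennreal (normal_density 0 r (- y + x)) * g x) \<partial>lborel \<partial>lborel)"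
      by (rule lborel_pair.Fubini') measurable
    also have "\<dots> = (\<integral>\<^sup>+ x. (\<integral>\<^sup>+ y. ennreal (normal_density 0 r (x - y) * normal_density 0 s y) \<partial>lborel) * g x \<partial>lborel)"
      by (subst nn_integral_multc[symmetric])
         (auto intro!: nn_integral_cong simp: ennreal_mult' mult_ac)
    also have "\<dots> = (\<integral>\<^sup>+ x. ennreal (normal_density 0 (sqrt (s\<^sup>2 + r\<^sup>2)) x) * g (0 + x) \<partial>lborel)"
      using conv_normal_density_zero_mean[OF 3(2,1), THEN fun_cong] by (simp add: add.commute)
    also have "\<dots> = (\<integral>\<^sup>+ z. g (0 + sqrt (s\<^sup>2 + r\<^sup>2) * z) \<partial>std_normal)"
      by (rule nn_integral_std_normal_affine[OF g sr, symmetric])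
    finally show ?thesis by simp
  qed (use s r one in auto)
qed

text \<open>A family of pairs \<open>p = (x, u)\<close> with a width \<open>w p\<close> that behaves as if, given the width,
  the first component were a mixture of zero-mean two-point laws on intervals of that width.\<close>
locale two_point_mixture =
  fixes \<rho> :: "'i \<Rightarrow> (real \<times> real) measure" and w :: "'i \<Rightarrow> real \<times> real \<Rightarrow> real"
  assumes prob: "\<And>i. prob_space (\<rho> i)"
    and sets_\<rho> [measurable_cong]: "\<And>i. sets (\<rho> i) = sets (borel \<Otimes>\<^sub>M borel)"
    and w_meas [measurable]: "\<And>i. w i \<in> borel_measurable (borel \<Otimes>\<^sub>M borel)"
    and w_nonneg: "\<And>i p. 0 \<le> w i p"
    and domination: "\<And>i k K. (\<lambda>(x, w). k x w) \<in> borel_measurable (borel \<Otimes>\<^sub>M borel) \<Longrightarrow>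
      K \<in> borel_measurable borel \<Longrightarrow>
      (\<And>a b. 0 < a \<Longrightarrow> 0 < b \<Longrightarrow> ennreal a * k b (a + b) + ennreal b * k (- a) (a + b) \<le> ennreal (a + b) * K (a + b)) \<Longrightarrow>
      k 0 0 \<le> K 0 \<Longrightarrow> (\<integral>\<^sup>+ p. k (fst p) (w i p) \<partial>\<rho> i) \<le> (\<integral>\<^sup>+ p. K (w i p) \<partial>\<rho> i)"
begin

sublocale product_sigma_finite \<rho>
  by (intro product_sigma_finite.intro prob_space_imp_sigma_finite prob)

definition var :: "'i set \<Rightarrow> ('i \<Rightarrow> real \<times> real) \<Rightarrow> real" where
  "var I p = (\<Sum>i\<in>I. (w i (p i))\<^sup>2 / 4)"

definition total :: "'i set \<Rightarrow> ('i \<Rightarrow> real \<times> real) \<Rightarrow> real" where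
  "total I p = (\<Sum>i\<in>I. fst (p i))"

lemma measurable_var [measurable]: "var I \<in> borel_measurable (PiM I \<rho>)"
  unfolding var_def by measurable

lemma measurable_total [measurable]: "total I \<in> borel_measurable (PiM I \<rho>)"
  unfolding total_def by measurable

lemma var_nonneg: "0 \<le> var I p"
  unfolding var_def by (intro sum_nonneg) auto

text \<open>Each replacement changes the first argument of \<open>L\<close> and keeps the second,
  which carries the random denominator. The statement must hold for all such \<open>L\<close>
  because the induction shifts both arguments.\<close>

lemma two_point_mixture_gaussian_le:
  fixes L :: "real \<Rightarrow> real \<Rightarrow> ennreal"
  assumes "finite I"
    and L: "(\<lambda>(x, v). L x v) \<in> borel_measurable (borel \<Otimes>\<^sub>M borel)"
    and two: "\<And>c v a b. 0 < a \<Longrightarrow> 0 < b \<Longrightarrow>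
      ennreal a * L (c + b) v + ennreal b * L (c - a) v \<le> ennreal (a + b) * (\<integral>\<^sup>+ z. L (c + (a + b) / 2 * z) v \<partial>std_normal)"
  shows "(\<integral>\<^sup>+ p. L (total I p) (var I p) \<partial>PiM I \<rho>)
    \<le> (\<integral>\<^sup>+ p. \<integral>\<^sup>+ z. L (sqrt (var I p) * z) (var I p) \<partial>std_normal \<partial>PiM I \<rho>)"
  using assms
proof (induction I arbitrary: L rule: finite_induct)
  case empty
  have one: "emeasure std_normal UNIV = 1"
    using std_normal.emeasure_space_1 by simp
  show ?case by (simp add: total_def var_def one)
next
  case (insert j I)
  note [measurable] = insert.prems(1)
  let ?N = "std_normal"
  interpret I: prob_space "PiM I \<rho>" by (rule prob_space_PiM) (rule prob)
  interpret jN: pair_sigma_finite "\<rho> j" "PiM I \<rho> \<Otimes>\<^sub>M ?N"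
    by (intro pair_sigma_finite.intro prob_space_imp_sigma_finite prob prob_space_pair
        I.prob_space_axioms std_normal.prob_space_axioms)
  have tot: "total (insert j I) (p(j := q)) = fst q + total I p" for p q
    using insert.hyps by (simp add: total_def) (intro sum.cong, auto)
  have var: "var (insert j I) (p(j := q)) = (w j q)\<^sup>2 / 4 + var I p" for p q
    using insert.hyps by (simp add: var_def) (intro sum.cong, auto)
  have "(\<integral>\<^sup>+ p. L (total (insert j I) p) (var (insert j I) p) \<partial>PiM (insert j I) \<rho>)
      = (\<integral>\<^sup>+ q. \<integral>\<^sup>+ p. L (fst q + total I p) ((w j q)\<^sup>2 / 4 + var I p) \<partial>PiM I \<rho> \<partial>\<rho> j)"
    by (subst product_nn_integral_insert_rev) (use insert.hyps tot var in auto)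
  \<comment> \<open>For a fixed pair \<open>q\<close> at index \<open>j\<close> the induction
    hypothesis is used with \<open>L\<close> shifted by \<open>fst q\<close> and by the variance
    share of \<open>q\<close>.\<close>
  also have "\<dots> \<le> (\<integral>\<^sup>+ q. \<integral>\<^sup>+ p. \<integral>\<^sup>+ z. L (fst q + sqrt (var I p) * z) ((w j q)\<^sup>2 / 4 + var I p) \<partial>?N \<partial>PiM I \<rho> \<partial>\<rho> j)"
  proof (rule nn_integral_mono)
    fix q :: "real \<times> real"
    show "(\<integral>\<^sup>+ p. L (fst q + total I p) ((w j q)\<^sup>2 / 4 + var I p) \<partial>PiM I \<rho>)
      \<le> (\<integral>\<^sup>+ p. \<integral>\<^sup>+ z. L (fst q + sqrt (var I p) * z) ((w j q)\<^sup>2 / 4 + var I p) \<partial>?N \<partial>PiM I \<rho>)"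
    proof (rule insert.IH[where L = "\<lambda>x v. L (fst q + x) ((w j q)\<^sup>2 / 4 + v)"])
      fix c v a b :: real assume "0 < a" "0 < b"
      from insert.prems(2)[OF this, of "fst q + c" "(w j q)\<^sup>2 / 4 + v"]
      show "ennreal a * L (fst q + (c + b)) ((w j q)\<^sup>2 / 4 + v) + ennreal b * L (fst q + (c - a)) ((w j q)\<^sup>2 / 4 + v)
        \<le> ennreal (a + b) * (\<integral>\<^sup>+ z. L (fst q + (c + (a + b) / 2 * z)) ((w j q)\<^sup>2 / 4 + v) \<partial>?N)"
        by (simp add: add.assoc add_diff_eq)
    qed measurable
  qed
  also have "\<dots> = (\<integral>\<^sup>+ q. \<integral>\<^sup>+ r. L (fst q + sqrt (var I (fst r)) * snd r) ((w j q)\<^sup>2 / 4 + var I (fst r)) \<partial>(PiM I \<rho> \<Otimes>\<^sub>M ?N) \<partial>\<rho> j)"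
    by (intro nn_integral_cong, subst std_normal.nn_integral_fst[symmetric]) auto
  \<comment> \<open>The pair at \<open>j\<close> becomes innermost, so that
    \<open>domination\<close> applies with the other widths and their normal variable held
    fixed.\<close>
  also have "\<dots> = (\<integral>\<^sup>+ r. \<integral>\<^sup>+ q. L (fst q + sqrt (var I (fst r)) * snd r) ((w j q)\<^sup>2 / 4 + var I (fst r)) \<partial>\<rho> j \<partial>(PiM I \<rho> \<Otimes>\<^sub>M ?N))"
    by (rule jN.Fubini'[symmetric]) measurable
  also have "\<dots> \<le> (\<integral>\<^sup>+ r. \<integral>\<^sup>+ q. \<integral>\<^sup>+ z. L (sqrt (var I (fst r)) * snd r + w j q / 2 * z) ((w j q)\<^sup>2 / 4 + var I (fst r)) \<partial>?N \<partial>\<rho> j \<partial>(PiM I \<rho> \<Otimes>\<^sub>M ?N))"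
  proof (rule nn_integral_mono)
    fix r :: "('i \<Rightarrow> real \<times> real) \<times> real"
    define c v where "c = sqrt (var I (fst r)) * snd r" and "v = var I (fst r)"
    have one: "emeasure std_normal UNIV = 1"
      using std_normal.emeasure_space_1 by simp
    have "(\<integral>\<^sup>+ q. L (fst q + c) ((w j q)\<^sup>2 / 4 + v) \<partial>\<rho> j) \<le> (\<integral>\<^sup>+ q. \<integral>\<^sup>+ z. L (c + w j q / 2 * z) ((w j q)\<^sup>2 / 4 + v) \<partial>?N \<partial>\<rho> j)"
    proof (rule domination[where k = "\<lambda>x w. L (x + c) (w\<^sup>2 / 4 + v)" and K = "\<lambda>w. \<integral>\<^sup>+ z. L (c + w / 2 * z) (w\<^sup>2 / 4 + v) \<partial>?N"])
      fix a b :: real assume "0 < a" "0 < b"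
      from insert.prems(2)[OF this, of c "(a + b)\<^sup>2 / 4 + v"]
      show "ennreal a * L (b + c) ((a + b)\<^sup>2 / 4 + v) + ennreal b * L (- a + c) ((a + b)\<^sup>2 / 4 + v)
        \<le> ennreal (a + b) * (\<integral>\<^sup>+ z. L (c + (a + b) / 2 * z) ((a + b)\<^sup>2 / 4 + v) \<partial>?N)"
        by (simp add: add.commute)
    qed (auto simp: one)
    then show "(\<integral>\<^sup>+ q. L (fst q + sqrt (var I (fst r)) * snd r) ((w j q)\<^sup>2 / 4 + var I (fst r)) \<partial>\<rho> j)
      \<le> (\<integral>\<^sup>+ q. \<integral>\<^sup>+ z. L (sqrt (var I (fst r)) * snd r + w j q / 2 * z) ((w j q)\<^sup>2 / 4 + var I (fst r)) \<partial>?N \<partial>\<rho> j)"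
      by (simp add: c_def v_def)
  qed
  also have "\<dots> = (\<integral>\<^sup>+ q. \<integral>\<^sup>+ r. \<integral>\<^sup>+ z. L (sqrt (var I (fst r)) * snd r + w j q / 2 * z) ((w j q)\<^sup>2 / 4 + var I (fst r)) \<partial>?N \<partial>(PiM I \<rho> \<Otimes>\<^sub>M ?N) \<partial>\<rho> j)"
    by (rule jN.Fubini') measurable
  also have "\<dots> = (\<integral>\<^sup>+ q. \<integral>\<^sup>+ p. \<integral>\<^sup>+ y. \<integral>\<^sup>+ z. L (sqrt (var I p) * y + w j q / 2 * z) ((w j q)\<^sup>2 / 4 + var I p) \<partial>?N \<partial>?N \<partial>PiM I \<rho> \<partial>\<rho> j)"
    by (intro nn_integral_cong, subst std_normal.nn_integral_fst[symmetric]) auto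
  \<comment> \<open>The two independent normal variables merge into one, whose variance is exactly
    the second argument of \<open>L\<close>.\<close>
  also have "\<dots> = (\<integral>\<^sup>+ q. \<integral>\<^sup>+ p. \<integral>\<^sup>+ z. L (sqrt ((w j q)\<^sup>2 / 4 + var I p) * z) ((w j q)\<^sup>2 / 4 + var I p) \<partial>?N \<partial>PiM I \<rho> \<partial>\<rho> j)"
  proof (rule nn_integral_cong, rule nn_integral_cong)
    fix q :: "real \<times> real" and p :: "'i \<Rightarrow> real \<times> real"
    have e: "(sqrt (var I p))\<^sup>2 + (w j q / 2)\<^sup>2 = (w j q)\<^sup>2 / 4 + var I p"
      using var_nonneg[of I p] by (simp add: power_divide)
    show "(\<integral>\<^sup>+ y. \<integral>\<^sup>+ z. L (sqrt (var I p) * y + w j q / 2 * z) ((w j q)\<^sup>2 / 4 + var I p) \<partial>?N \<partial>?N)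
      = (\<integral>\<^sup>+ z. L (sqrt ((w j q)\<^sup>2 / 4 + var I p) * z) ((w j q)\<^sup>2 / 4 + var I p) \<partial>?N)"
      unfolding e[symmetric] using var_nonneg[of I p] w_nonneg[of j q]
      by (intro nn_integral_std_normal_sum) auto
  qed
  also have "\<dots> = (\<integral>\<^sup>+ p. \<integral>\<^sup>+ z. L (sqrt (var (insert j I) p) * z) (var (insert j I) p) \<partial>?N \<partial>PiM (insert j I) \<rho>)"
    by (subst product_nn_integral_insert_rev) (use insert.hyps var in auto)
  finally show ?case .
qed

end

text \<open>Independence is given between the vector of all \<open>X i\<close> and the vector of all
  \<open>U i\<close>, whereas the mixture argument needs a product over indices of laws of pairs;
  this reorders one into the other.\<close>

lemma nn_integral_PiM_pair:
  fixes \<nu> \<mu> :: "'i \<Rightarrow> real measure" and f :: "('i \<Rightarrow> real \<times> real) \<Rightarrow> ennreal"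
  assumes "finite I" and \<nu>: "\<And>i. prob_space (\<nu> i)" "\<And>i. sets (\<nu> i) = sets borel"
    and \<mu>: "\<And>i. prob_space (\<mu> i)" "\<And>i. sets (\<mu> i) = sets borel"
    and "f \<in> borel_measurable (PiM I (\<lambda>_. borel \<Otimes>\<^sub>M borel))"
  shows "(\<integral>\<^sup>+ p. f p \<partial>PiM I (\<lambda>i. \<nu> i \<Otimes>\<^sub>M \<mu> i))
    = (\<integral>\<^sup>+ x. \<integral>\<^sup>+ u. f (\<lambda>i\<in>I. (x i, u i)) \<partial>PiM I \<mu> \<partial>PiM I \<nu>)"
  using assms(1,6)
proof (induction I arbitrary: f rule: finite_induct)
  case empty
  have "emeasure (PiM {} \<nu>) (space (PiM {} \<nu>)) = 1" "emeasure (PiM {} \<mu>) (space (PiM {} \<mu>)) = 1"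
    using \<nu> \<mu> by (intro prob_space.emeasure_space_1 prob_space_PiM; simp)+
  then show ?case by (simp add: PiM_empty nn_integral_count_space_finite)
next
  case (insert j I)
  note [measurable_cong] = \<nu>(2) \<mu>(2) and [measurable] = insert.prems
  interpret \<nu>: product_sigma_finite \<nu> by (intro product_sigma_finite.intro prob_space_imp_sigma_finite \<nu>)
  interpret \<mu>: product_sigma_finite \<mu> by (intro product_sigma_finite.intro prob_space_imp_sigma_finite \<mu>)
  interpret P: product_sigma_finite "\<lambda>i. \<nu> i \<Otimes>\<^sub>M \<mu> i"
    by (intro product_sigma_finite.intro prob_space_imp_sigma_finite prob_space_pair \<nu> \<mu>)
  interpret \<mu>j: prob_space "\<mu> j" by (rule \<mu>)
  interpret I: prob_space "PiM I \<nu>" by (rule prob_space_PiM) (rule \<nu>)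
  interpret \<mu>I: prob_space "PiM I \<mu>" by (rule prob_space_PiM) (rule \<mu>)
  interpret \<mu>jI: prob_space "PiM (insert j I) \<mu>" by (rule prob_space_PiM) (rule \<mu>)
  interpret S: pair_sigma_finite "PiM I \<nu>" "\<mu> j" ..
  have [measurable_cong]: "sets (PiM A \<nu>) = sets (PiM A (\<lambda>_. borel))" "sets (PiM A \<mu>) = sets (PiM A (\<lambda>_. borel))"
    "sets (PiM A (\<lambda>i. \<nu> i \<Otimes>\<^sub>M \<mu> i)) = sets (PiM A (\<lambda>_. borel \<Otimes>\<^sub>M borel))" for A
    by (intro sets_PiM_cong sets_pair_measure_cong refl \<nu> \<mu>)+
  have sp: "space (\<nu> i) = UNIV" "space (\<mu> i) = UNIV" for i
    using \<nu>(2)[THEN sets_eq_imp_space_eq] \<mu>(2)[THEN sets_eq_imp_space_eq] by auto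
  have upd: "(\<lambda>i\<in>insert j I. ((x(j := y)) i, (u(j := v)) i)) = (\<lambda>i\<in>I. (x i, u i))(j := (y, v))" for x u y v
    using insert.hyps by (auto simp: fun_eq_iff)
  have "(\<integral>\<^sup>+ p. f p \<partial>PiM (insert j I) (\<lambda>i. \<nu> i \<Otimes>\<^sub>M \<mu> i))
      = (\<integral>\<^sup>+ q. \<integral>\<^sup>+ p. f (p(j := q)) \<partial>PiM I (\<lambda>i. \<nu> i \<Otimes>\<^sub>M \<mu> i) \<partial>(\<nu> j \<Otimes>\<^sub>M \<mu> j))"
    by (rule P.product_nn_integral_insert_rev) (use insert.hyps in auto)
  also have "\<dots> = (\<integral>\<^sup>+ q. \<integral>\<^sup>+ x. \<integral>\<^sup>+ u. f ((\<lambda>i\<in>I. (x i, u i))(j := q)) \<partial>PiM I \<mu> \<partial>PiM I \<nu> \<partial>(\<nu> j \<Otimes>\<^sub>M \<mu> j))"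
    by (intro nn_integral_cong insert.IH) (measurable, auto simp: space_pair_measure sp)
  also have "\<dots> = (\<integral>\<^sup>+ y. \<integral>\<^sup>+ v. \<integral>\<^sup>+ x. \<integral>\<^sup>+ u. f ((\<lambda>i\<in>I. (x i, u i))(j := (y, v))) \<partial>PiM I \<mu> \<partial>PiM I \<nu> \<partial>\<mu> j \<partial>\<nu> j)"
    by (subst sigma_finite_measure.nn_integral_fst[OF prob_space_imp_sigma_finite[OF \<mu>(1)], symmetric]) auto
  also have "\<dots> = (\<integral>\<^sup>+ y. \<integral>\<^sup>+ x. \<integral>\<^sup>+ v. \<integral>\<^sup>+ u. f ((\<lambda>i\<in>I. (x i, u i))(j := (y, v))) \<partial>PiM I \<mu> \<partial>\<mu> j \<partial>PiM I \<nu> \<partial>\<nu> j)"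
    by (intro nn_integral_cong S.Fubini') measurable
  also have "\<dots> = (\<integral>\<^sup>+ y. \<integral>\<^sup>+ x. \<integral>\<^sup>+ u. f (\<lambda>i\<in>insert j I. ((x(j := y)) i, u i)) \<partial>PiM (insert j I) \<mu> \<partial>PiM I \<nu> \<partial>\<nu> j)"
    unfolding upd[symmetric]
    by (intro nn_integral_cong \<mu>.product_nn_integral_insert_rev[symmetric]) (use insert.hyps in auto)
  also have "\<dots> = (\<integral>\<^sup>+ x. \<integral>\<^sup>+ u. f (\<lambda>i\<in>insert j I. (x i, u i)) \<partial>PiM (insert j I) \<mu> \<partial>PiM (insert j I) \<nu>)"
    by (intro \<nu>.product_nn_integral_insert_rev[symmetric]) (use insert.hyps in auto)
  finally show ?case .
qed

text \<open>Covers the event that all widths vanish, where the quotient is 0; in substance this is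
  Jensen's inequality at the mean of Z.\<close>

lemma trunc5_0_le_normal_G5: "trunc5 t 0 \<le> normal_moment5 t"
proof (cases "0 \<le> t")
  case True
  then show ?thesis using normal_moment5_nonneg by simp
next
  case False
  define \<tau> where "\<tau> = - t"
  have "0 \<le> \<tau>" using False by (simp add: \<tau>_def)
  then have "\<tau>^5 \<le> \<tau>^5 + 10 * \<tau>^3 + 15 * \<tau> + normal_moment5 \<tau>"
    using normal_moment5_nonneg[of \<tau>] by simp
  also have "\<dots> = normal_moment5 t" using normal_moment5_minus[of \<tau>] by (simp add: \<tau>_def)
  finally show ?thesis using False by (simp add: \<tau>_def max_def)
qed

text \<open>The two-point inequality is required for every real v, and \<open>sqrt\<close> is odd.
  With \<open>max 0 v\<close> the function is constant in x for v \<le> 0, since division by 0 gives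
  0, and the inequality becomes an equality.\<close>

definition normalized_trunc5 :: "real \<Rightarrow> real \<Rightarrow> real \<Rightarrow> ennreal" where
  "normalized_trunc5 t x v = ennreal (trunc5 t (x / sqrt (max 0 v)))"

lemma measurable_normalized_trunc5:
  "(\<lambda>(x, v). normalized_trunc5 t x v) \<in> borel_measurable (borel \<Otimes>\<^sub>M borel)"
  unfolding normalized_trunc5_def by measurable

lemma normalized_trunc5_two_point:
  assumes ab: "0 < a" "0 < b"
  shows "ennreal a * normalized_trunc5 t (c + b) v + ennreal b * normalized_trunc5 t (c - a) v
    \<le> ennreal (a + b) * (\<integral>\<^sup>+ z. normalized_trunc5 t (c + (a + b) / 2 * z) v \<partial>std_normal)"
proof (cases "0 < v")
  case False
  have one: "emeasure std_normal UNIV = 1" using std_normal.emeasure_space_1 by simp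
  have "max 0 v = 0" using False by simp
  then show ?thesis
    using ab by (simp add: normalized_trunc5_def one distrib_right)
next
  case True
  define s where "s = sqrt (max 0 v)"
  have s: "0 < s" using True by (simp add: s_def)
  \<comment> \<open>Half the distance of the two points in units of s. Dividing by r, after shifting
    by c / s, reduces to points -a' and b' at distance 2.\<close>
  define r where "r = (a + b) / (2 * s)"
  have r: "0 < r" using ab s by (simp add: r_def)
  define t' where "t' = (t - c / s) / r"
  define a' where "a' = 2 * a / (a + b)"
  define b' where "b' = 2 * b / (a + b)"
  have "2 * a / (a + b) + 2 * b / (a + b) = 2 * (a + b) / (a + b)"
    by (simp add: add_divide_distrib[symmetric] distrib_left)
  also have "\<dots> = 2" using ab by (intro nonzero_mult_div_cancel_right) auto
  finally have ab': "0 < a'" "0 < b'" "a' + b' = 2"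
    using ab by (auto simp: a'_def b'_def)
  have scale: "trunc5 t ((c + (a + b) / 2 * y) / s) = r^5 * trunc5 t' y" for y
  proof -
    have "(c + (a + b) / 2 * y) / s - t = r * (y - t')"
    proof -
      have "r * t' = t - c / s" "r * y = (a + b) / 2 * y / s" using r by (simp_all add: t'_def) (simp add: r_def)
      then show ?thesis by (simp add: right_diff_distrib add_divide_distrib)
    qed
    moreover have "max 0 (r * (y - t')) = r * max 0 (y - t')"
      using r by (simp add: max_mult_distrib_left)
    ultimately show ?thesis by (simp add: power_mult_distrib)
  qed
  have "(a + b) / 2 * b' = b" "(a + b) / 2 * - a' = - a"
    using ab by (simp_all add: a'_def b'_def)
  then have ends: "trunc5 t ((c + b) / s) = r^5 * trunc5 t' b'" "trunc5 t ((c - a) / s) = r^5 * trunc5 t' (- a')"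
    using scale[of b'] scale[of "- a'"] by simp_all
  have "(\<integral>\<^sup>+ z. normalized_trunc5 t (c + (a + b) / 2 * z) v \<partial>std_normal) = ennreal (r^5 * normal_moment5 t')"
    unfolding normalized_trunc5_def s_def[symmetric] scale
    using r by (simp add: ennreal_mult' nn_integral_cmult nn_integral_trunc5_std_normal)
  moreover have "ennreal a * normalized_trunc5 t (c + b) v + ennreal b * normalized_trunc5 t (c - a) v
      = ennreal (a * (r^5 * trunc5 t' b') + b * (r^5 * trunc5 t' (- a')))"
    unfolding normalized_trunc5_def s_def[symmetric] ends
    using ab r by (simp add: ennreal_mult'[symmetric] ennreal_plus)
  moreover have "a * (r^5 * trunc5 t' b') + b * (r^5 * trunc5 t' (- a')) \<le> (a + b) * (r^5 * normal_moment5 t')"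
  proof -
    have "a * (r^5 * trunc5 t' b') + b * (r^5 * trunc5 t' (- a'))
        = (a + b) * r^5 * ((a' * trunc5 t' b' + b' * trunc5 t' (- a')) / 2)"
    proof -
      have "a = (a + b) * a' / 2" "b = (a + b) * b' / 2" using ab by (simp_all add: a'_def b'_def)
      then have "a * (r^5 * x) + b * (r^5 * y) = (a + b) * r^5 * ((a' * x + b' * y) / 2)" for x y
        by algebra
      then show ?thesis by blast
    qed
    also have "\<dots> \<le> (a + b) * r^5 * normal_moment5 t'"
      using two_point_trunc5[OF ab'] ab r by (intro mult_left_mono) auto
    finally show ?thesis by (simp add: mult.assoc)
  qed
  moreover have "ennreal (a + b) * ennreal (r^5 * normal_moment5 t') = ennreal ((a + b) * (r^5 * normal_moment5 t'))"
    using ab by (intro ennreal_mult'[symmetric]) auto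
  ultimately show ?thesis by (simp only: ennreal_leI)
qed

lemma (in two_point_mixture) nn_integral_trunc5_le:
  assumes "finite I"
  shows "(\<integral>\<^sup>+ p. ennreal (trunc5 t (total I p / sqrt (var I p))) \<partial>PiM I \<rho>) \<le> ennreal (normal_moment5 t)"
proof -
  interpret I: prob_space "PiM I \<rho>" by (rule prob_space_PiM) (rule prob)
  have one: "emeasure std_normal UNIV = 1" using std_normal.emeasure_space_1 by simp
  have "(\<integral>\<^sup>+ p. ennreal (trunc5 t (total I p / sqrt (var I p))) \<partial>PiM I \<rho>)
      = (\<integral>\<^sup>+ p. normalized_trunc5 t (total I p) (var I p) \<partial>PiM I \<rho>)"
    using var_nonneg by (simp add: normalized_trunc5_def)
  also have "\<dots> \<le> (\<integral>\<^sup>+ p. \<integral>\<^sup>+ z. normalized_trunc5 t (sqrt (var I p) * z) (var I p) \<partial>std_normal \<partial>PiM I \<rho>)"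
    by (intro two_point_mixture_gaussian_le assms measurable_normalized_trunc5 normalized_trunc5_two_point)
  also have "\<dots> \<le> (\<integral>\<^sup>+ p. ennreal (normal_moment5 t) \<partial>PiM I \<rho>)"
  proof (rule nn_integral_mono)
    fix p
    show "(\<integral>\<^sup>+ z. normalized_trunc5 t (sqrt (var I p) * z) (var I p) \<partial>std_normal) \<le> ennreal (normal_moment5 t)"
    proof (cases "var I p = 0")
      case True
      then show ?thesis using trunc5_0_le_normal_G5[of t]
        by (simp add: normalized_trunc5_def one ennreal_leI)
    next
      case False
      then have "sqrt (max 0 (var I p)) = sqrt (var I p)" "sqrt (var I p) \<noteq> 0"
        using var_nonneg[of I p] by auto
      then show ?thesis by (simp add: normalized_trunc5_def nn_integral_trunc5_std_normal)
    qed
  qed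
  finally show ?thesis by (simp add: I.emeasure_space_1)
qed

section \<open>The self-normalized sum\<close>

theorem corollary2p5:
  fixes M :: "'a measure" and X U :: "nat \<Rightarrow> 'a \<Rightarrow> real" and n :: nat
    and N :: "'b measure" and Z :: "'b \<Rightarrow> real"
  assumes "prob_space M"
    and "prob_space.indep_vars M (\<lambda>_. borel) X {1..n}"
    and "\<And>i. i \<in> {1..n} \<Longrightarrow> integrable M (X i)"
    and "\<And>i. i \<in> {1..n} \<Longrightarrow> (\<integral>\<omega>. X i \<omega> \<partial>M) = 0"
    and "prob_space.indep_vars M (\<lambda>_. borel) U {1..n}"
    and "\<And>i. i \<in> {1..n} \<Longrightarrow> distr M borel (U i) = uniform_measure lborel {0..1}"
    and "prob_space.indep_var M
           (Pi\<^sub>M {1..n} (\<lambda>_. borel)) (\<lambda>\<omega>. \<lambda>i\<in>{1..n}. X i \<omega>)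
           (Pi\<^sub>M {1..n} (\<lambda>_. borel)) (\<lambda>\<omega>. \<lambda>i\<in>{1..n}. U i \<omega>)"
    and "prob_space N"
    and "distributed N lborel Z std_normal_density"
  shows "(\<forall>f \<in> H_plus 5.
            (\<integral>\<^sup>+ \<omega>. ennreal (f (S_W M n X U \<omega>)) \<partial>M) \<le> (\<integral>\<^sup>+ \<omega>. ennreal (f (Z \<omega>)) \<partial>N)) \<and>
         (\<forall>x. measure M {\<omega> \<in> space M. x \<le> S_W M n X U \<omega>}
            \<le> c_5_0 * measure N {\<omega> \<in> space N. x \<le> Z \<omega>})"
proof -
  interpret M: prob_space M by fact
  interpret N: prob_space N by fact
  define I where "I = {1..n}"
  have I: "finite I" by (simp add: I_def)
  note indep = assms(2,5,7)[folded I_def]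
  have [measurable]: "X i \<in> borel_measurable M" "U i \<in> borel_measurable M" if "i \<in> I" for i
    using indep(1,2) that by (auto simp: M.indep_vars_def)
  \<comment> \<open>Indices outside \<open>I\<close> receive the point mass at 0, so that every
    member of the family is a zero-mean law as the locales demand.\<close>
  define \<nu> where "\<nu> i = distr M borel (if i \<in> I then X i else (\<lambda>_. 0))" for i
  have \<nu>_I: "\<nu> i = distr M borel (X i)" if "i \<in> I" for i using that by (simp add: \<nu>_def)
  have law: "zero_mean_law (\<nu> i)" for i
  proof -
    let ?Y = "if i \<in> I then X i else (\<lambda>_. 0)"
    have Y: "?Y \<in> borel_measurable M" "integrable M ?Y" "(\<integral>\<omega>. ?Y \<omega> \<partial>M) = 0"
      using assms(3,4)[of i] by (auto simp: I_def)
    show ?thesis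
      unfolding \<nu>_def
    proof (intro zero_mean_law.intro zero_mean_law_axioms.intro)
      show "prob_space (distr M borel ?Y)" by (rule M.prob_space_distr[OF Y(1)])
      show "integrable (distr M borel ?Y) (\<lambda>z. z)" using Y by (subst integrable_distr_eq) auto
      show "(\<integral>z. z \<partial>distr M borel ?Y) = 0" using Y by (subst integral_distr) auto
    qed simp
  qed
  interpret law: zero_mean_law "\<nu> i" for i by (rule law)
  interpret unif: prob_space unif by (rule prob_space_unif)
  define \<rho> where "\<rho> i = \<nu> i \<Otimes>\<^sub>M unif" for i
  define w where "w i p = law.width i (fst p) (snd p)" for i p
  interpret T: two_point_mixture \<rho> w
  proof (rule two_point_mixture.intro)
    show "prob_space (\<rho> i)" for i
      unfolding \<rho>_def by (intro prob_space_pair law.prob_space_axioms unif.prob_space_axioms)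
    show "sets (\<rho> i) = sets (borel \<Otimes>\<^sub>M borel)" for i
      unfolding \<rho>_def by (intro sets_pair_measure_cong) auto
    show w: "w i \<in> borel_measurable (borel \<Otimes>\<^sub>M borel)" for i
      using law.measurable_width[of i] by (simp add: w_def[abs_def] case_prod_beta)
    show "0 \<le> w i p" for i p by (simp add: w_def law.width_nonneg)
    fix i and k :: "real \<Rightarrow> real \<Rightarrow> ennreal" and K :: "real \<Rightarrow> ennreal"
    assume k [measurable]: "(\<lambda>(x, w). k x w) \<in> borel_measurable (borel \<Otimes>\<^sub>M borel)"
      and K [measurable]: "K \<in> borel_measurable borel"
      and le: "\<And>a b. 0 < a \<Longrightarrow> 0 < b \<Longrightarrow> ennreal a * k b (a + b) + ennreal b * k (- a) (a + b) \<le> ennreal (a + b) * K (a + b)"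
      "k 0 0 \<le> K 0"
    note [measurable] = w
    have "(\<integral>\<^sup>+ p. k (fst p) (w i p) \<partial>\<rho> i) = (\<integral>\<^sup>+ x. \<integral>\<^sup>+ u. k x (law.width i x u) \<partial>unif \<partial>\<nu> i)"
      unfolding \<rho>_def by (subst unif.nn_integral_fst[symmetric]) (auto simp: w_def)
    also have "\<dots> \<le> (\<integral>\<^sup>+ x. \<integral>\<^sup>+ u. K (law.width i x u) \<partial>unif \<partial>\<nu> i)"
      by (rule law.two_point_domination[OF k K le])
    also have "\<dots> = (\<integral>\<^sup>+ p. K (w i p) \<partial>\<rho> i)"
      unfolding \<rho>_def by (subst unif.nn_integral_fst[symmetric]) (auto simp: w_def)
    finally show "(\<integral>\<^sup>+ p. k (fst p) (w i p) \<partial>\<rho> i) \<le> (\<integral>\<^sup>+ p. K (w i p) \<partial>\<rho> i)" .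
  qed
  define P where "P \<omega> = (\<lambda>i\<in>I. (X i \<omega>, U i \<omega>))" for \<omega>
  have P [measurable]: "P \<in> measurable M (PiM I (\<lambda>_. borel \<Otimes>\<^sub>M borel))"
    unfolding P_def by measurable
  have joint: "(\<integral>\<^sup>+ \<omega>. f (P \<omega>) \<partial>M) = (\<integral>\<^sup>+ p. f p \<partial>PiM I \<rho>)"
    if f [measurable]: "f \<in> borel_measurable (PiM I (\<lambda>_. borel \<Otimes>\<^sub>M borel))" for f :: "_ \<Rightarrow> ennreal"
  proof (cases "I = {}")
    case True
    then show ?thesis
      by (simp add: P_def PiM_empty nn_integral_count_space_finite M.emeasure_space_1 restrict_def)
  next
    case False
    let ?Xv = "\<lambda>\<omega>. \<lambda>i\<in>I. X i \<omega>" and ?Uv = "\<lambda>\<omega>. \<lambda>i\<in>I. U i \<omega>"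
    \<comment> \<open>This characterisation of independence by a product law is for nonempty
      \<open>I\<close>, hence the separate treatment of n = 0.\<close>
    have "distr M (PiM I (\<lambda>_. borel)) ?Xv = PiM I (\<lambda>i. distr M borel (X i))"
      using indep(1) False by (subst (asm) M.indep_vars_iff_distr_eq_PiM') auto
    also have "\<dots> = PiM I \<nu>" by (intro PiM_cong) (auto simp: \<nu>_I)
    finally have Xv: "distr M (PiM I (\<lambda>_. borel)) ?Xv = PiM I \<nu>" .
    have "distr M (PiM I (\<lambda>_. borel)) ?Uv = PiM I (\<lambda>i. distr M borel (U i))"
      using indep(2) False by (subst (asm) M.indep_vars_iff_distr_eq_PiM') auto
    also have "\<dots> = PiM I (\<lambda>_. unif)" by (intro PiM_cong) (auto simp: assms(6) I_def)
    finally have Uv: "distr M (PiM I (\<lambda>_. borel)) ?Uv = PiM I (\<lambda>_. unif)" .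
    have XU: "distr M (PiM I (\<lambda>_. borel) \<Otimes>\<^sub>M PiM I (\<lambda>_. borel)) (\<lambda>\<omega>. (?Xv \<omega>, ?Uv \<omega>)) = PiM I \<nu> \<Otimes>\<^sub>M PiM I (\<lambda>_. unif)"
      using indep(3) by (subst (asm) M.indep_var_distribution_eq) (simp add: Xv Uv)
    interpret U: prob_space "PiM I (\<lambda>_. unif)" by (intro prob_space_PiM unif.prob_space_axioms)
    have [measurable_cong]: "sets (PiM I \<nu>) = sets (PiM I (\<lambda>_. borel))" "sets (PiM I (\<lambda>_. unif)) = sets (PiM I (\<lambda>_. borel))"
      by (intro sets_PiM_cong; simp)+
    have "(\<integral>\<^sup>+ \<omega>. f (P \<omega>) \<partial>M) = (\<integral>\<^sup>+ \<omega>. (\<lambda>(x, u). f (\<lambda>i\<in>I. (x i, u i))) (?Xv \<omega>, ?Uv \<omega>) \<partial>M)"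
      by (intro nn_integral_cong) (auto simp: P_def intro!: arg_cong[where f = f])
    also have "\<dots> = (\<integral>\<^sup>+ z. (\<lambda>(x, u). f (\<lambda>i\<in>I. (x i, u i))) z \<partial>(PiM I \<nu> \<Otimes>\<^sub>M PiM I (\<lambda>_. unif)))"
      unfolding XU[symmetric] by (subst nn_integral_distr) auto
    also have "\<dots> = (\<integral>\<^sup>+ x. \<integral>\<^sup>+ u. f (\<lambda>i\<in>I. (x i, u i)) \<partial>PiM I (\<lambda>_. unif) \<partial>PiM I \<nu>)"
      by (subst U.nn_integral_fst[symmetric]) auto
    also have "\<dots> = (\<integral>\<^sup>+ p. f p \<partial>PiM I \<rho>)"
      unfolding \<rho>_def[abs_def]
      by (rule nn_integral_PiM_pair[OF I, symmetric])
         (auto intro: law.prob_space_axioms unif.prob_space_axioms)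
    finally show ?thesis .
  qed
  define S where "S \<omega> = T.total I (P \<omega>) / sqrt (T.var I (P \<omega>))" for \<omega>
  have [measurable]: "(\<lambda>p. T.total I p / sqrt (T.var I p)) \<in> borel_measurable (PiM I (\<lambda>_. borel \<Otimes>\<^sub>M borel))"
    unfolding T.total_def T.var_def by measurable
  have S [measurable]: "S \<in> borel_measurable M"
    unfolding S_def by measurable
  have S_trunc: "(\<integral>\<^sup>+ \<omega>. ennreal (trunc5 t (S \<omega>)) \<partial>M) \<le> ennreal (normal_moment5 t)" for t
    unfolding S_def by (subst joint) (auto intro: T.nn_integral_trunc5_le I)
  \<comment> \<open>Each pair \<open>(X i, U i)\<close> has the product of \<open>\<nu> i\<close>
    and the uniform law as its joint law, under which almost every point is regular.\<close>
  have "AE \<omega> in M. \<forall>i\<in>I. W_rv M (X i) (U i) \<omega> = w i (X i \<omega>, U i \<omega>)"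
  proof (subst AE_ball_countable[OF countable_finite[OF I]], rule ballI)
    fix i assume i: "i \<in> I"
    have "M.indep_var borel ((\<lambda>x. x i) \<circ> (\<lambda>\<omega>. \<lambda>i\<in>I. X i \<omega>)) borel ((\<lambda>u. u i) \<circ> (\<lambda>\<omega>. \<lambda>i\<in>I. U i \<omega>))"
      using i by (intro M.indep_var_compose[OF indep(3)]) auto
    then have "M.indep_var borel (X i) borel (U i)" using i by (simp add: comp_def)
    then have D: "distr M (borel \<Otimes>\<^sub>M borel) (\<lambda>\<omega>. (X i \<omega>, U i \<omega>)) = \<nu> i \<Otimes>\<^sub>M unif"
      using i assms(6)[of i] by (simp add: M.indep_var_distribution_eq \<nu>_I I_def)
    have "AE z in distr M (borel \<Otimes>\<^sub>M borel) (\<lambda>\<omega>. (X i \<omega>, U i \<omega>)). law.regular i (fst z) (snd z)"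
      unfolding D by (rule law.AE_regular)
    from AE_distrD[OF _ this] have "AE \<omega> in M. law.regular i (X i \<omega>) (U i \<omega>)"
      using i by simp
    then show "AE \<omega> in M. W_rv M (X i) (U i) \<omega> = w i (X i \<omega>, U i \<omega>)"
    proof eventually_elim
      case (elim \<omega>)
      from law.reciprocating_width[OF this] show ?case
        using i by (simp add: W_rv_def w_def \<nu>_I)
    qed
  qed
  then have AE_S: "AE \<omega> in M. S_W M n X U \<omega> = S \<omega>"
  proof eventually_elim
    case (elim \<omega>)
    have "T.var I (P \<omega>) = (\<Sum>i\<in>I. (W_rv M (X i) (U i) \<omega>)\<^sup>2) / 4"
      using elim by (simp add: T.var_def P_def sum_divide_distrib)
    then have "sqrt (T.var I (P \<omega>)) = 1 / 2 * sqrt (\<Sum>i\<in>I. (W_rv M (X i) (U i) \<omega>)\<^sup>2)"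
      by (simp only: real_sqrt_divide) simp
    moreover have "T.total I (P \<omega>) = (\<Sum>i\<in>I. X i \<omega>)" by (simp add: T.total_def P_def)
    ultimately show ?case unfolding S_W_def S_def I_def[symmetric] by (simp only:)
  qed
  have Z [measurable]: "Z \<in> borel_measurable N" and distr_Z: "distr N borel Z = std_normal"
  proof -
    show "Z \<in> borel_measurable N" using distributed_measurable[OF assms(9)] by simp
    have "distr N borel Z = distr N lborel Z" by (intro distr_cong) auto
    then show "distr N borel Z = std_normal" using distributed_distr_eq_density[OF assms(9)] by simp
  qed
  show ?thesis
  proof (intro conjI ballI allI)
    fix f assume f: "f \<in> H_plus 5"
    have fb: "(\<lambda>x. ennreal (f x)) \<in> borel_measurable borel"
      unfolding H_plus_taylor(4)[OF f] using H_plus_taylor(3)[OF f] by measurable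
    \<comment> \<open>Almost sure equality allows passing to the measurable \<open>S\<close> before
      the image measure is formed.\<close>
    have "(\<integral>\<^sup>+ \<omega>. ennreal (f (S_W M n X U \<omega>)) \<partial>M) = (\<integral>\<^sup>+ \<omega>. ennreal (f (S \<omega>)) \<partial>M)"
      by (rule nn_integral_cong_AE) (use AE_S in eventually_elim, simp)
    also have "\<dots> = (\<integral>\<^sup>+ x. ennreal (f x) \<partial>distr M borel S)"
      using S fb by (simp add: nn_integral_distr)
    also have "\<dots> \<le> (\<integral>\<^sup>+ x. ennreal (f x) \<partial>std_normal)"
    proof (rule H_plus_5_integral_le[OF _ _ _ _ _ f])
      show "finite_measure (distr M borel S)"
        using M.prob_space_distr[OF S] by (rule prob_space.finite_measure)
      show "finite_measure std_normal" by (rule std_normal.finite_measure)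
      show "(\<integral>\<^sup>+ x. ennreal (max 0 (x - t) ^ 5) \<partial>distr M borel S) \<le> (\<integral>\<^sup>+ x. ennreal (max 0 (x - t) ^ 5) \<partial>std_normal)" for t
        using S_trunc[of t] by (subst nn_integral_distr) (auto simp: nn_integral_trunc5_std_normal)
    qed auto
    also have "\<dots> = (\<integral>\<^sup>+ \<omega>. ennreal (f (Z \<omega>)) \<partial>N)"
      unfolding distr_Z[symmetric] using Z fb by (simp add: nn_integral_distr)
    finally show "(\<integral>\<^sup>+ \<omega>. ennreal (f (S_W M n X U \<omega>)) \<partial>M) \<le> (\<integral>\<^sup>+ \<omega>. ennreal (f (Z \<omega>)) \<partial>N)" .
  next
    fix x
    txt \<open>Only \<open>S\<close> is known to be measurable; \<open>measure\<close> vanishes on non-measurable sets.\<close>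
    have "measure M {\<omega> \<in> space M. x \<le> S_W M n X U \<omega>} \<le> measure M {\<omega> \<in> space M. x \<le> S \<omega>}"
    proof (cases "{\<omega> \<in> space M. x \<le> S_W M n X U \<omega>} \<in> sets M")
      case True
      then have "measure M {\<omega> \<in> space M. x \<le> S_W M n X U \<omega>} = measure M {\<omega> \<in> space M. x \<le> S \<omega>}"
        by (intro measure_eq_AE) (use AE_S in eventually_elim, auto)
      then show ?thesis by simp
    qed (simp add: measure_notin_sets)
    also have "\<dots> \<le> c_5_0 * normal_tail x"
      by (rule tail_le_of_trunc5_moments_le[OF M.prob_space_axioms S S_trunc])
    also have "normal_tail x = measure N {\<omega> \<in> space N. x \<le> Z \<omega>}"
    proof -
      have "normal_tail x = measure (distr N borel Z) {x..}" by (simp add: normal_tail_def distr_Z)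
      also have "\<dots> = measure N (Z -` {x..} \<inter> space N)" by (rule measure_distr) auto
      also have "Z -` {x..} \<inter> space N = {\<omega> \<in> space N. x \<le> Z \<omega>}" by auto
      finally show ?thesis .
    qed
    finally show "measure M {\<omega> \<in> space M. x \<le> S_W M n X U \<omega>} \<le> c_5_0 * measure N {\<omega> \<in> space N. x \<le> Z \<omega>}" .
  qed
qed

end
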